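(* Let $n\ge 1$ be an integer and let $X=\{1,2,\dots,n\}$. The proper part of the link of the origin of the space of equidistant cactuses with leaf set $X$ (that is, the geometric realization of the order complex $\Delta(\overline{\mathfrak{P}(X)})$ of the proper part of the poset of ranked cactuses $(\mathfrak{P}(X),\preceq)$) has the homotopy type of a wedge of spheres.
   Context: **The poset.** A *set pair* on $X$ is an ordered pair $(S,H)$ of subsets of $X$. A *set pair system* on $X$ is a collection (set) $\mathcal{S}$ of set pairs $(S,H)$ on $X$ with $S\neq\emptyset$ and $S\cap H=\emptyset$. For a set pair system $\mathcal{S}$ put $\mathcal{P}(\mathcal{S})=\{S:(S,H)\in\mathcal{S}\}$. A set pair system $\mathcal{S}$ is *partition-like* if - (PL1) $\mathcal{P}(\mathcal{S})$ is a partition of $X$; - (PL2) for all $(S,H),(S',H')\in\mathcal{S}$ with $(S,H)\neq(S',H')$ we have $S\neq S'$; - (PL3) for all $(S,H)\in\mathcal{S}$ with $H\neq\emptyset$ we have $(H,\emptyset)\in\mathcal{S}$, and there exists precisely one $(\overline{S},\overline{H})\in\mathcal{S}$ with $(\overline{S},\overline{H})\neq(S,H)$ and $\overline{H}=H$. $\mathfrak{P}(X)$ is the set of all partition-like set pair systems on $X$. For set pairs, $(S_1,H_1)\leq(S_2,H_2)$ means that either $(S_1,H_1)=(S_2,H_2)$, or $(S_1,H_1)\ne(S_2,H_2)$ and one of the following holds: $S_1\cup H_1\subseteq S_2$; or $S_1\subsetneq S_2$ and $H_1=H_2\neq\emptyset$. For $\mathcal{S}_1,\mathcal{S}_2\in\mathfrak{P}(X)$,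 $\mathcal{S}_1\preceq\mathcal{S}_2$ means that - (SP1) for all $(S_1,H_1)\in\mathcal{S}_1$ there exists $(S_2,H_2)\in\mathcal{S}_2$ with $(S_1,H_1)\leq(S_2,H_2)$; and - (SP2) for all $(S_2,H_2)\in\mathcal{S}_2$ with $H_2\neq\emptyset$, if there exists some $(S_1,H_1)\in\mathcal{S}_1$ with $H_1=H_2$, then there exists such an $(S_1,H_1)$ (i.e. in $\mathcal S_1$ with $H_1=H_2$) with $(S_1,H_1)\leq(S_2,H_2)$. It is known that $(\mathfrak{P}(X),\preceq)$ is a bounded graded poset with minimum $\{(\{x\},\emptyset):x\in X\}$, maximum $\{(X,\emptyset)\}$, and all maximal chains of length $n-1$ (the length of a chain being its cardinality minus one). **The space and its link.** The *proper part* $\overline{M}$ of a bounded poset $M$ is obtained by removing its maximum and minimum. The *order complex* of a poset is the abstract simplicial complex whose vertices are the elements of the poset and whose simplices are the chains. The *orthant space* with scaffold complex $K$ (a finite abstract simplicial complex) is obtained by gluing one non-negative orthant $\mathbb{R}_{\geq0}^{\sigma}$ for each simplex $\sigma$ of $K$ along common faces; its *link of the origin* is a geometric realization of $K$ inside the orthant space. The *space of equidistant cactuses* with leaf set $X$ is the orthant space whose scaffold complex is the order complex of $(\mathfrak{P}(X),\preceq)$ with the maximum $\{(X,\emptyset)\}$ removed. The *proper part* of the link of the origin of this space is the part whose scaffold complex is the order complex $\Delta(\overline{\mathfrak{P}(X)})$ of the proper part of $(\mathfrak{P}(X),\preceq)$, i.e. it is the geometric realization of $\Delta(\overline{\mathfrak{P}(X)})$.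 Usual conventions apply in degenerate cases: the empty space is the $(-1)$-dimensional sphere, and a wedge of zero spheres is a point. *)

theory Defs
  imports "HOL-Analysis.Analysis" "HOL-Library.Disjoint_Sets"
begin

section \<open>The poset of ranked cactuses\<close>

type_synonym 'a set_pair = "'a set \<times> 'a set"

definition set_pair_system :: "'a set \<Rightarrow> 'a set_pair set \<Rightarrow> bool" where
  "set_pair_system X \<S> \<longleftrightarrow>
     (\<forall>(S, H) \<in> \<S>. S \<subseteq> X \<and> H \<subseteq> X \<and> S \<noteq> {} \<and> S \<inter> H = {})"

definition partition_like :: "'a set \<Rightarrow> 'a set_pair set \<Rightarrow> bool" where
  "partition_like X \<S> \<longleftrightarrow>
     set_pair_system X \<S> \<and>
     partition_on X (fst ` \<S>) \<and>
     (\<forall>(S, H) \<in> \<S>. \<forall>(S', H') \<in> \<S>. (S, H) \<noteq> (S', H') \<longrightarrow> S \<noteq> S') \<and>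
     (\<forall>(S, H) \<in> \<S>. H \<noteq> {} \<longrightarrow>
        (H, {}) \<in> \<S> \<and> (\<exists>!p. p \<in> \<S> \<and> p \<noteq> (S, H) \<and> snd p = H))"

definition ranked_cactuses :: "'a set \<Rightarrow> 'a set_pair set set" where
  "ranked_cactuses X = {\<S>. partition_like X \<S>}"

definition set_pair_le :: "'a set_pair \<Rightarrow> 'a set_pair \<Rightarrow> bool" where
  "set_pair_le p q \<longleftrightarrow>
     p = q \<or>
     p \<noteq> q \<and> (fst p \<union> snd p \<subseteq> fst q \<or>
              fst p \<subset> fst q \<and> snd p = snd q \<and> snd q \<noteq> {})"

definition cactus_le :: "'a set_pair set \<Rightarrow> 'a set_pair set \<Rightarrow> bool" where
  "cactus_le \<S>\<^sub>1 \<S>\<^sub>2 \<longleftrightarrow>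
     (\<forall>p \<in> \<S>\<^sub>1. \<exists>q \<in> \<S>\<^sub>2. set_pair_le p q) \<and>
     (\<forall>q \<in> \<S>\<^sub>2. snd q \<noteq> {} \<longrightarrow>
        (\<exists>p \<in> \<S>\<^sub>1. snd p = snd q) \<longrightarrow>
        (\<exists>p \<in> \<S>\<^sub>1. snd p = snd q \<and> set_pair_le p q))"

definition cactus_min :: "'a set \<Rightarrow> 'a set_pair set" where
  "cactus_min X = {({x}, {}) | x. x \<in> X}"

definition cactus_max :: "'a set \<Rightarrow> 'a set_pair set" where
  "cactus_max X = {(X, {})}"


section \<open>Posets and order complexes\<close>

text \<open>A poset is given by a carrier set and an order relation.\<close>

definition proper_part :: "'p set \<Rightarrow> ('p \<Rightarrow> 'p \<Rightarrow> bool) \<Rightarrow> 'p set" where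
  "proper_part P le = {x \<in> P. \<not> (\<forall>y\<in>P. le x y) \<and> \<not> (\<forall>y\<in>P. le y x)}"

text \<open>Abstract simplicial complexes are sets of finite sets that contain the empty simplex.\<close>

definition order_complex :: "'p set \<Rightarrow> ('p \<Rightarrow> 'p \<Rightarrow> bool) \<Rightarrow> 'p set set" where
  "order_complex P le = {C. C \<subseteq> P \<and> finite C \<and> Complete_Partial_Order.chain le C}"


section \<open>Orthant spaces and links\<close>

text \<open>The orthant of a simplex consists of the non-negative real vectors indexed by all
  vertices whose coordinates outside the simplex vanish. In this way the intersection of two
  orthants is the orthant of the intersection of the simplices, and gluing the orthants along
  common faces amounts to putting on their union the final topology with respect to the
  inclusions.\<close>

definition orthant :: "'v set \<Rightarrow> ('v \<Rightarrow> real) set" where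
  "orthant \<sigma> = {f. (\<forall>v. 0 \<le> f v) \<and> (\<forall>v. v \<notin> \<sigma> \<longrightarrow> f v = 0)}"

definition orthant_space :: "'v set set \<Rightarrow> ('v \<Rightarrow> real) topology" where
  "orthant_space K = topology (\<lambda>U. U \<subseteq> (\<Union>\<sigma>\<in>K. orthant \<sigma>) \<and>
     (\<forall>\<sigma>\<in>K. openin (subtopology (powertop_real UNIV) (orthant \<sigma>)) (U \<inter> orthant \<sigma>)))"

definition vertex_support :: "('v \<Rightarrow> real) \<Rightarrow> 'v set" where
  "vertex_support f = {v. f v \<noteq> 0}"

text \<open>The link consists of the points with coordinate sum 1, so that the coordinates are the
  barycentric ones.\<close>

definition link_of_origin :: "('v \<Rightarrow> real) topology \<Rightarrow> ('v \<Rightarrow> real) topology" where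
  "link_of_origin T = subtopology T {f. sum f (vertex_support f) = 1}"

text \<open>The geometric realization of a finite abstract simplicial complex, by barycentric
  coordinates.\<close>

definition geometric_realization :: "'v set set \<Rightarrow> ('v \<Rightarrow> real) topology" where
  "geometric_realization K = subtopology (powertop_real UNIV)
     {f. (\<forall>v. 0 \<le> f v) \<and> vertex_support f \<in> K \<and> sum f (vertex_support f) = 1}"


section \<open>The space of equidistant cactuses\<close>

definition equidistant_cactus_complex :: "'a set \<Rightarrow> 'a set_pair set set set" where
  "equidistant_cactus_complex X =
     order_complex (ranked_cactuses X - {cactus_max X}) cactus_le"

definition equidistant_cactus_space :: "'a set \<Rightarrow> ('a set_pair set \<Rightarrow> real) topology" where
  "equidistant_cactus_space X = orthant_space (equidistant_cactus_complex X)"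

definition proper_cactus_complex :: "'a set \<Rightarrow> 'a set_pair set set set" where
  "proper_cactus_complex X =
     order_complex (proper_part (ranked_cactuses X) cactus_le) cactus_le"

definition proper_cactus_link :: "'a set \<Rightarrow> ('a set_pair set \<Rightarrow> real) topology" where
  "proper_cactus_link X =
     subtopology (link_of_origin (equidistant_cactus_space X))
       {f. vertex_support f \<in> proper_cactus_complex X}"


section \<open>Wedges of spheres\<close>

text \<open>The wedge of the pointed spaces \<open>(X i, b i)\<close>, for \<open>i \<in> I\<close>, is the quotient of their
  disjoint union together with one extra point in which the extra point and all base points are
  identified. The extra point matters only for empty \<open>I\<close>, where the wedge is a
  single point. The common base point is represented by \<open>None\<close>.\<close>

definition wedge_map :: "('i \<Rightarrow> 'a) \<Rightarrow> 'i \<Rightarrow> 'a \<Rightarrow> ('i \<times> 'a) option" where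
  "wedge_map b i x = (if x = b i then None else Some (i, x))"

definition wedge_topology ::
    "'i set \<Rightarrow> ('i \<Rightarrow> 'a topology) \<Rightarrow> ('i \<Rightarrow> 'a) \<Rightarrow> ('i \<times> 'a) option topology" where
  "wedge_topology I X b = topology (\<lambda>U.
     U \<subseteq> insert None (\<Union>i\<in>I. wedge_map b i ` topspace (X i)) \<and>
     (\<forall>i\<in>I. openin (X i) {x \<in> topspace (X i). wedge_map b i x \<in> U}))"

definition nsphere_base :: "nat \<Rightarrow> real" where
  "nsphere_base = (\<lambda>k. if k = 0 then 1 else 0)"

definition wedge_of_spheres :: "nat set \<Rightarrow> (nat \<Rightarrow> nat) \<Rightarrow> (nat \<times> (nat \<Rightarrow> real)) option topology" where
  "wedge_of_spheres I d = wedge_topology I (\<lambda>i. nsphere (d i)) (\<lambda>_. nsphere_base)"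

text \<open>The first disjunct is the case of the sphere of dimension \<open>-1\<close>, which is the empty
  space; it has no base point, so it is a wedge of spheres only on its own.\<close>

definition homotopy_type_of_wedge_of_spheres :: "'a topology \<Rightarrow> bool" where
  "homotopy_type_of_wedge_of_spheres T \<longleftrightarrow>
     topspace T = {} \<or>
     (\<exists>I d. finite I \<and> T homotopy_equivalent_space wedge_of_spheres I d)"


section \<open>Basic facts\<close>

lemma openin_orthant_space:
  "openin (orthant_space K) U \<longleftrightarrow> U \<subseteq> (\<Union>\<sigma>\<in>K. orthant \<sigma>) \<and>
     (\<forall>\<sigma>\<in>K. openin (subtopology (powertop_real UNIV) (orthant \<sigma>)) (U \<inter> orthant \<sigma>))"
proof -
  have "istopology (\<lambda>U. U \<subseteq> (\<Union>\<sigma>\<in>K. orthant \<sigma>) \<and>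
     (\<forall>\<sigma>\<in>K. openin (subtopology (powertop_real UNIV) (orthant \<sigma>)) (U \<inter> orthant \<sigma>)))"
    unfolding istopology_def
  proof (rule conjI; intro allI impI conjI ballI)
    fix S T \<sigma>
    assume "S \<subseteq> (\<Union>\<sigma>\<in>K. orthant \<sigma>) \<and>
       (\<forall>\<sigma>\<in>K. openin (subtopology (powertop_real UNIV) (orthant \<sigma>)) (S \<inter> orthant \<sigma>))"
      and "T \<subseteq> (\<Union>\<sigma>\<in>K. orthant \<sigma>) \<and>
       (\<forall>\<sigma>\<in>K. openin (subtopology (powertop_real UNIV) (orthant \<sigma>)) (T \<inter> orthant \<sigma>))"
      and "\<sigma> \<in> K"
    then have "openin (subtopology (powertop_real UNIV) (orthant \<sigma>))
        ((S \<inter> orthant \<sigma>) \<inter> (T \<inter> orthant \<sigma>))"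
      by blast
    then show "openin (subtopology (powertop_real UNIV) (orthant \<sigma>)) (S \<inter> T \<inter> orthant \<sigma>)"
      by (simp add: Int_ac)
  next
    fix \<K> \<sigma>
    assume *: "\<forall>S\<in>\<K>. S \<subseteq> (\<Union>\<sigma>\<in>K. orthant \<sigma>) \<and>
       (\<forall>\<sigma>\<in>K. openin (subtopology (powertop_real UNIV) (orthant \<sigma>)) (S \<inter> orthant \<sigma>))"
      and "\<sigma> \<in> K"
    then have "openin (subtopology (powertop_real UNIV) (orthant \<sigma>)) (\<Union>S\<in>\<K>. S \<inter> orthant \<sigma>)"
      by blast
    then show "openin (subtopology (powertop_real UNIV) (orthant \<sigma>)) (\<Union>\<K> \<inter> orthant \<sigma>)"
      by (simp only: Int_Union2)
  qed blast+
  then show ?thesis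
    by (simp add: orthant_space_def)
qed

lemma closedin_orthant: "closedin (powertop_real UNIV) (orthant \<sigma>)"
proof -
  have "orthant \<sigma> = PiE UNIV (\<lambda>v. if v \<in> \<sigma> then {0..} else {0})"
    by (auto simp: orthant_def PiE_iff split: if_splits) (metis order_refl)
  then show ?thesis
    by (simp add: closedin_product_topology)
qed

lemma topspace_orthant_space: "topspace (orthant_space K) = (\<Union>\<sigma>\<in>K. orthant \<sigma>)"
proof -
  have "openin (orthant_space K) (\<Union>\<sigma>\<in>K. orthant \<sigma>)"
    unfolding openin_orthant_space
  proof (intro conjI ballI)
    fix \<sigma> assume "\<sigma> \<in> K"
    then have "(\<Union>\<sigma>\<in>K. orthant \<sigma>) \<inter> orthant \<sigma> = orthant \<sigma>"
      by blast
    then show "openin (subtopology (powertop_real UNIV) (orthant \<sigma>)) ((\<Union>\<sigma>\<in>K. orthant \<sigma>) \<inter> orthant \<sigma>)"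
      by (simp add: openin_subtopology_refl)
  qed simp
  then show ?thesis
    by (meson openin_orthant_space openin_subset openin_topspace subset_antisym)
qed

text \<open>For a finite complex the glued topology is the Euclidean one.\<close>

lemma orthant_space_finite:
  assumes "finite K"
  shows "orthant_space K = subtopology (powertop_real UNIV) (\<Union>\<sigma>\<in>K. orthant \<sigma>)"
    (is "_ = subtopology ?E ?U")
proof (rule topology_eq[THEN iffD2], intro allI iffI)
  fix W assume W: "openin (orthant_space K) W"
  have "closedin ?E (orthant \<sigma> - W)" if "\<sigma> \<in> K" for \<sigma>
  proof -
    have "openin (subtopology ?E (orthant \<sigma>)) (W \<inter> orthant \<sigma>)"
      using W that by (simp add: openin_orthant_space)
    then have "closedin (subtopology ?E (orthant \<sigma>)) (orthant \<sigma> - W)"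
      by (simp add: closedin_def Diff_Diff_Int Int_commute)
    then show ?thesis
      using closedin_trans_full closedin_orthant by blast
  qed
  then have "closedin ?E (\<Union>\<sigma>\<in>K. orthant \<sigma> - W)"
    using assms by (intro closedin_Union) auto
  moreover have "?U - W = (\<Union>\<sigma>\<in>K. orthant \<sigma> - W)"
    by blast
  ultimately have "closedin (subtopology ?E ?U) (?U - W)"
    by (metis Diff_subset closedin_subset_topspace)
  moreover have "W \<subseteq> ?U"
    using W by (simp add: openin_orthant_space)
  ultimately show "openin (subtopology ?E ?U) W"
    by (simp add: openin_closedin_eq)
next
  fix W assume "openin (subtopology ?E ?U) W"
  then obtain V where V: "openin ?E V" "W = V \<inter> ?U"
    by (auto simp: openin_subtopology)
  have "openin (subtopology ?E (orthant \<sigma>)) (W \<inter> orthant \<sigma>)" if "\<sigma> \<in> K" for \<sigma>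
  proof -
    have "W \<inter> orthant \<sigma> = V \<inter> orthant \<sigma>"
      using V that by blast
    then show ?thesis
      using V by (auto simp: openin_subtopology)
  qed
  then show "openin (orthant_space K) W"
    using V by (simp add: openin_orthant_space)
qed

lemma openin_wedge_topology:
  "openin (wedge_topology I X b) U \<longleftrightarrow>
     U \<subseteq> insert None (\<Union>i\<in>I. wedge_map b i ` topspace (X i)) \<and>
     (\<forall>i\<in>I. openin (X i) {x \<in> topspace (X i). wedge_map b i x \<in> U})"
proof -
  have "istopology (\<lambda>U. U \<subseteq> insert None (\<Union>i\<in>I. wedge_map b i ` topspace (X i)) \<and>
     (\<forall>i\<in>I. openin (X i) {x \<in> topspace (X i). wedge_map b i x \<in> U}))"
    unfolding istopology_def
  proof (rule conjI; intro allI impI conjI ballI)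
    fix S T i
    assume "S \<subseteq> insert None (\<Union>i\<in>I. wedge_map b i ` topspace (X i)) \<and>
       (\<forall>i\<in>I. openin (X i) {x \<in> topspace (X i). wedge_map b i x \<in> S})"
      and "T \<subseteq> insert None (\<Union>i\<in>I. wedge_map b i ` topspace (X i)) \<and>
       (\<forall>i\<in>I. openin (X i) {x \<in> topspace (X i). wedge_map b i x \<in> T})"
      and "i \<in> I"
    then have "openin (X i) ({x \<in> topspace (X i). wedge_map b i x \<in> S} \<inter>
        {x \<in> topspace (X i). wedge_map b i x \<in> T})"
      by (intro openin_Int) simp_all
    moreover have "{x \<in> topspace (X i). wedge_map b i x \<in> S \<inter> T} =
        {x \<in> topspace (X i). wedge_map b i x \<in> S} \<inter> {x \<in> topspace (X i). wedge_map b i x \<in> T}"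
      by blast
    ultimately show "openin (X i) {x \<in> topspace (X i). wedge_map b i x \<in> S \<inter> T}"
      by simp
  next
    fix \<K> i
    assume "\<forall>S\<in>\<K>. S \<subseteq> insert None (\<Union>i\<in>I. wedge_map b i ` topspace (X i)) \<and>
       (\<forall>i\<in>I. openin (X i) {x \<in> topspace (X i). wedge_map b i x \<in> S})"
      and "i \<in> I"
    then have "openin (X i) (\<Union>S\<in>\<K>. {x \<in> topspace (X i). wedge_map b i x \<in> S})"
      by (intro openin_Union) auto
    moreover have "{x \<in> topspace (X i). wedge_map b i x \<in> \<Union>\<K>} =
        (\<Union>S\<in>\<K>. {x \<in> topspace (X i). wedge_map b i x \<in> S})"
      by blast
    ultimately show "openin (X i) {x \<in> topspace (X i). wedge_map b i x \<in> \<Union>\<K>}"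
      by simp
  qed blast+
  then show ?thesis
    by (simp add: wedge_topology_def)
qed

lemma topspace_wedge_topology:
  assumes "\<And>i. i \<in> I \<Longrightarrow> b i \<in> topspace (X i)"
  shows "topspace (wedge_topology I X b) =
    insert None (Some ` (SIGMA i:I. topspace (X i) - {b i}))"
proof -
  let ?U = "insert None (\<Union>i\<in>I. wedge_map b i ` topspace (X i))"
  have "openin (wedge_topology I X b) ?U"
    unfolding openin_wedge_topology
  proof (intro conjI ballI)
    fix i assume "i \<in> I"
    then have "{x \<in> topspace (X i). wedge_map b i x \<in> ?U} = topspace (X i)"
      by blast
    then show "openin (X i) {x \<in> topspace (X i). wedge_map b i x \<in> ?U}"
      by simp
  qed simp
  then have "?U \<subseteq> topspace (wedge_topology I X b)"
    by (rule openin_subset)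
  moreover have "topspace (wedge_topology I X b) \<subseteq> ?U"
    using openin_topspace[of "wedge_topology I X b"] unfolding openin_wedge_topology by (rule conjunct1)
  ultimately have "topspace (wedge_topology I X b) = ?U"
    by (rule subset_antisym[rotated])
  also have "?U = insert None (Some ` (SIGMA i:I. topspace (X i) - {b i}))"
    using assms by (auto simp: wedge_map_def image_iff split: if_splits)
  finally show ?thesis .
qed

lemma ranked_cactuses_memberD:
  assumes "\<S> \<in> ranked_cactuses X" "p \<in> \<S>"
  shows "fst p \<subseteq> X" "snd p \<subseteq> X" "fst p \<noteq> {}" "fst p \<inter> snd p = {}"
proof -
  have "set_pair_system X \<S>"
    using assms(1) unfolding ranked_cactuses_def partition_like_def by blast
  then have "case p of (S, H) \<Rightarrow> S \<subseteq> X \<and> H \<subseteq> X \<and> S \<noteq> {} \<and> S \<inter> H = {}"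
    using assms(2) unfolding set_pair_system_def by (rule bspec)
  then show "fst p \<subseteq> X" "snd p \<subseteq> X" "fst p \<noteq> {}" "fst p \<inter> snd p = {}"
    by (simp_all add: case_prod_beta)
qed

lemma ranked_cactuses_partition:
  assumes "\<S> \<in> ranked_cactuses X"
  shows "\<Union>(fst ` \<S>) = X" "disjoint (fst ` \<S>)"
proof -
  have "partition_on X (fst ` \<S>)"
    using assms unfolding ranked_cactuses_def partition_like_def by blast
  then show "\<Union>(fst ` \<S>) = X" "disjoint (fst ` \<S>)"
    by (simp_all add: partition_on_def)
qed

lemma ranked_cactuses_fst_inj:
  assumes "\<S> \<in> ranked_cactuses X"
  shows "inj_on fst \<S>"
proof -
  have "\<forall>(S, H) \<in> \<S>. \<forall>(S', H') \<in> \<S>. (S, H) \<noteq> (S', H') \<longrightarrow> S \<noteq> S'"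
    using assms unfolding ranked_cactuses_def partition_like_def by blast
  then show ?thesis
    by (fastforce simp: inj_on_def)
qed

lemma finite_ranked_cactuses:
  assumes "finite X"
  shows "finite (ranked_cactuses X)"
proof (rule finite_subset)
  show "ranked_cactuses X \<subseteq> Pow (Pow X \<times> Pow X)"
    using ranked_cactuses_memberD(1,2)[of _ X] by (fastforce simp: mem_Times_iff)
qed (use assms in simp)

lemma cactus_min_in:
  "cactus_min X \<in> ranked_cactuses X"
proof -
  have "fst ` cactus_min X = (\<lambda>x. {x}) ` X"
    by (force simp: cactus_min_def)
  then have "partition_on X (fst ` cactus_min X)"
    by (auto simp: partition_on_def disjoint_def)
  then show ?thesis
    by (auto simp: ranked_cactuses_def partition_like_def set_pair_system_def cactus_min_def)
qed

lemma cactus_max_in: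
  assumes "X \<noteq> {}"
  shows "cactus_max X \<in> ranked_cactuses X"
  using assms
  by (auto simp: ranked_cactuses_def partition_like_def set_pair_system_def cactus_max_def
      partition_on_def)

lemma cactus_min_le:
  assumes "\<S> \<in> ranked_cactuses X"
  shows "cactus_le (cactus_min X) \<S>"
proof -
  have "\<exists>q\<in>\<S>. set_pair_le ({x}, {}) q" if x: "x \<in> X" for x
  proof -
    obtain q where "q \<in> \<S>" "x \<in> fst q"
      using x ranked_cactuses_partition(1)[OF assms(1)] by blast
    then show ?thesis
      by (intro bexI[of _ q]) (auto simp: set_pair_le_def)
  qed
  then show ?thesis
    by (auto simp: cactus_le_def cactus_min_def)
qed

lemma cactus_le_max:
  assumes "\<S> \<in> ranked_cactuses X"
  shows "cactus_le \<S> (cactus_max X)"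
proof -
  have "set_pair_le p (X, {})" if "p \<in> \<S>" for p
    using ranked_cactuses_memberD[OF assms that] by (auto simp: set_pair_le_def)
  then show ?thesis
    by (simp add: cactus_le_def cactus_max_def)
qed

lemma cactus_le_min_iff:
  assumes "\<S> \<in> ranked_cactuses X" "cactus_le \<S> (cactus_min X)"
  shows "\<S> = cactus_min X"
proof -
  have sub: "\<S> \<subseteq> cactus_min X"
  proof
    fix p assume p: "p \<in> \<S>"
    obtain x where x: "x \<in> X" "set_pair_le p ({x}, {})"
      using assms(2) p by (auto simp: cactus_le_def cactus_min_def)
    have "fst p \<noteq> {}" "fst p \<inter> snd p = {}"
      using ranked_cactuses_memberD[OF assms(1) p] by blast+
    then have "p = ({x}, {})"
      using x(2) by (cases p) (auto simp: set_pair_le_def)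
    then show "p \<in> cactus_min X"
      using x(1) by (auto simp: cactus_min_def)
  qed
  moreover have "({x}, {}) \<in> \<S>" if x: "x \<in> X" for x
  proof -
    obtain q where "q \<in> \<S>" "x \<in> fst q"
      using x ranked_cactuses_partition(1)[OF assms(1)] by blast
    moreover from this have "q = ({x}, {})"
      using sub by (auto simp: cactus_min_def)
    ultimately show ?thesis
      by simp
  qed
  ultimately show ?thesis
    by (auto simp: cactus_min_def)
qed

lemma cactus_max_le_iff:
  assumes "X \<noteq> {}" "\<S> \<in> ranked_cactuses X" "cactus_le (cactus_max X) \<S>"
  shows "\<S> = cactus_max X"
proof -
  obtain q where q: "q \<in> \<S>" "set_pair_le (X, {}) q"
    using assms(3) by (auto simp: cactus_le_def cactus_max_def)
  have "fst q \<subseteq> X" "snd q \<subseteq> X" "fst q \<inter> snd q = {}"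
    using ranked_cactuses_memberD[OF assms(2) q(1)] by blast+
  then have qX: "q = (X, {})"
    using q(2) by (cases q) (auto simp: set_pair_le_def)
  have "r = q" if r: "r \<in> \<S>" for r
  proof (rule ccontr)
    assume "r \<noteq> q"
    then have "fst r \<noteq> X"
      using inj_onD[OF ranked_cactuses_fst_inj[OF assms(2)], of r q] r q(1) qX by auto
    moreover have "X \<in> fst ` \<S>" "fst r \<in> fst ` \<S>"
      using imageI[OF q(1), of fst] imageI[OF r, of fst] qX by simp_all
    ultimately have "fst r \<inter> X = {}"
      using ranked_cactuses_partition(2)[OF assms(2)] unfolding disjoint_def by blast
    moreover have "fst r \<subseteq> X" "fst r \<noteq> {}"
      using ranked_cactuses_memberD[OF assms(2) r] by blast+
    ultimately show False
      by blast
  qed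
  then have "\<S> = {q}"
    using q(1) by blast
  then show ?thesis
    by (simp add: cactus_max_def qX)
qed

lemma proper_part_ranked_cactuses:
  assumes "X \<noteq> {}"
  shows "proper_part (ranked_cactuses X) cactus_le =
    ranked_cactuses X - {cactus_min X, cactus_max X}"
proof -
  have "(\<forall>\<T>\<in>ranked_cactuses X. cactus_le \<S> \<T>) \<longleftrightarrow> \<S> = cactus_min X"
    "(\<forall>\<T>\<in>ranked_cactuses X. cactus_le \<T> \<S>) \<longleftrightarrow> \<S> = cactus_max X"
    if "\<S> \<in> ranked_cactuses X" for \<S>
    using cactus_le_min_iff[OF that] cactus_min_in[of X] cactus_min_le[of _ X]
      cactus_max_le_iff[OF assms that] cactus_max_in[OF assms] cactus_le_max[of _ X]
    by blast+
  then show ?thesis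
    by (auto simp: proper_part_def)
qed

lemma finite_order_complex: "finite P \<Longrightarrow> finite (order_complex P le)"
  by (rule finite_subset[of _ "Pow P"]) (auto simp: order_complex_def)

lemma orthant_Union_order_complex:
  "(\<Union>\<sigma>\<in>order_complex P le. orthant \<sigma>) =
     {f. (\<forall>v. 0 \<le> f v) \<and> vertex_support f \<in> order_complex P le}"
proof (intro equalityI subsetI)
  fix f assume "f \<in> (\<Union>\<sigma>\<in>order_complex P le. orthant \<sigma>)"
  then obtain \<sigma> where \<sigma>: "\<sigma> \<in> order_complex P le" "f \<in> orthant \<sigma>"
    by blast
  have "vertex_support f \<subseteq> \<sigma>"
    using \<sigma>(2) by (auto simp: orthant_def vertex_support_def)
  then have "vertex_support f \<in> order_complex P le"
    using \<sigma>(1) by (auto simp: order_complex_def chain_def intro: finite_subset)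
  then show "f \<in> {f. (\<forall>v. 0 \<le> f v) \<and> vertex_support f \<in> order_complex P le}"
    using \<sigma>(2) by (simp add: orthant_def)
next
  fix f assume "f \<in> {f. (\<forall>v. 0 \<le> f v) \<and> vertex_support f \<in> order_complex P le}"
  then show "f \<in> (\<Union>\<sigma>\<in>order_complex P le. orthant \<sigma>)"
    by (auto simp: orthant_def vertex_support_def intro!: bexI[of _ "vertex_support f"])
qed

lemma link_of_origin_order_complex:
  assumes "finite P"
  shows "link_of_origin (orthant_space (order_complex P le)) = geometric_realization (order_complex P le)"
proof -
  have *: "{f::'a \<Rightarrow> real. (\<forall>v. 0 \<le> f v) \<and> vertex_support f \<in> order_complex P le}
      \<inter> {f. sum f (vertex_support f) = 1} =
    {f. (\<forall>v. 0 \<le> f v) \<and> vertex_support f \<in> order_complex P le \<and> sum f (vertex_support f) = 1}"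
    by blast
  show ?thesis
    unfolding link_of_origin_def geometric_realization_def
      orthant_space_finite[OF finite_order_complex[OF assms]] orthant_Union_order_complex
      subtopology_subtopology *
    by (rule refl)
qed

theorem proper_cactus_link_eq:
  assumes "finite X" "X \<noteq> {}"
  shows "proper_cactus_link X = geometric_realization (proper_cactus_complex X)"
proof -
  have fin: "finite (ranked_cactuses X - {cactus_max X})"
    using finite_ranked_cactuses[OF assms(1)] by simp
  have sub: "proper_cactus_complex X \<subseteq> equidistant_cactus_complex X"
    by (auto simp: proper_cactus_complex_def equidistant_cactus_complex_def order_complex_def
        proper_part_ranked_cactuses[OF assms(2)])
  have *: "{f. (\<forall>v. 0 \<le> f v) \<and> vertex_support f \<in> equidistant_cactus_complex X
        \<and> sum f (vertex_support f) = 1} \<inter> {f. vertex_support f \<in> proper_cactus_complex X} =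
    {f. (\<forall>v. 0 \<le> f v) \<and> vertex_support f \<in> proper_cactus_complex X
        \<and> sum f (vertex_support f) = 1}"
    using sub by blast
  have "link_of_origin (equidistant_cactus_space X) =
      geometric_realization (equidistant_cactus_complex X)"
    unfolding equidistant_cactus_space_def equidistant_cactus_complex_def
    by (rule link_of_origin_order_complex[OF fin])
  then show ?thesis
    unfolding proper_cactus_link_def geometric_realization_def
    by (simp only: subtopology_subtopology *)
qed

end

theory Submission
  imports Defs
begin

text \<open>
  Chains of ranked cactuses from minimum to maximum are matched as in discrete Morse theory, by
  toggling one element that is comparable with all members of the chain. Let \<open>t\<close> be a coatom of the
  chain that consists of a single triple \<open>A, B\<close> with hybrid \<open>H\<close>, or the maximum if there is none, and let \<open>x\<close> be
  the largest member with a hybrid that \<open>t\<close> does not have. Then the system obtained from \<open>x\<close> by collapsing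
  all triples whose hybrid is not a hybrid of \<open>t\<close> is toggled. If there is no such \<open>x\<close> and \<open>t\<close> is the
  maximum, all members are partitions. Otherwise the partition underlying the smallest member with a
  hybrid is toggled, which fails only if this partition is the minimum. Then \<open>H\<close> is a singleton, and
  the members with hybrid \<open>H\<close> correspond to a chain of partitions refining \<open>{A, B, H}\<close>. So
  everything reduces to intervals of the partition lattice, where a chain is matched by joining with an
  atom. All critical chains have the maximal size, since the poset is graded. Hence the order complex of
  the proper part becomes collapsible after removing some of its top-dimensional simplices, and shrinking the
  contractible remainder to a point yields a wedge of spheres.
\<close>

section \<open>Acyclic matchings\<close>

text \<open>Two requirements shape the matching. The toggled element must be the same for a whole
  family of chains, so chains are sorted by their trace on a set \<open>N\<close> of systems that
  determines this element and does not contain it. Since \<open>C \<mapsto> C \<inter> N\<close> is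
  monotone, matchings on the fibres never combine to a cycle. And the element must differ from
  minimum and maximum, which belong to every chain considered. Collapsing all triples of
  \<open>x\<close> gives the maximum only if \<open>x\<close> is a single triple filling
  \<open>X\<close>; this obstacle is why chains are first sorted by such a \<open>t\<close>,
  relative to which only foreign hybrids are collapsed and the result stays strictly below
  \<open>t\<close>. The sizes fit because an interval of the partition lattice from the singletons
  to \<pi> has critical chains of size \<open>card X - card \<pi> + 1\<close>. This is
  \<open>card X\<close> for \<open>\<pi> = {X}\<close>, and \<open>card X - 2\<close> for
  \<open>{A, B, H}\<close>, where minimum and maximum still have to be added.\<close>

text \<open>Read backwards, a pair is an elementary collapse: among the sets present, only
  \<open>insert v \<sigma>\<close> properly contains \<sigma>. The families need not be complexes,
  so that fibres can be treated separately. A vertex may be matched with the empty set, which lets a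
  collapsible complex be exhausted completely. Critical sets enter without any freeness condition
  because they are deleted before collapsing.\<close>

inductive dismantles :: "('v set \<Rightarrow> bool) \<Rightarrow> 'v set set \<Rightarrow> bool" for crit where
  empty: "dismantles crit {}"
| critical: "dismantles crit F \<Longrightarrow> crit \<tau> \<Longrightarrow> dismantles crit (insert \<tau> F)"
| pair: "dismantles crit F \<Longrightarrow> finite \<sigma> \<Longrightarrow> v \<notin> \<sigma> \<Longrightarrow> (\<And>f. f \<in> F \<Longrightarrow> \<not> \<sigma> \<subseteq> f) \<Longrightarrow>
    dismantles crit (insert \<sigma> (insert (insert v \<sigma>) F))"

text \<open>The freeness conditions met while building \<open>G\<close> survive putting
  \<open>F\<close> underneath, as no member of \<open>G\<close> lies in a member of
  \<open>F\<close>.\<close>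

lemma dismantles_Un:
  assumes "dismantles crit G" "dismantles crit F" "\<And>f g. f \<in> F \<Longrightarrow> g \<in> G \<Longrightarrow> \<not> g \<subseteq> f"
  shows "dismantles crit (F \<union> G)"
  using assms
proof induction
  case (pair G \<sigma> v)
  then have "dismantles crit (F \<union> G)" by blast
  then have "dismantles crit (insert \<sigma> (insert (insert v \<sigma>) (F \<union> G)))"
    using pair by (intro dismantles.pair) auto
  then show ?case by simp
qed (auto intro: dismantles.intros)

text \<open>Adding or removing \<open>v\<close> matches everything, so nothing critical is left,
  whatever \<open>crit\<close> is. Peeling off inclusion-maximal sets without \<open>v\<close>
  provides the order.\<close>

lemma dismantles_cone:
  assumes "finite F" "\<And>f. f \<in> F \<Longrightarrow> finite f"
    and "\<And>f. f \<in> F \<Longrightarrow> insert v f \<in> F" "\<And>f. f \<in> F \<Longrightarrow> f - {v} \<in> F"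
  shows "dismantles crit F"
  using assms
proof (induction F rule: finite_psubset_induct)
  case (psubset F)
  show ?case
  proof (cases "F = {}")
    case True
    then show ?thesis by (simp add: dismantles.empty)
  next
    case False
    then obtain f where "f \<in> F" by blast
    then have ne: "{f \<in> F. v \<notin> f} \<noteq> {}" and fin: "finite {f \<in> F. v \<notin> f}"
      using psubset.prems(3)[of f] psubset.hyps by auto
    obtain s where s: "s \<in> F" "v \<notin> s" and max: "\<And>g. g \<in> F \<Longrightarrow> v \<notin> g \<Longrightarrow> s \<subseteq> g \<Longrightarrow> s = g"
      using finite_has_maximal[OF fin ne] by auto
    let ?F = "F - {s, insert v s}"
    have "dismantles crit ?F"
    proof (rule psubset.IH)
      show "insert v f \<in> ?F" if "f \<in> ?F" for f
        using that psubset.prems(2)[of f] s by (cases "v \<in> f") (auto simp: insert_absorb)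
      show "f - {v} \<in> ?F" if "f \<in> ?F" for f
        using that psubset.prems(3)[of f] s by (cases "v \<in> f") auto
    qed (use s psubset.prems in auto)
    moreover have "\<not> s \<subseteq> f" if f: "f \<in> ?F" for f
    proof
      assume "s \<subseteq> f"
      then have "s = f - {v}"
        using max[of "f - {v}"] psubset.prems(3)[of f] f s(2) by blast
      then show False using f by blast
    qed
    ultimately have "dismantles crit (insert s (insert (insert v s) ?F))"
      using s psubset.prems(1) by (intro dismantles.pair) auto
    moreover have "insert s (insert (insert v s) ?F) = F"
      using s psubset.prems(2)[of s] by blast
    ultimately show ?thesis by simp
  qed
qed

text \<open>The patchwork principle: \<open>f \<inter> N\<close> grows with \<open>f\<close>, so the
  fibre over a maximal trace can be placed on top of all the others.\<close>

lemma dismantles_fibres: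
  assumes "finite F" "\<And>D. dismantles crit {f \<in> F. f \<inter> N = D}"
  shows "dismantles crit F"
  using assms
proof (induction F rule: finite_psubset_induct)
  case (psubset F)
  show ?case
  proof (cases "F = {}")
    case False
    then have ne: "(\<lambda>f. f \<inter> N) ` F \<noteq> {}" and fin: "finite ((\<lambda>f. f \<inter> N) ` F)"
      using psubset.hyps by auto
    obtain D where D: "D \<in> (\<lambda>f. f \<inter> N) ` F"
      and max: "\<forall>E \<in> (\<lambda>f. f \<inter> N) ` F. D \<subseteq> E \<longrightarrow> D = E"
      using finite_has_maximal[OF fin ne] by (elim bexE)
    let ?G = "{f \<in> F. f \<inter> N = D}"
    have "dismantles crit (F - ?G)"
    proof (rule psubset.IH)
      show "F - ?G \<subset> F" using D by blast
      show "dismantles crit {f \<in> F - ?G. f \<inter> N = E}" for E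
      proof (cases "E = D")
        case True
        then have "{f \<in> F - ?G. f \<inter> N = E} = {}" by blast
        then show ?thesis by (simp only: dismantles.empty)
      next
        case False
        then have "{f \<in> F - ?G. f \<inter> N = E} = {f \<in> F. f \<inter> N = E}" by blast
        then show ?thesis using psubset.prems by simp
      qed
    qed
    moreover have "\<not> g \<subseteq> f" if "f \<in> F - ?G" "g \<in> ?G" for f g
      using bspec[OF max, of "f \<inter> N"] that by blast
    ultimately have "dismantles crit ((F - ?G) \<union> ?G)"
      using psubset.prems by (intro dismantles_Un)
    moreover have "(F - ?G) \<union> ?G = F" by blast
    ultimately show ?thesis by simp
  qed (simp add: dismantles.empty)
qed

lemma dismantles_image:
  assumes "dismantles crit F" "inj_on g (\<Union>F)" "\<And>f. f \<in> F \<Longrightarrow> crit f \<Longrightarrow> crit' (g ` f)"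
  shows "dismantles crit' ((`) g ` F)"
  using assms
proof induction
  case (critical F \<tau>)
  then show ?case by (auto intro!: dismantles.critical intro: inj_on_subset)
next
  case (pair F \<sigma> v)
  have "dismantles crit' ((`) g ` F)"
    using pair by (intro pair.IH) (auto intro: inj_on_subset)
  moreover have "g v \<notin> g ` \<sigma>"
    using pair.prems(1) \<open>v \<notin> \<sigma>\<close> by (auto simp: inj_on_def)
  moreover have "\<not> g ` \<sigma> \<subseteq> f'" if f': "f' \<in> (`) g ` F" for f'
  proof -
    obtain f where f: "f \<in> F" "f' = g ` f" using f' by blast
    show ?thesis
      using inj_on_image_subset_iff[OF pair.prems(1), of \<sigma> f] pair.hyps(4)[OF f(1)] f
      by auto
  qed
  ultimately show ?case
    using dismantles.pair[of crit' "(`) g ` F" "g ` \<sigma>" "g v"] pair.hyps by simp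
qed (simp add: dismantles.empty)

lemma dismantles_Un_fixed:
  assumes "dismantles crit F" "finite A" "\<And>f. f \<in> F \<Longrightarrow> f \<inter> A = {}"
    and "\<And>f. f \<in> F \<Longrightarrow> crit f \<Longrightarrow> crit' (f \<union> A)"
  shows "dismantles crit' ((\<lambda>f. f \<union> A) ` F)"
  using assms
proof induction
  case (critical F \<tau>)
  then show ?case by (auto intro!: dismantles.critical)
next
  case (pair F \<sigma> v)
  have "dismantles crit' ((\<lambda>f. f \<union> A) ` F)"
    using pair by (intro pair.IH) auto
  then have "dismantles crit' (insert (\<sigma> \<union> A) (insert (insert v (\<sigma> \<union> A)) ((\<lambda>f. f \<union> A) ` F)))"
  proof (rule dismantles.pair)
    show "v \<notin> \<sigma> \<union> A" using pair.prems(2)[of "insert v \<sigma>"] pair.hyps by auto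
    have "\<sigma> \<inter> A = {}" using pair.prems(2)[of \<sigma>] by auto
    then show "\<not> \<sigma> \<union> A \<subseteq> f" if "f \<in> (\<lambda>f. f \<union> A) ` F" for f
      using that pair.hyps(4) by blast
  qed (use pair in auto)
  then show ?case by simp
qed (simp add: dismantles.empty)

lemma dismantles_Diff_fixed:
  assumes "dismantles crit F" "\<And>f. f \<in> F \<Longrightarrow> A \<subseteq> f"
    and "\<And>f. f \<in> F \<Longrightarrow> crit f \<Longrightarrow> crit' (f - A)"
  shows "dismantles crit' ((\<lambda>f. f - A) ` F)"
  using assms
proof induction
  case (critical F \<tau>)
  then show ?case by (auto intro!: dismantles.critical)
next
  case (pair F \<sigma> v)
  have A: "A \<subseteq> \<sigma>" using pair.prems(1)[of \<sigma>] by auto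
  have "dismantles crit' ((\<lambda>f. f - A) ` F)"
    using pair by (intro pair.IH) auto
  then have "dismantles crit' (insert (\<sigma> - A) (insert (insert v (\<sigma> - A)) ((\<lambda>f. f - A) ` F)))"
  proof (rule dismantles.pair)
    show "\<not> \<sigma> - A \<subseteq> f" if "f \<in> (\<lambda>f. f - A) ` F" for f
      using that pair.hyps(4) pair.prems(1) by blast
  qed (use pair in auto)
  moreover have "insert v \<sigma> - A = insert v (\<sigma> - A)" using A pair.hyps by auto
  ultimately show ?case by simp
qed (simp add: dismantles.empty)

text \<open>Freeness only forbids inclusions and hence passes to subfamilies, so the critical sets
  can be left out of the construction.\<close>

lemma dismantles_split_critical:
  assumes "dismantles crit F"
  obtains M where "M \<subseteq> F" "\<And>m. m \<in> M \<Longrightarrow> crit m" "dismantles (\<lambda>_. False) (F - M)"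
proof -
  have "\<exists>M \<subseteq> F. (\<forall>m\<in>M. crit m) \<and> dismantles (\<lambda>_. False) (F - M)"
    using assms
  proof induction
    case empty
    then show ?case by (auto intro: dismantles.empty)
  next
    case (critical F \<tau>)
    then obtain M where M: "M \<subseteq> F" "\<forall>m\<in>M. crit m" "dismantles (\<lambda>_. False) (F - M)" by blast
    show ?case
    \<comment> \<open>\<tau> may already be present as a member of a pair, and then it has to
      stay.\<close>
    proof (cases "\<tau> \<in> F - M")
      case True
      then show ?thesis using M by (auto intro!: exI[of _ M] simp: insert_absorb)
    next
      case False
      then have "insert \<tau> F - insert \<tau> M = F - M" by blast
      then show ?thesis using M critical.hyps by (intro exI[of _ "insert \<tau> M"]) auto
    qed
  next
    case (pair F \<sigma> v)
    then obtain M where M: "M \<subseteq> F" "\<forall>m\<in>M. crit m" "dismantles (\<lambda>_. False) (F - M)" by blast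
    have "\<sigma> \<notin> M" "insert v \<sigma> \<notin> M" using M pair.hyps(4) by blast+
    then have "insert \<sigma> (insert (insert v \<sigma>) F) - M = insert \<sigma> (insert (insert v \<sigma>) (F - M))"
      by blast
    moreover have "dismantles (\<lambda>_. False) (insert \<sigma> (insert (insert v \<sigma>) (F - M)))"
      using M(3) pair.hyps by (intro dismantles.pair) auto
    ultimately show ?case using M by (intro exI[of _ M]) auto
  qed
  then show ?thesis using that by blast
qed

section \<open>Geometric realizations\<close>

definition simplicial_complex :: "'v set set \<Rightarrow> bool" where
  "simplicial_complex K \<longleftrightarrow> finite K \<and> (\<forall>s\<in>K. finite s) \<and> (\<forall>s\<in>K. \<forall>t\<subseteq>s. t \<in> K)"

lemma simplicial_complexD:
  assumes "simplicial_complex K"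
  shows "finite K" "s \<in> K \<Longrightarrow> finite s" "s \<in> K \<Longrightarrow> t \<subseteq> s \<Longrightarrow> t \<in> K" "finite (\<Union>K)"
  using assms unfolding simplicial_complex_def by auto

lemma sum_vertex_support:
  assumes "finite V" "vertex_support x \<subseteq> V"
  shows "sum x (vertex_support x) = sum x V"
  using assms by (intro sum.mono_neutral_left) (auto simp: vertex_support_def)

text \<open>Summing over the fixed vertex set instead of the varying support makes the normalization
  linear, so conservation of mass can be checked by a single sum.\<close>

lemma geometric_realization_iff:
  assumes "simplicial_complex K"
  shows "x \<in> topspace (geometric_realization K) \<longleftrightarrow>
    (\<forall>v. 0 \<le> x v) \<and> vertex_support x \<in> K \<and> sum x (\<Union>K) = 1"
proof -
  have "sum x (vertex_support x) = sum x (\<Union>K)" if "vertex_support x \<in> K"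
    by (rule sum_vertex_support) (use that simplicial_complexD(4)[OF assms] in auto)
  then show ?thesis
    by (auto simp: geometric_realization_def)
qed

lemma geometric_realization_nonempty_support:
  assumes "x \<in> topspace (geometric_realization K)"
  shows "vertex_support x \<noteq> {}"
  using assms by (auto simp: geometric_realization_def)

lemma continuous_map_geometric_realization_coord [continuous_intros]:
  "continuous_map (geometric_realization K) euclideanreal (\<lambda>x. x v)"
  unfolding geometric_realization_def
  by (intro continuous_map_from_subtopology continuous_map_product_projection) auto

lemma continuous_map_into_geometric_realization:
  assumes "\<And>v. continuous_map X euclideanreal (\<lambda>x. f x v)"
    and "\<And>x. x \<in> topspace X \<Longrightarrow> f x \<in> topspace (geometric_realization K)"
  shows "continuous_map X (geometric_realization K) f"
proof -
  have "continuous_map X (powertop_real UNIV) f"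
    using assms(1) by (simp add: continuous_map_componentwise_UNIV)
  then show ?thesis
    using assms(2) unfolding geometric_realization_def
    by (intro continuous_map_into_subtopology) auto
qed

lemma geometric_realization_subcomplex:
  assumes "L \<subseteq> K"
  shows "geometric_realization L = subtopology (geometric_realization K) {x. vertex_support x \<in> L}"
  unfolding geometric_realization_def subtopology_subtopology
  by (rule arg_cong[where f = "subtopology _"]) (use assms in auto)

section \<open>Elementary collapses and contractibility\<close>

lemma continuous_map_Min:
  fixes f :: "'a \<Rightarrow> 'v \<Rightarrow> real"
  assumes "finite S" "S \<noteq> {}" "\<And>v. v \<in> S \<Longrightarrow> continuous_map X euclideanreal (\<lambda>x. f x v)"
  shows "continuous_map X euclideanreal (\<lambda>x. Min (f x ` S))"
  using assms
proof (induction S rule: finite_ne_induct)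
  case (insert v S)
  then have "continuous_map X euclideanreal (\<lambda>x. min (f x v) (Min (f x ` S)))"
    by (intro continuous_map_real_min) auto
  then show ?case using insert by simp
qed simp

lemma Min_coord:
  fixes x :: "'v \<Rightarrow> real"
  assumes "finite \<sigma>" "\<sigma> \<noteq> {}"
  shows "u \<in> \<sigma> \<Longrightarrow> Min (x ` \<sigma>) \<le> x u"
    and "\<exists>u\<in>\<sigma>. x u = Min (x ` \<sigma>)"
  using assms Min_in[of "x ` \<sigma>"] by (simp, fastforce)

lemma Min_coord_pos_iff:
  fixes x :: "'v \<Rightarrow> real"
  assumes "finite \<sigma>" "\<sigma> \<noteq> {}" "\<forall>v. 0 \<le> x v"
  shows "0 \<le> Min (x ` \<sigma>)" "0 < Min (x ` \<sigma>) \<longleftrightarrow> \<sigma> \<subseteq> vertex_support x"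
proof -
  show "0 \<le> Min (x ` \<sigma>)" using assms by simp
  have "0 < Min (x ` \<sigma>) \<longleftrightarrow> (\<forall>u\<in>\<sigma>. 0 < x u)" using assms by simp
  also have "\<dots> \<longleftrightarrow> \<sigma> \<subseteq> vertex_support x"
    using assms(3) by (auto simp: vertex_support_def less_le)
  finally show "0 < Min (x ` \<sigma>) \<longleftrightarrow> \<sigma> \<subseteq> vertex_support x" .
qed

text \<open>The push away from the free face \<open>\<sigma>\<close>: mass moves from the vertices of \<open>\<sigma>\<close> to \<open>v\<close> until
  one of the coordinates in \<open>\<sigma>\<close> vanishes.\<close>

lemma contractible_realization_collapse:
  fixes K :: "'v set set"
  assumes K: "simplicial_complex K" "K = insert \<sigma> (insert (insert v \<sigma>) F)"
    and F: "simplicial_complex F" "\<And>f. f \<in> F \<Longrightarrow> \<not> \<sigma> \<subseteq> f"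
    and \<sigma>: "v \<notin> \<sigma>" "\<sigma> \<noteq> {}"
    and con: "contractible_space (geometric_realization F)"
  shows "contractible_space (geometric_realization K)"
proof -
  let ?V = "\<Union>K"
  \<comment> \<open>Along \<open>w\<close> each vertex of \<sigma> loses one unit and
    \<open>v\<close> receives all \<open>card \<sigma>\<close> of them, so the coordinate sum is
    preserved. The speed \<open>\<mu> x\<close> makes a smallest coordinate on \<sigma> vanish at
    \<open>t = 1\<close>.\<close>
  define \<mu> where "\<mu> x = Min (x ` \<sigma>)" for x :: "'v \<Rightarrow> real"
  define w where "w u = (if u = v then real (card \<sigma>) else 0) - (if u \<in> \<sigma> then 1 else 0)" for u
  define h where "h = (\<lambda>(t, x) u. x u + t * \<mu> x * w u)"
  have fin\<sigma>: "finite \<sigma>" and finV: "finite ?V" and V: "\<sigma> \<subseteq> ?V" "v \<in> ?V"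
    using simplicial_complexD[OF K(1)] K(2) by auto
  have sw: "sum w ?V = 0"
    using V finV by (simp add: w_def sum_subtractf sum.If_cases Int_absorb1)
  have top: "h (t, x) \<in> topspace (geometric_realization K)"
    "t = 1 \<Longrightarrow> h (t, x) \<in> topspace (geometric_realization F)"
    if x: "x \<in> topspace (geometric_realization K)" and t: "0 \<le> t" "t \<le> 1" for x t
  proof -
    have x0: "\<forall>u. 0 \<le> x u" and xK: "vertex_support x \<in> K" and x1: "sum x ?V = 1"
      using x by (simp_all add: geometric_realization_iff[OF K(1)])
    have \<mu>0: "0 \<le> \<mu> x" and \<mu>le: "\<And>u. u \<in> \<sigma> \<Longrightarrow> \<mu> x \<le> x u"
      using Min_coord_pos_iff(1)[OF fin\<sigma> \<sigma>(2) x0] Min_coord(1)[OF fin\<sigma> \<sigma>(2)] by (simp_all add: \<mu>_def)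
    have tm: "t * \<mu> x \<le> \<mu> x" using \<mu>0 t by (simp add: mult_left_le_one_le)
    have nonneg: "0 \<le> h (t, x) u" for u
    proof (cases "u \<in> \<sigma>")
      case True
      then have "h (t, x) u = x u - t * \<mu> x" using \<sigma> by (auto simp: h_def w_def)
      then show ?thesis using \<mu>le[OF True] tm by simp
    next
      case False
      then show ?thesis using \<mu>0 x0 t by (simp add: h_def w_def)
    qed
    have "sum (h (t, x)) ?V = sum x ?V + t * \<mu> x * sum w ?V"
      by (simp add: h_def sum.distrib sum_distrib_left)
    then have sum1: "sum (h (t, x)) ?V = 1" using sw x1 by simp
    have supp: "vertex_support (h (t, x)) \<in> K \<and> (t = 1 \<longrightarrow> vertex_support (h (t, x)) \<in> F)"
    proof (cases "\<mu> x = 0")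
      case True
      then have "h (t, x) = x" by (simp add: h_def)
      moreover have "\<not> \<sigma> \<subseteq> vertex_support x"
        using Min_coord_pos_iff(2)[OF fin\<sigma> \<sigma>(2) x0] True by (simp add: \<mu>_def)
      ultimately show ?thesis using xK K(2) by auto
    next
      case False
      then have "\<sigma> \<subseteq> vertex_support x"
        using Min_coord_pos_iff[OF fin\<sigma> \<sigma>(2) x0] by (simp add: \<mu>_def)
      \<comment> \<open>By freeness a support containing \<sigma> is \<sigma> or
        \<open>insert v \<sigma>\<close>, so the push stays in this one simplex.\<close>
      then have "vertex_support x \<subseteq> insert v \<sigma>" using xK F(2) K(2) by auto
      then have sub: "vertex_support (h (t, x)) \<subseteq> insert v \<sigma>"
        by (auto simp: vertex_support_def h_def w_def split: if_splits)
      then have "vertex_support (h (t, x)) \<in> K"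
        using simplicial_complexD(3)[OF K(1)] K(2) by blast
      moreover have "vertex_support (h (t, x)) \<in> F" if "t = 1"
      proof -
        obtain u where u: "u \<in> \<sigma>" "x u = \<mu> x"
          using Min_coord(2)[OF fin\<sigma> \<sigma>(2)] by (auto simp: \<mu>_def)
        then have "h (t, x) u = 0" using \<sigma> that by (auto simp: h_def w_def)
        then have "\<not> \<sigma> \<subseteq> vertex_support (h (t, x))" using u by (auto simp: vertex_support_def)
        then show ?thesis using calculation K(2) by auto
      qed
      ultimately show ?thesis by blast
    qed
    show "h (t, x) \<in> topspace (geometric_realization K)"
      using nonneg sum1 supp by (simp add: geometric_realization_iff[OF K(1)])
    show "h (t, x) \<in> topspace (geometric_realization F)" if "t = 1"
    proof -
      have "sum (h (t, x)) (\<Union>F) = sum (h (t, x)) ?V"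
        using sum_vertex_support[OF finV, of "h (t, x)"] supp that
          sum_vertex_support[OF simplicial_complexD(4)[OF F(1)], of "h (t, x)"] by fastforce
      then show ?thesis
        using nonneg sum1 supp that by (simp add: geometric_realization_iff[OF F(1)])
    qed
  qed
  have c\<mu>: "continuous_map (geometric_realization K) euclideanreal \<mu>"
    unfolding \<mu>_def by (intro continuous_map_Min fin\<sigma> \<sigma> continuous_intros)
  let ?P = "prod_topology (top_of_set {0..1::real}) (geometric_realization K)"
  have cfst: "continuous_map ?P euclideanreal fst"
    using continuous_map_fst continuous_map_into_fulltopology by blast
  have ch: "continuous_map ?P (geometric_realization K) h"
  proof (rule continuous_map_into_geometric_realization)
    fix u
    have "continuous_map ?P euclideanreal (\<lambda>p. snd p u + fst p * \<mu> (snd p) * w u)"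
      using cfst continuous_map_compose[OF continuous_map_snd c\<mu>]
        continuous_map_compose[OF continuous_map_snd continuous_map_geometric_realization_coord]
      by (intro continuous_intros) (simp_all add: o_def)
    then show "continuous_map ?P euclideanreal (\<lambda>p. h p u)"
      by (simp add: h_def case_prod_unfold)
  qed (use top(1) in auto)
  have cr: "continuous_map (geometric_realization K) (geometric_realization F) (\<lambda>x. h (1, x))"
  proof (rule continuous_map_into_geometric_realization)
    show "continuous_map (geometric_realization K) euclideanreal (\<lambda>x. h (1, x) u)" for u
      unfolding h_def prod.case by (intro continuous_intros c\<mu>)
  qed (use top(2)[of _ 1] in auto)
  have FK: "F \<subseteq> K" using K(2) by auto
  have ci: "continuous_map (geometric_realization F) (geometric_realization K) id"
    unfolding geometric_realization_subcomplex[OF FK] by (rule continuous_map_from_subtopology) simp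
  \<comment> \<open>The end of the push takes values in the realization of \<open>F\<close> and is
    homotopic to the identity, so the realization of \<open>F\<close> dominates that of
    \<open>K\<close>.\<close>
  have "homotopic_with (\<lambda>_. True) (geometric_realization K) (geometric_realization K)
      id (id \<circ> (\<lambda>x. h (1, x)))"
    unfolding homotopic_with_def using ch by (intro exI[of _ h]) (simp add: h_def)
  then show ?thesis
    using homotopy_dominated_contractibility[OF ci cr _ con] homotopic_with_symD by blast
qed

text \<open>Each pair undoes one elementary collapse. Nonemptiness is part of the claim because the
  empty space also counts as contractible, while a wedge needs a base point.\<close>

lemma contractible_realization_dismantles:
  assumes "dismantles (\<lambda>_. False) K" "simplicial_complex K" "K \<noteq> {}"
  shows "contractible_space (geometric_realization K) \<and> topspace (geometric_realization K) \<noteq> {}"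
  using assms
proof induction
  case (pair F \<sigma> v)
  let ?K = "insert \<sigma> (insert (insert v \<sigma>) F)"
  \<comment> \<open>No face of a member of \<open>F\<close> can be \<sigma> or
    \<open>insert v \<sigma>\<close>, since both contain \<sigma>.\<close>
  have F: "simplicial_complex F"
    using pair.prems(1) pair.hyps(4) unfolding simplicial_complex_def
    by (smt (verit, ccfv_SIG) finite_insert insert_iff subset_insertI subset_trans)
  show ?case
  proof (cases "F = {}")
    case True
    \<comment> \<open>A complex contains the empty simplex, so the first pair consists of it and a
      vertex, and the realization is a point.\<close>
    have "\<sigma> = {}"
    proof (rule ccontr)
      assume "\<sigma> \<noteq> {}"
      then show False
        using simplicial_complexD(3)[OF pair.prems(1), of \<sigma> "{}"] True by auto
    qed
    then have K: "?K = {{}, {v}}" using True by auto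
    have *: "topspace (geometric_realization ?K) = {\<lambda>u. if u = v then 1 else 0}"
    proof (intro equalityI subsetI)
      fix x assume "x \<in> topspace (geometric_realization ?K)"
      then have x: "vertex_support x \<in> {{}, {v}}" "sum x (vertex_support x) = 1"
        unfolding K by (auto simp: geometric_realization_def)
      then have v: "vertex_support x = {v}" by auto
      then have "x u = (if u = v then 1 else 0)" for u
        using x(2) by (cases "u = v") (auto simp: vertex_support_def)
      then show "x \<in> {\<lambda>u. if u = v then 1 else 0}" by auto
    next
      have "vertex_support (\<lambda>u. if u = v then 1 else 0) = {v}"
        by (auto simp: vertex_support_def)
      then show "x \<in> topspace (geometric_realization ?K)" if "x \<in> {\<lambda>u. if u = v then 1 else 0}" for x
        using that unfolding K by (auto simp: geometric_realization_def)
    qed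
    then show ?thesis
      by (metis contractible_space_subset_singleton insert_not_empty order_refl)
  next
    case False
    then have IH: "contractible_space (geometric_realization F)" "topspace (geometric_realization F) \<noteq> {}"
      using pair.IH F by auto
    obtain f where "f \<in> F" using False by blast
    then have "\<sigma> \<noteq> {}" using pair.hyps(4) by blast
    then have "contractible_space (geometric_realization ?K)"
      using contractible_realization_collapse[OF pair.prems(1) refl F pair.hyps(4,3) _ IH(1)] by blast
    moreover have "topspace (geometric_realization F) \<subseteq> topspace (geometric_realization ?K)"
      by (auto simp: geometric_realization_def)
    ultimately show ?thesis using IH(2) by auto
  qed
qed auto

section \<open>Dividing out a contractible subspace\<close>

text \<open>The homotopy contracts \<open>A\<close> within itself. Hence its end map is constant on
  \<open>A\<close> and descends to a homotopy inverse \<open>g\<close>, and the whole homotopy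
  descends to one on \<open>Y\<close>.\<close>

lemma homotopy_equivalent_quotient:
  assumes Q: "quotient_map X Y Q"
    and fib: "\<And>x y. x \<in> topspace X \<Longrightarrow> y \<in> topspace X \<Longrightarrow> Q x = Q y \<Longrightarrow> x = y \<or> x \<in> A \<and> y \<in> A"
    and QA: "\<And>x. x \<in> A \<Longrightarrow> Q x = c"
    and h: "continuous_map (prod_topology (top_of_set {0..1::real}) X) X h"
    and h0: "\<And>x. x \<in> topspace X \<Longrightarrow> h (0, x) = x"
    and hA: "\<And>t x. 0 \<le> t \<Longrightarrow> t \<le> 1 \<Longrightarrow> x \<in> A \<Longrightarrow> h (t, x) \<in> A"
    and h1: "\<And>x. x \<in> A \<Longrightarrow> h (1, x) = a"
  shows "X homotopy_equivalent_space Y"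
proof -
  let ?I = "top_of_set {0..1::real}"
  have Qc: "continuous_map X Y Q" and Qs: "Q ` topspace X = topspace Y"
    using Q by (simp_all add: quotient_imp_continuous_map quotient_imp_surjective_map)
  have ch1: "continuous_map X X (\<lambda>x. h (1, x))"
    using continuous_map_compose[OF _ h, of X "\<lambda>x. (1, x)"]
    by (simp add: o_def continuous_map_paired)
  obtain g where g: "continuous_map Y X g" "\<And>x. x \<in> topspace X \<Longrightarrow> g (Q x) = h (1, x)"
    using quotient_map_lift_exists[OF Q ch1] fib h1 by metis
  \<comment> \<open>Descending a homotopy needs the product of the quotient map with the unit
    interval to be a quotient map again; the interval is locally compact and Hausdorff.\<close>
  have QI: "quotient_map (prod_topology ?I X) (prod_topology ?I Y) (\<lambda>(t, x). (t, Q x))"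
    by (intro quotient_map_prod_right Q)
      (simp_all add: Hausdorff_space_subtopology compact_imp_locally_compact_space compact_space_subtopology)
  have cQh: "continuous_map (prod_topology ?I X) Y (Q \<circ> h)"
    by (rule continuous_map_compose[OF h Qc])
  have "(Q \<circ> h) p = (Q \<circ> h) q"
    if "p \<in> topspace (prod_topology ?I X)" "q \<in> topspace (prod_topology ?I X)"
      "(case p of (t, x) \<Rightarrow> (t, Q x)) = (case q of (t, x) \<Rightarrow> (t, Q x))" for p q
  proof -
    obtain t x s y where "p = (t, x)" "q = (s, y)" by (cases p; cases q)
    then have pq: "p = (t, x)" "q = (t, y)" and t: "0 \<le> t" "t \<le> 1" and "x \<in> topspace X" "y \<in> topspace X" "Q x = Q y"
      using that by auto
    then consider "x = y" | "x \<in> A" "y \<in> A" using fib by blast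
    then show ?thesis
    proof cases
      case 2
      then show ?thesis using QA hA[OF t] by (simp add: pq)
    qed (simp add: pq)
  qed
  then obtain k where k: "continuous_map (prod_topology ?I Y) Y k"
      "\<And>p. p \<in> topspace (prod_topology ?I X) \<Longrightarrow> k (case p of (t, x) \<Rightarrow> (t, Q x)) = (Q \<circ> h) p"
    using quotient_map_lift_exists[OF QI cQh] by metis
  have k': "k (t, Q x) = Q (h (t, x))" if "0 \<le> t" "t \<le> 1" "x \<in> topspace X" for t x
    using k(2)[of "(t, x)"] that by simp
  have "homotopic_with (\<lambda>_. True) X X id (g \<circ> Q)"
    by (subst homotopic_with) (use h h0 g(2) in auto)
  moreover have "homotopic_with (\<lambda>_. True) Y Y id (Q \<circ> g)"
  proof (subst homotopic_with, simp, intro exI conjI ballI)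
    fix y assume "y \<in> topspace Y"
    then obtain x where x: "x \<in> topspace X" "y = Q x" using Qs by blast
    show "k (0, y) = id y" using k'[of 0 x] x h0 by simp
    show "k (1, y) = (Q \<circ> g) y" using k'[of 1 x] x g(2) by simp
  qed (use k in auto)
  ultimately show ?thesis
    unfolding homotopy_equivalent_space_def using Qc g(1)
    by (intro exI[of _ Q] exI[of _ g] conjI) (auto intro: homotopic_with_symD)
qed

section \<open>A closed simplex mapped onto a sphere\<close>

lemma simplicial_complex_Pow: "finite \<tau> \<Longrightarrow> simplicial_complex (Pow \<tau>)"
  by (auto simp: simplicial_complex_def intro: finite_subset)

text \<open>Compactness is what later makes the map from a simplex to a sphere closed.\<close>

lemma compact_space_simplex:
  assumes "finite \<tau>"
  shows "compact_space (geometric_realization (Pow \<tau>))"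
proof -
  let ?E = "powertop_real (UNIV :: 'a set)"
  define S where "S = {x :: 'a \<Rightarrow> real. (\<forall>v. 0 \<le> x v) \<and> vertex_support x \<in> Pow \<tau> \<and> sum x (vertex_support x) = 1}"
  have S: "S = {x. (\<forall>v. 0 \<le> x v) \<and> vertex_support x \<subseteq> \<tau> \<and> sum x \<tau> = 1}"
    using sum_vertex_support[OF assms] by (auto simp: S_def)
  have proj: "continuous_map ?E euclideanreal (\<lambda>x. x v)" for v
    by (rule continuous_map_product_projection) simp
  have "closedin ?E {x \<in> topspace ?E. x v \<in> (if v \<in> \<tau> then {0..} else {0})}" for v
    by (rule closedin_continuous_map_preimage[OF proj]) simp
  then have "closedin ?E (\<Inter>v. {x \<in> topspace ?E. x v \<in> (if v \<in> \<tau> then {0..} else {0})})"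
    by (intro closedin_Inter) auto
  moreover have "closedin ?E {x \<in> topspace ?E. sum x \<tau> \<in> {1}}"
    by (rule closedin_continuous_map_preimage[where Y = euclideanreal])
      (use assms proj in \<open>auto intro!: continuous_map_sum\<close>)
  ultimately have "closedin ?E ((\<Inter>v. {x \<in> topspace ?E. x v \<in> (if v \<in> \<tau> then {0..} else {0})})
      \<inter> {x \<in> topspace ?E. sum x \<tau> \<in> {1}})"
    by (rule closedin_Int)
  also have "(\<Inter>v. {x \<in> topspace ?E. x v \<in> (if v \<in> \<tau> then {0..} else {0})})
      \<inter> {x \<in> topspace ?E. sum x \<tau> \<in> {1}} = S"
    by (fastforce simp: S vertex_support_def split: if_splits)
  finally have "closedin ?E S" .
  moreover have "compactin ?E (PiE UNIV (\<lambda>_. {0..1}))"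
    by (simp add: compactin_PiE)
  moreover have "S \<subseteq> PiE UNIV (\<lambda>_. {0..1})"
  proof
    fix x assume x: "x \<in> S"
    have "x v \<le> 1" for v
    proof (cases "v \<in> \<tau>")
      case True
      then have "x v \<le> sum x \<tau>" using x assms by (intro member_le_sum) (auto simp: S)
      then show ?thesis using x by (simp add: S)
    next
      case False
      then have "x v = 0" using x by (auto simp: S vertex_support_def)
      then show ?thesis by simp
    qed
    then show "x \<in> PiE UNIV (\<lambda>_. {0..1})" using x by (auto simp: S)
  qed
  ultimately have "compactin ?E S" by (metis closed_compactin)
  then show ?thesis
    unfolding geometric_realization_def S_def by (rule compact_space_subtopology)
qed

lemma Hausdorff_space_nsphere: "Hausdorff_space (nsphere p)"
  unfolding nsphere
  by (intro Hausdorff_space_subtopology) (simp add: Hausdorff_space_product_topology)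

lemma nsphere_base_unique:
  assumes "s \<in> topspace (nsphere p)"
  shows "s 0 \<le> 1" "s 0 = 1 \<Longrightarrow> s = nsphere_base"
proof -
  have s: "(\<Sum>i\<le>p. (s i)\<^sup>2) = 1" "\<And>i. i > p \<Longrightarrow> s i = 0"
    using assms by (simp_all add: nsphere)
  have split: "(\<Sum>i\<le>p. (s i)\<^sup>2) = (s 0)\<^sup>2 + (\<Sum>i=1..p. (s i)\<^sup>2)"
    by (simp add: sum.atLeast_Suc_atMost atMost_atLeast0)
  moreover have "(\<Sum>i=1..p. (s i)\<^sup>2) \<ge> 0" by (simp add: sum_nonneg)
  ultimately have "(s 0)\<^sup>2 \<le> 1\<^sup>2" using s by simp
  then show "s 0 \<le> 1" by (rule power2_le_imp_le) simp
  assume 1: "s 0 = 1"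
  then have "(\<Sum>i=1..p. (s i)\<^sup>2) = 0" using s split by simp
  then have "\<forall>i\<in>{1..p}. s i = 0" by (subst (asm) sum_nonneg_eq_0_iff) auto
  then have "s i = nsphere_base i" for i
    using 1 s(2)[of i] by (cases "i = 0"; cases "i \<le> p") (auto simp: nsphere_base_def)
  then show "s = nsphere_base" by blast
qed

text \<open>Scaling the open simplex radially onto a Euclidean space, with the barycentre as origin,
  and then applying the inverse stereographic projection yields a rational map on the
  whole simplex.\<close>

lemma simplex_onto_nsphere:
  fixes \<tau> :: "'v set"
  assumes "finite \<tau>" "card \<tau> = Suc p"
  obtains q where
    "continuous_map (geometric_realization (Pow \<tau>)) (nsphere p) q"
    "\<And>x. x \<in> topspace (geometric_realization (Pow \<tau>)) \<Longrightarrow> q x = nsphere_base \<longleftrightarrow> vertex_support x \<noteq> \<tau>"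
    "inj_on q {x \<in> topspace (geometric_realization (Pow \<tau>)). vertex_support x = \<tau>}"
    "topspace (nsphere p) - {nsphere_base} \<subseteq> q ` topspace (geometric_realization (Pow \<tau>))"
proof -
  let ?G = "geometric_realization (Pow \<tau>)"
  have ne: "\<tau> \<noteq> {}" using assms by auto
  obtain e where e: "bij_betw e {..p} \<tau>"
    using assms by (metis finite_atMost card_atMost finite_same_card_bij)
  define \<kappa> where "\<kappa> = real (Suc p)"
  have \<kappa>: "\<kappa> > 0" by (simp add: \<kappa>_def)
  \<comment> \<open>\<open>y\<close> is the displacement from the barycentre, and \<open>m\<close>
    is 1 at the barycentre and 0 on the boundary. The coordinates of \<open>y x\<close> sum to 0, so
    those with index 1 to \<open>p\<close> determine it. \<open>q\<close> is the inverse
    stereographic image of \<open>y / m\<close>; expanding the fractions by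
    \<open>(m x)\<^sup>2\<close> removes the division by \<open>m\<close>, so the formula also
    covers the boundary.\<close>
  define y where "y x j = x (e j) - 1 / \<kappa>" for x :: "'v \<Rightarrow> real" and j
  define m where "m x = \<kappa> * Min (x ` \<tau>)" for x :: "'v \<Rightarrow> real"
  define N where "N x = (\<Sum>j=1..p. (y x j)\<^sup>2)" for x :: "'v \<Rightarrow> real"
  define q where "q x j = (if j = 0 then (N x - (m x)\<^sup>2) / (N x + (m x)\<^sup>2)
      else if j \<le> p then 2 * m x * y x j / (N x + (m x)\<^sup>2) else 0)" for x :: "'v \<Rightarrow> real" and j
  have split: "(\<Sum>i\<le>p. g i) = g 0 + (\<Sum>i=1..p. g i)" for g :: "nat \<Rightarrow> real"
    by (simp add: sum.atLeast_Suc_atMost atMost_atLeast0)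
  have G: "x \<in> topspace ?G \<longleftrightarrow> (\<forall>v. 0 \<le> x v) \<and> vertex_support x \<subseteq> \<tau> \<and> sum x \<tau> = 1" for x
    using geometric_realization_iff[OF simplicial_complex_Pow[OF assms(1)], of x] by simp
  have sy: "(\<Sum>j\<le>p. y x j) = 0" if "x \<in> topspace ?G" for x
  proof -
    have "(\<Sum>j\<le>p. x (e j)) = 1" using that sum.reindex_bij_betw[OF e, of x] by (simp add: G)
    then show ?thesis by (simp add: y_def sum_subtractf \<kappa>_def)
  qed
  then have y0: "y x 0 = - (\<Sum>j=1..p. y x j)" if "x \<in> topspace ?G" for x
    using that split[of "y x"] by simp
  have mlow: "m x / \<kappa> \<le> x v" if "v \<in> \<tau>" for x v
    using Min_coord(1)[OF assms(1) ne that] \<kappa> by (simp add: m_def)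
  \<comment> \<open>A vertex with least coordinate has displacement
    \<open>(m x - 1) / \<kappa>\<close>. This excludes a vanishing denominator and later recovers
    \<open>m x\<close> from the ratios \<open>y x j / m x\<close>.\<close>
  have mat: "\<exists>j\<le>p. y x j = (m x - 1) / \<kappa>" for x
    using Min_coord(2)[OF assms(1) ne, of x] e \<kappa>
    by (auto simp: m_def y_def bij_betw_def image_iff diff_divide_distrib)
  have m0: "0 \<le> m x" and mpos: "0 < m x \<longleftrightarrow> vertex_support x = \<tau>" if "x \<in> topspace ?G" for x
    using Min_coord_pos_iff[OF assms(1) ne, of x] that \<kappa> by (auto simp: m_def G zero_less_mult_iff)
  have N0: "0 \<le> N x" for x by (simp add: N_def sum_nonneg)
  have pos: "0 < N x + (m x)\<^sup>2" if x: "x \<in> topspace ?G" for x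
  proof (rule ccontr)
    assume "\<not> ?thesis"
    then have "N x = 0" "(m x)\<^sup>2 = 0" using N0[of x] zero_le_power2[of "m x"] by linarith+
    then have "m x = 0" by simp
    from \<open>N x = 0\<close>
    have "\<forall>j\<in>{1..p}. (y x j)\<^sup>2 = 0" unfolding N_def by (subst (asm) sum_nonneg_eq_0_iff) auto
    then have "y x j = 0" if "j \<le> p" for j
      using y0[OF x] that by (cases "j = 0") auto
    then show False using mat[of x] \<open>m x = 0\<close> \<kappa> by force
  qed
  have qtop: "q x \<in> topspace (nsphere p)" if x: "x \<in> topspace ?G" for x
  proof -
    let ?d = "N x + (m x)\<^sup>2"
    have "(\<Sum>i=1..p. (q x i)\<^sup>2) = (\<Sum>i=1..p. (y x i)\<^sup>2 * (2 * m x / ?d)\<^sup>2)"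
      by (intro sum.cong) (auto simp: q_def power_mult_distrib power_divide)
    also have "\<dots> = N x * (2 * m x / ?d)\<^sup>2" by (simp add: N_def sum_distrib_right)
    finally have "(\<Sum>i\<le>p. (q x i)\<^sup>2) = ((N x - (m x)\<^sup>2) / ?d)\<^sup>2 + N x * (2 * m x / ?d)\<^sup>2"
      by (simp add: split) (simp add: q_def)
    also have "\<dots> = ((N x - (m x)\<^sup>2)\<^sup>2 + 4 * N x * (m x)\<^sup>2) / ?d\<^sup>2"
      by (simp add: power_divide power_mult_distrib add_divide_distrib)
    also have "(N x - (m x)\<^sup>2)\<^sup>2 + 4 * N x * (m x)\<^sup>2 = ?d\<^sup>2" by (simp add: power2_eq_square algebra_simps)
    finally show ?thesis using pos[OF x] by (simp add: nsphere q_def)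
  qed
  have cm: "continuous_map ?G euclideanreal m"
    unfolding m_def by (intro continuous_intros continuous_map_Min assms ne)
  have cy: "continuous_map ?G euclideanreal (\<lambda>x. y x j)" for j
    unfolding y_def by (intro continuous_intros)
  have cN: "continuous_map ?G euclideanreal N"
    unfolding N_def by (intro continuous_intros cy) auto
  have cq: "continuous_map ?G (nsphere p) q"
  proof -
    have "continuous_map ?G euclideanreal (\<lambda>x. q x j)" for j
    proof -
      consider "j = 0" | "j \<noteq> 0" "j \<le> p" | "j > p" by linarith
      then show ?thesis
      proof cases
        case 1
        have "continuous_map ?G euclideanreal (\<lambda>x. (N x - (m x)\<^sup>2) / (N x + (m x)\<^sup>2))"
          by (intro continuous_intros cm cN) (use pos in fastforce)
        then show ?thesis using 1 by (simp add: q_def)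
      next
        case 2
        have "continuous_map ?G euclideanreal (\<lambda>x. 2 * m x * y x j / (N x + (m x)\<^sup>2))"
          by (intro continuous_intros cm cN cy) (use pos in fastforce)
        then show ?thesis using 2 by (simp add: q_def)
      qed (simp add: q_def)
    qed
    then have "continuous_map ?G (powertop_real UNIV) q"
      by (simp add: continuous_map_componentwise_UNIV)
    then show ?thesis using qtop unfolding nsphere
      by (intro continuous_map_into_subtopology) auto
  qed
  \<comment> \<open>So \<open>q x\<close> is the base point exactly if \<open>m x = 0\<close>, and
    elsewhere the stereographic projection \<open>q x j / (1 - q x 0)\<close> gives back the ratio
    \<open>y x j / m x\<close>.\<close>
  have q0: "1 - q x 0 = 2 * (m x)\<^sup>2 / (N x + (m x)\<^sup>2)" if "x \<in> topspace ?G" for x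
    using pos[OF that] by (simp add: q_def field_simps)
  have base: "q x = nsphere_base \<longleftrightarrow> vertex_support x \<noteq> \<tau>" if x: "x \<in> topspace ?G" for x
  proof -
    have "q x = nsphere_base \<longleftrightarrow> q x 0 = 1"
      using nsphere_base_unique(2)[OF qtop[OF x]] by (auto simp: nsphere_base_def)
    also have "\<dots> \<longleftrightarrow> m x = 0" using q0[OF x] pos[OF x] by auto
    also have "\<dots> \<longleftrightarrow> vertex_support x \<noteq> \<tau>" using m0[OF x] mpos[OF x] by auto
    finally show ?thesis .
  qed
  have scale: "y x j / m x = q x j / (1 - q x 0)"
    if "x \<in> topspace ?G" "m x > 0" "j \<in> {1..p}" for x j
    using that pos[OF that(1)] q0[OF that(1)] by (simp add: q_def power2_eq_square)
  have "inj_on q {x \<in> topspace ?G. vertex_support x = \<tau>}"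
  proof (rule inj_onI)
    fix x x' assume "x \<in> {x \<in> topspace ?G. vertex_support x = \<tau>}"
      "x' \<in> {x \<in> topspace ?G. vertex_support x = \<tau>}" and eq: "q x = q x'"
    then have x: "x \<in> topspace ?G" "vertex_support x = \<tau>"
      and x': "x' \<in> topspace ?G" "vertex_support x' = \<tau>" by auto
    have mp: "m x > 0" "m x' > 0" using mpos x x' by auto
    have "y x j / m x = y x' j / m x'" if "j \<in> {1..p}" for j
      using scale[OF x(1) mp(1) that] scale[OF x'(1) mp(2) that] eq by simp
    then have yy: "y x j / m x = y x' j / m x'" if "j \<le> p" for j
      using that y0[OF x(1)] y0[OF x'(1)]
      by (cases "j = 0") (simp_all add: sum_divide_distrib)
    \<comment> \<open>The least ratio \<open>y a j / m a\<close> is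
      \<open>(m a - 1) / (\<kappa> * m a)\<close>, which increases with \<open>m a\<close>; equal
      ratios therefore force equal values of \<open>m\<close>.\<close>
    have le: "m a \<le> m b" if a: "m a > 0" and b: "m b > 0" and
      ab: "\<And>j. j \<le> p \<Longrightarrow> y a j / m a = y b j / m b" for a b
    proof -
      obtain j where j: "j \<le> p" "y b j = (m b - 1) / \<kappa>" using mat by blast
      have "m a / \<kappa> \<le> a (e j)" using j e by (intro mlow) (auto simp: bij_betw_def)
      then have "(m a - 1) / \<kappa> \<le> y a j" by (simp add: y_def diff_divide_distrib)
      then have "(m a - 1) / \<kappa> / m a \<le> y b j / m b"
        using ab[OF j(1)] a by (metis divide_right_mono less_imp_le)
      then have "(m a - 1) / m a / \<kappa> \<le> (m b - 1) / m b / \<kappa>"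
        by (simp add: j(2) mult.commute)
      then have "(m a - 1) / m a \<le> (m b - 1) / m b"
        using \<kappa> divide_le_cancel[of "(m a - 1) / m a" \<kappa> "(m b - 1) / m b"] by blast
      then show ?thesis using a b by (simp add: field_simps)
    qed
    have "m x = m x'" using le[OF mp yy] le[OF mp(2,1) yy[symmetric]] by simp
    then have "y x j = y x' j" if "j \<le> p" for j using yy[OF that] mp by simp
    then have "x (e j) = x' (e j)" if "j \<le> p" for j using that by (simp add: y_def)
    then have "x v = x' v" if "v \<in> \<tau>" for v
      using that e by (auto simp: bij_betw_def)
    moreover have "x v = x' v" if v: "v \<notin> \<tau>" for v
    proof -
      have "v \<notin> vertex_support x" "v \<notin> vertex_support x'" using v x(2) x'(2) by simp_all
      then have "x v = 0" "x' v = 0" by (simp_all add: vertex_support_def)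
      then show "x v = x' v" by simp
    qed
    ultimately show "x = x'" by blast
  qed
  moreover have "topspace (nsphere p) - {nsphere_base} \<subseteq> q ` topspace ?G"
  proof
    fix s assume s: "s \<in> topspace (nsphere p) - {nsphere_base}"
    then have s1: "s 0 < 1" using nsphere_base_unique[of s p] by force
    \<comment> \<open>The stereographic projection of \<open>s\<close>, with coordinate 0 restored
      so that the sum is 0.\<close>
    define z where "z j = (if j = 0 then - (\<Sum>i=1..p. s i) else s j) / (1 - s 0)" for j
    have sz: "(\<Sum>j\<le>p. z j) = 0"
    proof -
      have "(\<Sum>j=1..p. z j) = (\<Sum>i=1..p. s i) / (1 - s 0)"
        by (simp add: z_def sum_divide_distrib)
      then show ?thesis by (simp add: split) (simp add: z_def)
    qed
    define \<mu> where "\<mu> = Min (z ` {..p})"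
    have \<mu>le: "\<mu> \<le> z j" if "j \<le> p" for j using that by (simp add: \<mu>_def)
    have "\<mu> \<in> z ` {..p}" unfolding \<mu>_def by (rule Min_in) auto
    then obtain i where i: "i \<le> p" "\<mu> = z i" by blast
    have "\<mu> * \<kappa> \<le> 0" using sum_bounded_below[of "{..p}" \<mu> z] \<mu>le sz by (simp add: \<kappa>_def mult.commute)
    then have den: "1 - \<kappa> * \<mu> > 0" by (simp add: mult.commute)
    \<comment> \<open>The preimage is sought as the barycentre plus \<open>c * z\<close>, where
      \<open>c\<close> has to be its value of \<open>m\<close>. Its least coordinate
      \<open>1 / \<kappa> + c * \<mu>\<close> must then be \<open>c / \<kappa>\<close>, which
      determines \<open>c\<close>.\<close>
    define c where "c = 1 / (1 - \<kappa> * \<mu>)"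
    have c: "c > 0" "c * (1 - \<kappa> * \<mu>) = 1" using den by (simp_all add: c_def)
    define x where "x v = (if v \<in> \<tau> then 1 / \<kappa> + c * z (inv_into {..p} e v) else 0)" for v
    have xe: "x (e j) = 1 / \<kappa> + c * z j" if "j \<le> p" for j
      using that e by (auto simp: x_def bij_betw_def)
    have low: "1 / \<kappa> + c * \<mu> = c / \<kappa>" using c(2) \<kappa> by (simp add: field_simps)
    have xge: "c / \<kappa> \<le> x v" if v: "v \<in> \<tau>" for v
    proof -
      obtain j where "j \<le> p" "v = e j" using v e by (auto simp: bij_betw_def)
      then show ?thesis using xe \<mu>le c(1) by (simp flip: low)
    qed
    have "Min (x ` \<tau>) = c / \<kappa>"
    proof (rule Min_eqI)
      show "c / \<kappa> \<in> x ` \<tau>"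
        using xe[OF i(1)] i e low by (metis atMost_iff bij_betwE image_eqI)
    qed (use assms xge in auto)
    then have mx: "m x = c" using \<kappa> by (simp add: m_def)
    have x0: "0 \<le> x v" for v
      using xge[of v] c(1) \<kappa> by (cases "v \<in> \<tau>") (auto simp: x_def intro: order_trans[rotated])
    have "sum x \<tau> = (\<Sum>j\<le>p. x (e j))" using sum.reindex_bij_betw[OF e, of x] by simp
    also have "\<dots> = (\<Sum>j\<le>p. 1 / \<kappa>) + c * (\<Sum>j\<le>p. z j)"
      using xe by (simp add: sum.distrib sum_distrib_left)
    finally have "sum x \<tau> = 1" using sz by (simp add: \<kappa>_def)
    then have x: "x \<in> topspace ?G" using x0 by (auto simp: G vertex_support_def x_def)
    have yx: "y x j = c * s j / (1 - s 0)" if "j \<in> {1..p}" for j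
      using that xe[of j] by (simp add: y_def z_def)
    have ss: "(\<Sum>i=1..p. (s i)\<^sup>2) = 1 - (s 0)\<^sup>2"
      using s split[of "\<lambda>i. (s i)\<^sup>2"] by (simp add: nsphere)
    have "N x = (\<Sum>i=1..p. (s i)\<^sup>2 * (c / (1 - s 0))\<^sup>2)"
      unfolding N_def by (intro sum.cong refl) (simp add: yx power_mult_distrib power_divide)
    also have "\<dots> = (1 - (s 0)\<^sup>2) * (c / (1 - s 0))\<^sup>2" by (subst sum_distrib_right[symmetric]) (simp only: ss)
    also have "\<dots> = c\<^sup>2 * ((1 + s 0) / (1 - s 0))"
    proof -
      have "1 - (s 0)\<^sup>2 = (1 + s 0) * (1 - s 0)" by (simp add: power2_eq_square algebra_simps)
      moreover have "1 - s 0 \<noteq> 0" using s1 by simp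
      ultimately show ?thesis by (simp add: power2_eq_square)
    qed
    finally have N: "N x = c\<^sup>2 * ((1 + s 0) / (1 - s 0))" .
    have d: "N x + (m x)\<^sup>2 = 2 * c\<^sup>2 / (1 - s 0)"
      using s1 by (simp add: N mx field_simps)
    have "q x j = s j" for j
    proof -
      consider "j = 0" | "j \<in> {1..p}" | "j > p" by fastforce
      then show ?thesis
      proof cases
        case 1
        have "1 - q x 0 = 2 * c\<^sup>2 / (2 * c\<^sup>2 / (1 - s 0))" by (simp only: q0[OF x] d) (simp only: mx)
        then show ?thesis using 1 s1 c(1) by simp
      next
        case 2
        then have "q x j = 2 * c * (c * s j / (1 - s 0)) / (2 * c\<^sup>2 / (1 - s 0))"
          unfolding q_def d by (simp add: mx yx)
        then show ?thesis using s1 c(1) by (simp add: power2_eq_square)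
      qed (use s in \<open>simp add: q_def nsphere\<close>)
    qed
    then have "s = q x" by auto
    then show "s \<in> q ` topspace ?G" using x by blast
  qed
  ultimately show thesis using that cq base by blast
qed

text \<open>Homotopy extension: a contraction of the subcomplex below the top-dimensional simplices \<open>M\<close>
  extends by stretching an inner copy of each of these simplices over the whole simplex and
  running the contraction on the collar.\<close>

lemma extend_contraction:
  fixes K :: "'v set set"
  assumes K: "simplicial_complex K" and M: "M \<subseteq> K" "\<And>\<tau>. \<tau> \<in> M \<Longrightarrow> card \<tau> = Suc p"
    and dim: "\<And>\<tau>. \<tau> \<in> K \<Longrightarrow> card \<tau> \<le> Suc p"
    and con: "contractible_space (geometric_realization (K - M))"
      "topspace (geometric_realization (K - M)) \<noteq> {}"
  obtains H a where
    "continuous_map (prod_topology (top_of_set {0..1::real}) (geometric_realization K)) (geometric_realization K) H"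
    "\<And>x. x \<in> topspace (geometric_realization K) \<Longrightarrow> H (0, x) = x"
    "\<And>t x. 0 \<le> t \<Longrightarrow> t \<le> 1 \<Longrightarrow> x \<in> topspace (geometric_realization (K - M)) \<Longrightarrow>
      H (t, x) \<in> topspace (geometric_realization (K - M))"
    "\<And>x. x \<in> topspace (geometric_realization (K - M)) \<Longrightarrow> H (1, x) = a"
proof -
  let ?G = "geometric_realization K" and ?L = "geometric_realization (K - M)"
  let ?I = "top_of_set {0..1::real}"
  define \<kappa> where "\<kappa> = real (Suc p)"
  have \<kappa>: "\<kappa> > 0" by (simp add: \<kappa>_def)
  obtain a h where ch: "continuous_map (prod_topology ?I ?L) ?L h"
    and h0: "\<And>x. h (0, x) = x" and h1: "\<And>x. h (1, x) = a"
    using con(1) unfolding contractible_space_def homotopic_with_def by auto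
  have finM: "finite M" using simplicial_complexD(1)[OF K] M(1) finite_subset by blast
  have Mfin: "finite \<tau>" "\<tau> \<noteq> {}" if "\<tau> \<in> M" for \<tau>
    using that M simplicial_complexD(2)[OF K] by fastforce+
  have G: "x \<in> topspace ?G \<longleftrightarrow> (\<forall>v. 0 \<le> x v) \<and> vertex_support x \<in> K \<and> sum x (\<Union>K) = 1" for x
    by (rule geometric_realization_iff[OF K])
  have L: "x \<in> topspace ?L \<longleftrightarrow> x \<in> topspace ?G \<and> vertex_support x \<notin> M" for x
    by (auto simp: geometric_realization_def)
  \<comment> \<open>On a simplex \<tau> of \<open>M\<close>, \<open>m \<tau> x\<close> runs from 0
    at the boundary to 1 at the barycentre \<open>b \<tau>\<close>. It vanishes outside the open
    simplex because \<tau> has maximal size, so for \<open>t \<ge> 0\<close> at most one summand of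
    \<open>md\<close>, \<open>D\<close> and \<open>D'\<close> is nonzero.\<close>
  define m where "m \<tau> x = \<kappa> * Min (x ` \<tau>)" for \<tau> and x :: "'v \<Rightarrow> real"
  define b where "b \<tau> v = (if v \<in> \<tau> then 1 / \<kappa> else 0)" for \<tau> and v :: 'v
  define md where "md x = (\<Sum>\<tau>\<in>M. m \<tau> x)" for x
  define D where "D x v = (\<Sum>\<tau>\<in>M. m \<tau> x * b \<tau> v)" for x v
  \<comment> \<open>The truncation gives one continuous formula for all simplices: where
    \<open>md x \<ge> t / 2\<close>, the difference of \<open>D\<close> and \<open>D'\<close> is
    \<open>t / 2\<close> times the barycentre. \<open>r\<close> projects radially to the boundary
    and serves on the collar \<open>md x \<le> t / 2\<close>, while \<open>E\<close> stretches the
    inner simplex over the whole one. The level \<open>t / 2\<close> is at most 1/2, which keeps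
    both denominators positive where they are used.\<close>
  define D' where "D' t x v = (\<Sum>\<tau>\<in>M. max 0 (m \<tau> x - t / 2) * b \<tau> v)" for t x v
  define r where "r x v = (x v - D x v) / (1 - md x)" for x v
  define E where "E = (\<lambda>(t, x) v. (x v - D x v + D' t x v) / (1 - t / 2))"
  define H where "H = (\<lambda>(t, x). if md x \<le> t / 2 then h (t - 2 * md x, r x) else E (t, x))"
  have m0: "0 \<le> m \<tau> x" if "\<tau> \<in> M" "x \<in> topspace ?G" for \<tau> x
    using Min_coord_pos_iff(1)[OF Mfin[OF that(1)], of x] that \<kappa> by (simp add: m_def G)
  have mpos: "0 < m \<tau> x \<longleftrightarrow> vertex_support x = \<tau>" if "\<tau> \<in> M" "x \<in> topspace ?G" for \<tau> x
  proof -
    have "0 < m \<tau> x \<longleftrightarrow> \<tau> \<subseteq> vertex_support x"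
      using Min_coord_pos_iff(2)[OF Mfin[OF that(1)], of x] that \<kappa> by (simp add: m_def G zero_less_mult_iff)
    moreover have "finite (vertex_support x)" "card (vertex_support x) \<le> card \<tau>"
      using that dim M simplicial_complexD(2)[OF K] by (auto simp: G)
    ultimately show ?thesis using card_seteq by blast
  qed
  have mz: "m \<tau> x = 0" if "\<tau> \<in> M" "x \<in> topspace ?G" "vertex_support x \<noteq> \<tau>" for \<tau> x
    using m0[OF that(1,2)] mpos[OF that(1,2)] that(3) by simp
  have single: "(\<Sum>\<tau>\<in>M. f \<tau>) = f (vertex_support x)"
    if "vertex_support x \<in> M" "\<And>\<tau>. \<tau> \<in> M \<Longrightarrow> \<tau> \<noteq> vertex_support x \<Longrightarrow> f \<tau> = 0" for f :: "'v set \<Rightarrow> real" and x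
    using that finM by (subst sum.remove[of _ "vertex_support x"]) (auto intro: sum.neutral)
  have onL: "md x = 0" "D x v = 0" "r x = x" if "x \<in> topspace ?L" for x v
  proof -
    have z: "m \<tau> x = 0" if "\<tau> \<in> M" for \<tau> using mz[OF that] L that \<open>x \<in> topspace ?L\<close> by blast
    show 1: "md x = 0" "D x v = 0" for v using z by (simp_all add: md_def D_def)
    show "r x = x" by (rule ext) (simp add: r_def 1)
  qed
  have onM: "md x = m \<tau> x" "D x v = m \<tau> x * b \<tau> v"
      "0 \<le> t \<Longrightarrow> D' t x v = max 0 (m \<tau> x - t / 2) * b \<tau> v"
    if "x \<in> topspace ?G" "vertex_support x = \<tau>" "\<tau> \<in> M" for x \<tau> v t
  proof -
    have z: "m \<tau>' x = 0" if "\<tau>' \<in> M" "\<tau>' \<noteq> vertex_support x" for \<tau>'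
      using mz[of \<tau>' x] that \<open>x \<in> topspace ?G\<close> by auto
    have s: "vertex_support x \<in> M" using that by simp
    show "md x = m \<tau> x" "D x v = m \<tau> x * b \<tau> v"
      unfolding md_def D_def using single[OF s] z that by auto
    show "D' t x v = max 0 (m \<tau> x - t / 2) * b \<tau> v" if "0 \<le> t"
      unfolding D'_def by (subst single[OF s]) (use z that \<open>vertex_support x = \<tau>\<close> in auto)
  qed
  have sb: "sum (b \<tau>) (\<Union>K) = 1" if "\<tau> \<in> M" for \<tau>
  proof -
    have "sum (b \<tau>) (\<Union>K) = sum (b \<tau>) \<tau>"
      using that M simplicial_complexD(4)[OF K] by (intro sum.mono_neutral_right) (auto simp: b_def)
    then show ?thesis using M(2)[OF that] by (simp add: b_def \<kappa>_def)
  qed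
  have mlow: "m \<tau> x * b \<tau> v \<le> x v" if "\<tau> \<in> M" "x \<in> topspace ?G" for \<tau> x v
    using Min_coord(1)[OF Mfin[OF that(1)], of v x] that \<kappa> by (auto simp: m_def b_def G)
  have mat: "\<exists>v\<in>\<tau>. x v = m \<tau> x * b \<tau> v" if "\<tau> \<in> M" for \<tau> x
    using Min_coord(2)[OF Mfin[OF that], of x] \<kappa> by (auto simp: m_def b_def)
  have rL: "r x \<in> topspace ?L" if x: "x \<in> topspace ?G" and md: "md x < 1" for x
  proof (cases "vertex_support x \<in> M")
    case False
    then show ?thesis using onL(3)[of x] x L by simp
  next
    case True
    let ?\<tau> = "vertex_support x"
    have rx: "r x v = (x v - m ?\<tau> x * b ?\<tau> v) / (1 - m ?\<tau> x)" for v
      using onM(1,2)[OF x refl True] by (simp add: r_def)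
    have m1: "m ?\<tau> x < 1" using md onM(1)[OF x refl True] by simp
    have nn: "0 \<le> r x v" for v using mlow[OF True x, of v] m1 by (simp add: rx)
    obtain u where u: "u \<in> ?\<tau>" "x u = m ?\<tau> x * b ?\<tau> u" using mat[OF True] by blast
    have "vertex_support (r x) \<subseteq> ?\<tau>" by (auto simp: vertex_support_def rx b_def)
    moreover have "u \<notin> vertex_support (r x)" using u by (simp add: vertex_support_def rx)
    ultimately have ps: "vertex_support (r x) \<subset> ?\<tau>" using u by blast
    then have rK: "vertex_support (r x) \<in> K" using True M simplicial_complexD(3)[OF K] by blast
    moreover have "card (vertex_support (r x)) < Suc p"
      using psubset_card_mono[OF Mfin(1)[OF True] ps] M(2)[OF True] by simp
    then have "vertex_support (r x) \<notin> M" using M(2) by fastforce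
    moreover have "sum (r x) (\<Union>K) = (sum x (\<Union>K) - m ?\<tau> x * sum (b ?\<tau>) (\<Union>K)) / (1 - m ?\<tau> x)"
      by (simp add: rx sum_subtractf sum_distrib_left flip: sum_divide_distrib)
    then have "sum (r x) (\<Union>K) = 1" using x m1 by (simp add: G sb[OF True])
    ultimately show ?thesis using nn by (simp add: L G)
  qed
  have EG: "E (t, x) \<in> topspace ?G" if x: "x \<in> topspace ?G" and t: "0 \<le> t" "t \<le> 1" "t / 2 \<le> md x" for x t
  proof (cases "vertex_support x \<in> M")
    case False
    then have xL: "x \<in> topspace ?L" using x L by simp
    then have t0: "t = 0" using onL(1) t by fastforce
    have "D' 0 x v = D x v" for v
      unfolding D'_def D_def using m0 x by (intro sum.cong) auto
    then have "E (t, x) = x" by (simp add: E_def t0)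
    then show ?thesis using x by simp
  next
    case True
    let ?\<tau> = "vertex_support x"
    have mt: "t / 2 \<le> m ?\<tau> x" using t onM(1)[OF x refl True] by simp
    have Ex: "E (t, x) v = (x v - t / 2 * b ?\<tau> v) / (1 - t / 2)" for v
      using onM[OF x refl True] mt t by (simp add: E_def algebra_simps)
    have t1: "1 - t / 2 > 0" using t by simp
    have b0: "0 \<le> b ?\<tau> v" for v using \<kappa> by (simp add: b_def)
    have nn: "0 \<le> E (t, x) v" for v
    proof -
      have "t / 2 * b ?\<tau> v \<le> m ?\<tau> x * b ?\<tau> v" using mt b0 by (rule mult_right_mono)
      then show ?thesis using mlow[OF True x, of v] t1 by (simp add: Ex)
    qed
    have "vertex_support (E (t, x)) \<subseteq> ?\<tau>" by (auto simp: vertex_support_def Ex b_def)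
    then have "vertex_support (E (t, x)) \<in> K" using True M simplicial_complexD(3)[OF K] by blast
    moreover have "sum (E (t, x)) (\<Union>K) = (sum x (\<Union>K) - t / 2 * sum (b ?\<tau>) (\<Union>K)) / (1 - t / 2)"
      unfolding Ex by (simp only: sum_subtractf sum_distrib_left flip: sum_divide_distrib)
    then have "sum (E (t, x)) (\<Union>K) = 1" using x t1 by (simp add: G sb[OF True])
    ultimately show ?thesis using nn by (simp add: G)
  qed
  have hL: "h (t, x) \<in> topspace ?L" if "0 \<le> t" "t \<le> 1" "x \<in> topspace ?L" for t x
    using continuous_map_image_subset_topspace[OF ch] that by auto
  have cmt: "continuous_map ?G euclideanreal (m \<tau>)" if "\<tau> \<in> M" for \<tau>
    unfolding m_def by (intro continuous_intros continuous_map_Min Mfin that)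
  have cmd: "continuous_map ?G euclideanreal md"
    unfolding md_def by (intro continuous_intros finM cmt)
  have cD: "continuous_map ?G euclideanreal (\<lambda>x. D x v)" for v
    unfolding D_def by (intro continuous_intros finM cmt)
  let ?P = "prod_topology ?I ?G"
  have cfst: "continuous_map ?P euclideanreal fst"
    using continuous_map_fst continuous_map_into_fulltopology by blast
  have csnd: "continuous_map ?P euclideanreal (\<lambda>p. f (snd p))" if "continuous_map ?G euclideanreal f" for f
    using continuous_map_compose[OF continuous_map_snd that] by (simp add: o_def)
  have cH: "continuous_map ?P ?G H"
  proof -
    have "continuous_map ?P ?G (\<lambda>p. if md (snd p) \<le> fst p / 2 then h (fst p - 2 * md (snd p), r (snd p)) else E p)"
    proof (rule continuous_map_cases_le)
      show "continuous_map ?P euclideanreal (\<lambda>p. md (snd p))" by (rule csnd[OF cmd])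
      show "continuous_map ?P euclideanreal (\<lambda>p. fst p / 2)"
        by (intro continuous_intros cfst) auto
      \<comment> \<open>On the interface \<open>h\<close> is taken at time 0 and \<open>D'\<close>
        vanishes, so both formulas give \<open>r x\<close>.\<close>
      show "h (fst p - 2 * md (snd p), r (snd p)) = E p"
        if "p \<in> topspace ?P" "md (snd p) = fst p / 2" for p
      proof -
        obtain t x where p: "p = (t, x)" by (cases p)
        have x: "x \<in> topspace ?G" and t: "0 \<le> t" "t \<le> 1" "md x = t / 2" using that p by auto
        have "m \<tau> x \<le> t / 2" if "\<tau> \<in> M" for \<tau>
          using member_le_sum[of \<tau> M "\<lambda>\<tau>. m \<tau> x"] that m0 x finM t(3) by (simp add: md_def)
        then have "D' t x v = 0" for v unfolding D'_def by (intro sum.neutral) auto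
        then show ?thesis by (simp add: p t(3) h0 E_def r_def fun_eq_iff)
      qed
      let ?P1 = "subtopology ?P {p \<in> topspace ?P. md (snd p) \<le> fst p / 2}"
      have P1: "0 \<le> fst p \<and> fst p \<le> 1 \<and> snd p \<in> topspace ?G \<and> 0 \<le> md (snd p) \<and> md (snd p) \<le> fst p / 2"
        if "p \<in> topspace ?P1" for p
        using that m0 by (auto simp: md_def intro!: sum_nonneg)
      have "continuous_map ?P1 (prod_topology ?I ?L) (\<lambda>p. (fst p - 2 * md (snd p), r (snd p)))"
      proof (rule continuous_map_pairedI)
        show "continuous_map ?P1 ?I (\<lambda>p. fst p - 2 * md (snd p))"
          by (intro continuous_map_into_subtopology continuous_intros
              continuous_map_from_subtopology[OF cfst] continuous_map_from_subtopology[OF csnd[OF cmd]])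
            (use P1 in force)
        show "continuous_map ?P1 ?L (\<lambda>p. r (snd p))"
        proof (rule continuous_map_into_geometric_realization)
          show "continuous_map ?P1 euclideanreal (\<lambda>p. r (snd p) v)" for v
            unfolding r_def
            by (intro continuous_intros continuous_map_from_subtopology[OF csnd[OF cmd]]
                continuous_map_from_subtopology[OF csnd[OF cD]]
                continuous_map_from_subtopology[OF csnd[OF continuous_map_geometric_realization_coord]])
              (use P1 in fastforce)
          show "r (snd p) \<in> topspace ?L" if "p \<in> topspace ?P1" for p
            using P1[OF that] by (intro rL) auto
        qed
      qed
      from continuous_map_compose[OF this ch]
      have "continuous_map ?P1 ?L (\<lambda>p. h (fst p - 2 * md (snd p), r (snd p)))" by (simp add: o_def)
      then show "continuous_map ?P1 ?G (\<lambda>p. h (fst p - 2 * md (snd p), r (snd p)))"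
        unfolding geometric_realization_subcomplex[OF Diff_subset]
        by (rule continuous_map_into_fulltopology)
      let ?P2 = "subtopology ?P {p \<in> topspace ?P. fst p / 2 \<le> md (snd p)}"
      show "continuous_map ?P2 ?G E"
      proof (rule continuous_map_into_geometric_realization)
        show "E p \<in> topspace ?G" if "p \<in> topspace ?P2" for p
          using that EG[of "snd p" "fst p"] by auto
        have "continuous_map ?P euclideanreal (\<lambda>p. (snd p v - D (snd p) v + D' (fst p) (snd p) v) / (1 - fst p / 2))" for v
          unfolding D'_def
          by (intro continuous_intros csnd[OF cD] csnd[OF continuous_map_geometric_realization_coord]
              cfst finM csnd[OF cmt]) auto
        then show "continuous_map ?P2 euclideanreal (\<lambda>p. E p v)" for v
          by (intro continuous_map_from_subtopology) (simp add: E_def case_prod_unfold)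
      qed
    qed
    moreover have "H = (\<lambda>p. if md (snd p) \<le> fst p / 2 then h (fst p - 2 * md (snd p), r (snd p)) else E p)"
      by (rule ext) (simp add: H_def split: prod.split)
    ultimately show ?thesis by simp
  qed
  have "H (0, x) = x" if x: "x \<in> topspace ?G" for x
  proof (cases "md x \<le> 0")
    case True
    have md0: "md x = 0" using True m0 x by (simp add: md_def sum_nonneg order_antisym)
    then have "m \<tau> x = 0" if "\<tau> \<in> M" for \<tau>
      using that m0[OF _ x] finM unfolding md_def by (subst (asm) sum_nonneg_eq_0_iff) auto
    then have "vertex_support x \<notin> M" using mpos x by fastforce
    then show ?thesis using onL(3)[of x] L x by (simp add: H_def md0 h0)
  next
    case False
    have "D' 0 x v = D x v" for v
      unfolding D'_def D_def using m0 x by (intro sum.cong) auto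
    then show ?thesis using False by (simp add: H_def E_def)
  qed
  moreover have "H (t, x) = h (t, x)" if "0 \<le> t" "x \<in> topspace ?L" for t x
    using onL[OF that(2)] that(1) by (simp add: H_def)
  ultimately show thesis using that[of H a] cH hL h1 by simp
qed

section \<open>Wedges of spheres as quotients\<close>

lemma continuous_map_wedge_map:
  assumes "i \<in> I"
  shows "continuous_map (X i) (wedge_topology I X b) (wedge_map b i)"
  unfolding continuous_map_def
proof (intro conjI allI impI)
  have "openin (wedge_topology I X b) (insert None (\<Union>i\<in>I. wedge_map b i ` topspace (X i)))"
    unfolding openin_wedge_topology
  proof (intro conjI ballI)
    fix j assume "j \<in> I"
    then have "{x \<in> topspace (X j). wedge_map b j x \<in> insert None (\<Union>i\<in>I. wedge_map b i ` topspace (X i))} = topspace (X j)"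
      by blast
    then show "openin (X j) {x \<in> topspace (X j). wedge_map b j x \<in> insert None (\<Union>i\<in>I. wedge_map b i ` topspace (X i))}"
      by simp
  qed simp
  then show "wedge_map b i \<in> topspace (X i) \<rightarrow> topspace (wedge_topology I X b)"
    using openin_subset assms by fastforce
  show "openin (X i) {x \<in> topspace (X i). wedge_map b i x \<in> U}"
    if "openin (wedge_topology I X b) U" for U
    using that assms by (simp add: openin_wedge_topology)
qed

text \<open>Dividing by the contractible part leaves one \<open>p\<close>-sphere for each simplex in
  \<open>M\<close>: these simplices all have the largest size, so any two of them meet only inside
  \<open>K - M\<close>.\<close>

lemma geometric_realization_homotopy_equivalent_wedge:
  fixes K :: "'v set set"
  assumes K: "simplicial_complex K" and M: "M \<subseteq> K" "\<And>\<tau>. \<tau> \<in> M \<Longrightarrow> card \<tau> = Suc p"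
    and dim: "\<And>\<tau>. \<tau> \<in> K \<Longrightarrow> card \<tau> \<le> Suc p"
    and con: "contractible_space (geometric_realization (K - M))"
      "topspace (geometric_realization (K - M)) \<noteq> {}"
  shows "geometric_realization K homotopy_equivalent_space wedge_of_spheres {..<card M} (\<lambda>_. p)"
proof -
  let ?G = "geometric_realization K" and ?L = "geometric_realization (K - M)"
  let ?I = "{..<card M}" let ?W = "wedge_of_spheres ?I (\<lambda>_. p)"
  let ?S = "\<lambda>\<tau>. geometric_realization (Pow \<tau>)"
  let ?w = "wedge_map (\<lambda>_. nsphere_base) :: nat \<Rightarrow> (nat \<Rightarrow> real) \<Rightarrow> _"
  have finM: "finite M" using simplicial_complexD(1)[OF K] M(1) finite_subset by blast
  have Mfin: "finite \<tau>" if "\<tau> \<in> M" for \<tau>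
    using that M simplicial_complexD(2)[OF K] by blast
  obtain \<beta> where \<beta>: "bij_betw \<beta> ?I M"
    using finM by (metis card_lessThan finite_lessThan finite_same_card_bij)
  then have \<beta>M: "\<beta> i \<in> M" if "i \<in> ?I" for i using that by (auto simp: bij_betw_def)
  define sph where "sph \<tau> f \<longleftrightarrow> continuous_map (?S \<tau>) (nsphere p) f \<and>
      (\<forall>x \<in> topspace (?S \<tau>). f x = nsphere_base \<longleftrightarrow> vertex_support x \<noteq> \<tau>) \<and>
      inj_on f {x \<in> topspace (?S \<tau>). vertex_support x = \<tau>} \<and>
      topspace (nsphere p) - {nsphere_base} \<subseteq> f ` topspace (?S \<tau>)" for \<tau> :: "'v set" and f
  have "\<exists>f. sph \<tau> f" if "\<tau> \<in> M" for \<tau>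
    by (rule simplex_onto_nsphere[OF Mfin[OF that] M(2)[OF that]]) (auto simp: sph_def)
  then obtain q where "sph \<tau> (q \<tau>)" if "\<tau> \<in> M" for \<tau> by metis
  then have q: "\<And>\<tau>. \<tau> \<in> M \<Longrightarrow> continuous_map (?S \<tau>) (nsphere p) (q \<tau>)"
    "\<And>\<tau> x. \<tau> \<in> M \<Longrightarrow> x \<in> topspace (?S \<tau>) \<Longrightarrow> q \<tau> x = nsphere_base \<longleftrightarrow> vertex_support x \<noteq> \<tau>"
    "\<And>\<tau>. \<tau> \<in> M \<Longrightarrow> inj_on (q \<tau>) {x \<in> topspace (?S \<tau>). vertex_support x = \<tau>}"
    "\<And>\<tau>. \<tau> \<in> M \<Longrightarrow> topspace (nsphere p) - {nsphere_base} \<subseteq> q \<tau> ` topspace (?S \<tau>)"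
    by (simp_all add: sph_def)
  have base: "nsphere_base \<in> topspace (nsphere n)" for n
    using in_topspace_nsphere[of n] by (simp add: nsphere_base_def)
  have W: "topspace ?W = insert None (Some ` (SIGMA i:?I. topspace (nsphere p) - {nsphere_base}))"
    unfolding wedge_of_spheres_def by (rule topspace_wedge_topology) (rule base)
  have G: "x \<in> topspace ?G \<longleftrightarrow> (\<forall>v. 0 \<le> x v) \<and> vertex_support x \<in> K \<and> sum x (vertex_support x) = 1" for x
    by (auto simp: geometric_realization_def)
  have L: "x \<in> topspace ?L \<longleftrightarrow> x \<in> topspace ?G \<and> vertex_support x \<notin> M" for x
    by (auto simp: geometric_realization_def)
  have PowK: "Pow \<tau> \<subseteq> K" if "\<tau> \<in> M" for \<tau> using that M simplicial_complexD(3)[OF K] by blast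
  have S: "x \<in> topspace (?S \<tau>) \<longleftrightarrow> x \<in> topspace ?G \<and> vertex_support x \<subseteq> \<tau>" if "\<tau> \<in> M" for \<tau> x
    using PowK[OF that] by (auto simp: geometric_realization_def)
  have subM: "vertex_support x = \<tau>" if "x \<in> topspace ?G" "\<tau> \<in> M" "vertex_support x \<in> M" "vertex_support x \<subseteq> \<tau>" for x \<tau>
    using card_subset_eq[OF Mfin[OF that(2)] that(4)] M(2)[OF that(2)] M(2)[OF that(3)] by simp
  define Q where "Q x = (if vertex_support x \<in> M then
      Some (inv_into ?I \<beta> (vertex_support x), q (vertex_support x) x) else None)" for x
  have QS: "Q x = ?w i (q (\<beta> i) x)" if i: "i \<in> ?I" and x: "x \<in> topspace (?S (\<beta> i))" for i x
  proof (cases "vertex_support x = \<beta> i")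
    case True
    then show ?thesis
      using q(2)[OF \<beta>M[OF i] x] \<beta> i \<beta>M[OF i] by (simp add: Q_def wedge_map_def bij_betw_def)
  next
    case False
    then have "vertex_support x \<notin> M" using subM \<beta>M[OF i] x S by blast
    then show ?thesis using False q(2)[OF \<beta>M[OF i] x] by (simp add: Q_def wedge_map_def)
  qed
  have QL: "Q x = None" if "x \<in> topspace ?L" for x using that by (simp add: Q_def L)
  have cover: "x \<in> topspace ?L \<or> (\<exists>i\<in>?I. x \<in> topspace (?S (\<beta> i)) \<and> vertex_support x = \<beta> i)"
    if "x \<in> topspace ?G" for x
  proof (cases "vertex_support x \<in> M")
    case True
    then obtain i where "i \<in> ?I" "vertex_support x = \<beta> i" using \<beta> by (auto simp: bij_betw_def)
    then show ?thesis using that S[OF \<beta>M] by auto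
  qed (use that L in blast)
  \<comment> \<open>The realization of \<open>K - M\<close> and the closed simplices of
    \<open>M\<close> form a finite closed cover. On the first \<open>Q\<close> is constant, on each
    of the others it is a sphere map followed by the inclusion into the wedge.\<close>
  have Qc: "continuous_map ?G ?W Q"
  proof (rule pasting_lemma_closed[where I = "insert None (Some ` ?I)"
        and T = "\<lambda>j. case j of None \<Rightarrow> topspace ?L | Some i \<Rightarrow> topspace (?S (\<beta> i))" and f = "\<lambda>_. Q"])
    fix j assume j: "j \<in> insert None (Some ` ?I)"
    have cl: "closedin ?G {x \<in> topspace ?G. vertex_support x \<subseteq> \<tau>}" for \<tau>
    proof -
      have "closedin ?G {x \<in> topspace ?G. x v \<in> {0}}" for v
        by (rule closedin_continuous_map_preimage[OF continuous_map_geometric_realization_coord]) simp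
      then have "closedin ?G (topspace ?G \<inter> (\<Inter>v\<in>-\<tau>. {x \<in> topspace ?G. x v \<in> {0}}))"
        by (cases "- \<tau> = {}") (auto intro!: closedin_Int closedin_Inter)
      also have "topspace ?G \<inter> (\<Inter>v\<in>-\<tau>. {x \<in> topspace ?G. x v \<in> {0}}) = {x \<in> topspace ?G. vertex_support x \<subseteq> \<tau>}"
        by (auto simp: vertex_support_def)
      finally show ?thesis .
    qed
    show "closedin ?G (case j of None \<Rightarrow> topspace ?L | Some i \<Rightarrow> topspace (?S (\<beta> i)))"
    proof (cases j)
      case None
      have "topspace ?L = (\<Union>s\<in>K - M. {x \<in> topspace ?G. vertex_support x \<subseteq> s})"
      proof (intro equalityI subsetI)
        fix x assume "x \<in> (\<Union>s\<in>K - M. {x \<in> topspace ?G. vertex_support x \<subseteq> s})"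
        then obtain s where s: "s \<in> K" "s \<notin> M" "x \<in> topspace ?G" "vertex_support x \<subseteq> s" by blast
        have "vertex_support x \<notin> M"
        proof
          assume "vertex_support x \<in> M"
          then have "vertex_support x = s"
            using card_seteq[of s "vertex_support x"] s M(2) dim[OF s(1)] simplicial_complexD(2)[OF K s(1)] by simp
          then show False using s \<open>vertex_support x \<in> M\<close> by simp
        qed
        then show "x \<in> topspace ?L" using s L by blast
      qed (auto simp: L G)
      then show ?thesis using None simplicial_complexD(1)[OF K] cl by (auto intro!: closedin_Union)
    next
      case (Some i)
      then have "topspace (?S (\<beta> i)) = {x \<in> topspace ?G. vertex_support x \<subseteq> \<beta> i}"
        using S[OF \<beta>M] j by auto
      then show ?thesis using Some cl by simp
    qed
    show "continuous_map (subtopology ?G (case j of None \<Rightarrow> topspace ?L | Some i \<Rightarrow> topspace (?S (\<beta> i)))) ?W Q"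
    proof (cases j)
      case None
      have "continuous_map (subtopology ?G (topspace ?L)) ?W (\<lambda>_. None)"
        by (simp add: W)
      then have "continuous_map (subtopology ?G (topspace ?L)) ?W Q"
        by (rule continuous_map_eq) (use QL in auto)
      then show ?thesis using None by simp
    next
      case (Some i)
      then have i: "i \<in> ?I" using j by auto
      have "continuous_map (?S (\<beta> i)) ?W (?w i \<circ> q (\<beta> i))"
        unfolding wedge_of_spheres_def
        by (rule continuous_map_compose[OF q(1)[OF \<beta>M[OF i]]
              continuous_map_wedge_map[OF i, of "\<lambda>_. nsphere p"]])
      then have "continuous_map (?S (\<beta> i)) ?W Q"
        by (rule continuous_map_eq) (use QS[OF i] in simp)
      moreover have "subtopology ?G (topspace (?S (\<beta> i))) = ?S (\<beta> i)"
        unfolding geometric_realization_subcomplex[OF PowK[OF \<beta>M[OF i]]]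
        by (simp only: topspace_subtopology subtopology_restrict)
      ultimately show ?thesis using Some by simp
    qed
  next
    fix x assume "x \<in> topspace ?G"
    then show "\<exists>j. j \<in> insert None (Some ` ?I) \<and>
        x \<in> (case j of None \<Rightarrow> topspace ?L | Some i \<Rightarrow> topspace (?S (\<beta> i))) \<and> Q x = Q x"
      using cover[of x] by (auto split: option.splits)
  qed auto
  have Qs: "Q ` topspace ?G = topspace ?W"
  proof
    show "Q ` topspace ?G \<subseteq> topspace ?W" using Qc continuous_map_image_subset_topspace by blast
    show "topspace ?W \<subseteq> Q ` topspace ?G"
    proof
      fix y assume "y \<in> topspace ?W"
      then consider "y = None" | i s where "y = Some (i, s)" "i \<in> ?I" "s \<in> topspace (nsphere p) - {nsphere_base}"
        by (auto simp: W)
      then show "y \<in> Q ` topspace ?G"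
      proof cases
        \<comment> \<open>Here the nonemptiness of the remainder is needed: for \<open>p = 0\<close>
          no simplex of \<open>M\<close> reaches the base point.\<close>
        case 1
        then show ?thesis using con(2) QL L by (metis all_not_in_conv image_iff)
      next
        case (2 i s)
        then obtain x where x: "x \<in> topspace (?S (\<beta> i))" "s = q (\<beta> i) x" using q(4)[OF \<beta>M] by blast
        then have "Q x = y" using QS[OF 2(2) x(1)] 2 by (simp add: wedge_map_def)
        then show ?thesis using x(1) S[OF \<beta>M[OF 2(2)]] by blast
      qed
    qed
  qed
  have Qq: "quotient_map ?G ?W Q"
    unfolding quotient_map_def
  proof (intro conjI allI impI iffI Qs)
    fix U assume U: "U \<subseteq> topspace ?W" and op: "openin ?G {x \<in> topspace ?G. Q x \<in> U}"
    have "openin (nsphere p) {s \<in> topspace (nsphere p). ?w i s \<in> U}" if i: "i \<in> ?I" for i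
    proof -
      let ?C = "{x \<in> topspace (?S (\<beta> i)). Q x \<notin> U}"
      have "continuous_map (?S (\<beta> i)) ?G id"
        unfolding geometric_realization_subcomplex[OF PowK[OF \<beta>M[OF i]]]
        by (rule continuous_map_from_subtopology) simp
      from openin_continuous_map_preimage[OF this op]
      have "openin (?S (\<beta> i)) {x \<in> topspace (?S (\<beta> i)). x \<in> topspace ?G \<and> Q x \<in> U}" by simp
      moreover have "{x \<in> topspace (?S (\<beta> i)). x \<in> topspace ?G \<and> Q x \<in> U} = topspace (?S (\<beta> i)) - ?C"
        using S[OF \<beta>M[OF i]] by blast
      ultimately have "closedin (?S (\<beta> i)) ?C" by (auto simp: closedin_def)
      moreover have "closed_map (?S (\<beta> i)) (nsphere p) (q (\<beta> i))"
        by (intro continuous_imp_closed_map q(1) \<beta>M[OF i] compact_space_simplex Mfin Hausdorff_space_nsphere)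
      ultimately have c1: "closedin (nsphere p) (q (\<beta> i) ` ?C)" by (simp add: closed_map_def)
      \<comment> \<open>For \<open>p = 0\<close> a simplex has no boundary point and its sphere map
        misses the base point, so the base point is treated separately.\<close>
      have c2: "closedin (nsphere p) (if None \<in> U then {} else {nsphere_base})"
        using base closedin_Hausdorff_singleton[OF Hausdorff_space_nsphere] by simp
      have "topspace (nsphere p) - {s \<in> topspace (nsphere p). ?w i s \<in> U} =
          q (\<beta> i) ` ?C \<union> (if None \<in> U then {} else {nsphere_base})" (is "?A = ?B")
      proof (intro equalityI subsetI)
        fix s assume s: "s \<in> ?A"
        show "s \<in> ?B"
        proof (cases "s = nsphere_base")
          case True
          then show ?thesis using s by (auto simp: wedge_map_def)
        next
          case False
          then obtain x where x: "x \<in> topspace (?S (\<beta> i))" "s = q (\<beta> i) x" using q(4)[OF \<beta>M[OF i]] s by blast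
          then show ?thesis using s QS[OF i x(1)] by auto
        qed
      next
        fix s assume "s \<in> ?B"
        then consider x where "x \<in> ?C" "s = q (\<beta> i) x" | "None \<notin> U" "s = nsphere_base"
          by (auto split: if_splits)
        then show "s \<in> ?A"
        proof cases
          case (1 x)
          then show ?thesis
            using QS[OF i, of x] continuous_map_image_subset_topspace[OF q(1)[OF \<beta>M[OF i]]] by auto
        next
          case 2
          then show ?thesis using base by (simp add: wedge_map_def)
        qed
      qed
      then have "closedin (nsphere p) (topspace (nsphere p) - {s \<in> topspace (nsphere p). ?w i s \<in> U})"
        using closedin_Un[OF c1 c2] by simp
      then show ?thesis by (simp add: openin_closedin_eq)
    qed
    moreover have "U \<subseteq> insert None (\<Union>i\<in>?I. ?w i ` topspace (nsphere p))"
    proof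
      fix y assume "y \<in> U"
      then have "y \<in> topspace ?W" using U by blast
      then show "y \<in> insert None (\<Union>i\<in>?I. ?w i ` topspace (nsphere p))"
      proof (cases y)
        case (Some z)
        then obtain i s where "y = Some (i, s)" "i \<in> ?I" "s \<in> topspace (nsphere p)" "s \<noteq> nsphere_base"
          using \<open>y \<in> topspace ?W\<close> by (auto simp: W)
        then have "y = ?w i s" by (simp add: wedge_map_def)
        then show ?thesis using \<open>i \<in> ?I\<close> \<open>s \<in> topspace (nsphere p)\<close> by blast
      qed simp
    qed
    ultimately show "openin ?W U" unfolding wedge_of_spheres_def openin_wedge_topology by blast
  next
    fix U assume "openin ?W U"
    then show "openin ?G {x \<in> topspace ?G. Q x \<in> U}"
      using Qc by (simp add: continuous_map_def)
  qed
  obtain H a where H: "continuous_map (prod_topology (top_of_set {0..1::real}) ?G) ?G H"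
    "\<And>x. x \<in> topspace ?G \<Longrightarrow> H (0, x) = x"
    "\<And>t x. 0 \<le> t \<Longrightarrow> t \<le> 1 \<Longrightarrow> x \<in> topspace ?L \<Longrightarrow> H (t, x) \<in> topspace ?L"
    "\<And>x. x \<in> topspace ?L \<Longrightarrow> H (1, x) = a"
    using extend_contraction[OF K M dim con] by metis
  show ?thesis
  proof (rule homotopy_equivalent_quotient[OF Qq _ QL H(1,2,3,4)])
    fix x y assume x: "x \<in> topspace ?G" and y: "y \<in> topspace ?G" and eq: "Q x = Q y"
    show "x = y \<or> x \<in> topspace ?L \<and> y \<in> topspace ?L"
    proof (cases "vertex_support x \<in> M")
      case False
      then have "vertex_support y \<notin> M" using eq by (auto simp: Q_def split: if_splits)
      then show ?thesis using False x y L by blast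
    next
      case True
      then have yM: "vertex_support y \<in> M" using eq by (auto simp: Q_def split: if_splits)
      then have "vertex_support x = vertex_support y"
        using eq True \<beta> by (auto simp: Q_def bij_betw_def dest: inv_into_injective)
      moreover have "q (vertex_support x) x = q (vertex_support y) y" using eq True yM by (simp add: Q_def)
      ultimately show ?thesis
        using q(3)[OF True] x y S[OF True] by (auto simp: inj_on_def)
    qed
  qed
qed

text \<open>Critical sets of the largest size \<open>k\<close> can be deleted without destroying the
  complex. What remains is collapsible, and the deleted simplices become spheres of dimension
  \<open>k - 1\<close>.\<close>

theorem wedge_of_spheres_if_dismantles:
  assumes K: "simplicial_complex K" "K \<noteq> {}"
    and dim: "\<And>\<tau>. \<tau> \<in> K \<Longrightarrow> card \<tau> \<le> k"
    and dis: "dismantles (\<lambda>\<tau>. card \<tau> = k) K"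
  shows "homotopy_type_of_wedge_of_spheres (geometric_realization K)"
proof (cases k)
  \<comment> \<open>The empty set is the only simplex, and the space is the sphere of dimension
    -1.\<close>
  case 0
  have "x \<notin> topspace (geometric_realization K)" for x
  proof
    assume x: "x \<in> topspace (geometric_realization K)"
    then have s: "vertex_support x \<in> K" by (simp add: geometric_realization_iff[OF K(1)])
    then have "vertex_support x = {}" using dim[OF s] 0 simplicial_complexD(2)[OF K(1) s] by simp
    then show False using geometric_realization_nonempty_support[OF x] by simp
  qed
  then have "topspace (geometric_realization K) = {}" by blast
  then show ?thesis by (simp add: homotopy_type_of_wedge_of_spheres_def)
next
  case (Suc p)
  obtain M where M: "M \<subseteq> K" "\<And>m. m \<in> M \<Longrightarrow> card m = k" "dismantles (\<lambda>_. False) (K - M)"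
    using dismantles_split_critical[OF dis] by metis
  have "{} \<in> K" using K simplicial_complexD(3)[OF K(1)] by blast
  \<comment> \<open>Since \<open>k > 0\<close>, the empty simplex survives the deletion.\<close>
  moreover have "{} \<notin> M" using M(2)[of "{}"] Suc by auto
  ultimately have ne: "K - M \<noteq> {}" by blast
  have "simplicial_complex (K - M)"
    unfolding simplicial_complex_def
  proof (intro conjI ballI allI impI)
    fix s t assume s: "s \<in> K - M" and t: "t \<subseteq> s"
    then have "t \<in> K" using simplicial_complexD(3)[OF K(1)] by blast
    moreover have "t \<notin> M"
    proof
      assume "t \<in> M"
      then have "t = s" using card_seteq[of s t] t s dim[of s] M(2)[of t] simplicial_complexD(2)[OF K(1)] by simp
      then show False using s \<open>t \<in> M\<close> by blast
    qed
    ultimately show "t \<in> K - M" by blast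
  qed (use simplicial_complexD[OF K(1)] in auto)
  from contractible_realization_dismantles[OF M(3) this ne]
  have "geometric_realization K homotopy_equivalent_space wedge_of_spheres {..<card M} (\<lambda>_. p)"
    using geometric_realization_homotopy_equivalent_wedge[OF K(1) M(1), of p] M(2) dim Suc by simp
  then show ?thesis unfolding homotopy_type_of_wedge_of_spheres_def by blast
qed

section \<open>Chains of partitions\<close>

text \<open>Keeping some elements fixed as members of every chain avoids special cases for posets
  whose proper part is empty.\<close>

definition chains_through :: "'p set \<Rightarrow> ('p \<Rightarrow> 'p \<Rightarrow> bool) \<Rightarrow> 'p set \<Rightarrow> 'p set set" where
  "chains_through P le A = {C \<in> order_complex P le. A \<subseteq> C}"

lemma chains_throughI:
  assumes "C \<subseteq> P" "finite C" "A \<subseteq> C" "\<And>x y. x \<in> C \<Longrightarrow> y \<in> C \<Longrightarrow> le x y \<or> le y x"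
  shows "C \<in> chains_through P le A"
  using assms by (auto simp: chains_through_def order_complex_def chain_def)

lemma chains_throughD:
  assumes "C \<in> chains_through P le A"
  shows "C \<subseteq> P" "finite C" "A \<subseteq> C" "\<And>x y. x \<in> C \<Longrightarrow> y \<in> C \<Longrightarrow> le x y \<or> le y x"
  using assms by (auto simp: chains_through_def order_complex_def chain_def)

lemma finite_chains_through: "finite P \<Longrightarrow> finite (chains_through P le A)"
  by (rule finite_subset[of _ "Pow P"]) (auto dest: chains_throughD)

lemma chains_through_remove:
  assumes "C \<in> chains_through P le A" "v \<notin> A"
  shows "C - {v} \<in> chains_through P le A"
  using chains_throughD[OF assms(1)] assms(2) by (intro chains_throughI) auto

lemma chains_through_insert:
  assumes "C \<in> chains_through P le A" "v \<in> P" "le v v" "\<And>x. x \<in> C \<Longrightarrow> le x v \<or> le v x"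
  shows "insert v C \<in> chains_through P le A"
proof (rule chains_throughI)
  note C = chains_throughD[OF assms(1)]
  show "insert v C \<subseteq> P" "finite (insert v C)" "A \<subseteq> insert v C" using C(1-3) assms(2) by auto
  show "le x y \<or> le y x" if "x \<in> insert v C" "y \<in> insert v C" for x y
    using that C(4) assms(3,4) by blast
qed

lemma chains_through_image:
  assumes "bij_betw g P P'" "\<And>x y. x \<in> P \<Longrightarrow> y \<in> P \<Longrightarrow> le' (g x) (g y) \<longleftrightarrow> le x y" "A \<subseteq> P"
  shows "chains_through P' le' (g ` A) = (`) g ` chains_through P le A"
proof (intro equalityI subsetI)
  fix C assume "C \<in> (`) g ` chains_through P le A"
  then obtain D where D: "D \<in> chains_through P le A" "C = g ` D" by blast
  note d = chains_throughD[OF D(1)]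
  show "C \<in> chains_through P' le' (g ` A)"
    unfolding D(2)
  proof (rule chains_throughI)
    show "g ` D \<subseteq> P'" using d(1) assms(1) by (auto simp: bij_betw_def)
    show "le' x y \<or> le' y x" if xy: "x \<in> g ` D" "y \<in> g ` D" for x y
    proof -
      obtain a b where "a \<in> D" "b \<in> D" "x = g a" "y = g b" using xy by blast
      then show ?thesis using d(1,4) assms(2) by blast
    qed
  qed (use d in auto)
next
  fix C assume C: "C \<in> chains_through P' le' (g ` A)"
  note c = chains_throughD[OF C]
  define D where "D = inv_into P g ` C"
  have inj: "inj_on g P" and im: "g ` P = P'" using assms(1) by (auto simp: bij_betw_def)
  have gD: "g ` D = C" unfolding D_def image_image
    using c(1) im by (auto simp: f_inv_into_f subset_iff intro!: image_eqI)
  have DP: "D \<subseteq> P" using c(1) im by (auto simp: D_def intro: inv_into_into)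
  have "D \<in> chains_through P le A"
  proof (rule chains_throughI)
    show "A \<subseteq> D"
      using c(3) gD DP assms(3) inj by (metis inj_on_image_subset_iff)
    show "le x y \<or> le y x" if xy: "x \<in> D" "y \<in> D" for x y
      using c(4)[of "g x" "g y"] assms(2) DP gD xy by blast
  qed (use c DP in \<open>auto simp: D_def\<close>)
  then show "C \<in> (`) g ` chains_through P le A" using gD by blast
qed

text \<open>The relation is arbitrary, so that the reversed order yields a smallest member.\<close>

lemma chain_has_max:
  assumes "finite D" "D \<noteq> {}" "\<forall>x\<in>D. \<forall>y\<in>D. le x y \<or> le y x" "transp_on D le"
  shows "\<exists>m\<in>D. \<forall>x\<in>D. le x m"
  using assms
proof (induction D rule: finite_ne_induct)
  case (insert a D)
  have tr: "transp_on D le" using insert.prems(2) by (rule transp_on_subset) blast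
  have "\<exists>m\<in>D. \<forall>x\<in>D. le x m"
    using insert.prems(1) tr by (intro insert.IH) simp_all
  then obtain m where m: "m \<in> D" "\<forall>x\<in>D. le x m" by blast
  have aa: "le a a" and am: "le a m \<or> le m a" using insert.prems(1) m(1) by simp_all
  show ?case
  proof (cases "le a m")
    case True
    then show ?thesis using m by (intro bexI[of _ m]) auto
  next
    case False
    then have "le m a" using am by simp
    then have "le x a" if "x \<in> D" for x
      using transp_onD[OF insert.prems(2), of x m a] m that by simp
    then show ?thesis using aa by (intro bexI[of _ a]) auto
  qed
qed simp

section \<open>Refinement of partitions and joins with an atom\<close>

definition singletons :: "'a set \<Rightarrow> 'a set set" where
  "singletons X = (\<lambda>x. {x}) ` X"

lemma partition_on_block:
  assumes "partition_on X P" "x \<in> X"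
  obtains S where "S \<in> P" "x \<in> S"
  using assms by (auto simp: partition_on_def)

lemma partition_on_block_unique:
  assumes "partition_on X P" "S \<in> P" "T \<in> P" "x \<in> S" "x \<in> T"
  shows "S = T"
  using assms unfolding partition_on_def disjoint_def by blast

lemma refines_transp: "transp_on D (refines X)"
  using refines_trans by (rule transp_onI)

lemma refinesD:
  assumes "refines X P Q"
  shows "partition_on X P" "partition_on X Q" "S \<in> P \<Longrightarrow> \<exists>T\<in>Q. S \<subseteq> T"
  using assms by (auto simp: refines_def)

lemma refines_block_subset:
  assumes "refines X P Q" "S \<in> P" "T \<in> Q" "x \<in> S" "x \<in> T"
  shows "S \<subseteq> T"
proof -
  obtain T' where "T' \<in> Q" "S \<subseteq> T'" using refinesD(3)[OF assms(1,2)] by blast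
  then show ?thesis using partition_on_block_unique[OF refinesD(2)[OF assms(1)], of T T' x] assms by blast
qed

lemma singletons_refines:
  assumes "partition_on X P"
  shows "refines X (singletons X) P"
  unfolding refines_def singletons_def
  using assms partition_on_singletons[of X] partition_on_block[OF assms] by auto

lemma refines_singletons:
  assumes "refines X P (singletons X)"
  shows "P = singletons X"
  using refines_asym[OF assms singletons_refines[OF refinesD(1)[OF assms]]] .

text \<open>\<open>together i j P\<close>: the partition \<open>P\<close> lies above the atom whose only nontrivial block is \<open>{i, j}\<close>.\<close>

definition together :: "'a \<Rightarrow> 'a \<Rightarrow> 'a set set \<Rightarrow> bool" where
  "together i j P \<longleftrightarrow> (\<exists>S\<in>P. i \<in> S \<and> j \<in> S)"

definition block :: "'a set set \<Rightarrow> 'a \<Rightarrow> 'a set" where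
  "block P x = (THE S. S \<in> P \<and> x \<in> S)"

lemma block:
  assumes "partition_on X P" "x \<in> X"
  shows "block P x \<in> P" "x \<in> block P x"
proof -
  have "\<exists>!S. S \<in> P \<and> x \<in> S"
    using partition_on_block[OF assms] partition_on_block_unique[OF assms(1)] by (metis (no_types))
  from theI'[OF this] show "block P x \<in> P" "x \<in> block P x" by (auto simp: block_def)
qed

text \<open>The join of \<open>P\<close> with the atom of \<open>i\<close> and \<open>j\<close>; it
  is \<open>P\<close> itself if both already lie in one block.\<close>

definition merge :: "'a \<Rightarrow> 'a \<Rightarrow> 'a set set \<Rightarrow> 'a set set" where
  "merge i j P = insert (block P i \<union> block P j) (P - {block P i, block P j})"

context
  fixes X :: "'a set" and P :: "'a set set" and i j :: 'a
  assumes P: "partition_on X P" and i: "i \<in> X" and j: "j \<in> X"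
begin

lemma partition_on_merge: "partition_on X (merge i j P)"
proof (rule partition_onI)
  note b = block[OF P i] block[OF P j]
  show "\<Union>(merge i j P) = X"
    using partition_onD1[OF P] b by (auto simp: merge_def)
  show "{} \<notin> merge i j P"
    using partition_onD3[OF P] b by (auto simp: merge_def)
  fix p q assume pq: "p \<in> merge i j P" "q \<in> merge i j P" "p \<noteq> q"
  have dis: "S \<inter> T = {}" if "S \<in> P" "T \<in> P" "S \<noteq> T" for S T
    using partition_on_block_unique[OF P that(1,2)] that(3) by blast
  show "disjnt p q"
  proof -
    let ?U = "block P i \<union> block P j"
    have U: "?U \<inter> S = {}" if "S \<in> P - {block P i, block P j}" for S
      using dis[OF b(1), of S] dis[OF b(3), of S] that by auto
    consider "p = ?U" "q \<in> P - {block P i, block P j}" | "q = ?U" "p \<in> P - {block P i, block P j}"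
      | "p \<in> P" "q \<in> P"
      using pq by (auto simp: merge_def)
    then show ?thesis using U dis pq(3) by cases (auto simp: disjnt_def)
  qed
qed

lemma refines_merge: "refines X P (merge i j P)"
  using P partition_on_merge by (auto simp: refines_def merge_def)

lemma together_merge: "together i j (merge i j P)"
  using block[OF P i] block[OF P j] by (auto simp: together_def merge_def)

lemma merge_refines:
  assumes "refines X P Q" "together i j Q"
  shows "refines X (merge i j P) Q"
  unfolding refines_def
proof (intro conjI ballI)
  obtain S where S: "S \<in> Q" "i \<in> S" "j \<in> S" using assms(2) by (auto simp: together_def)
  have "block P i \<subseteq> S" "block P j \<subseteq> S"
    using refines_block_subset[OF assms(1) _ S(1)] block[OF P i] block[OF P j] S by blast+
  then show "\<exists>T\<in>Q. R \<subseteq> T" if "R \<in> merge i j P" for R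
    using that refinesD(3)[OF assms(1)] S(1) by (auto simp: merge_def)
qed (use partition_on_merge refinesD(2)[OF assms(1)] in auto)

text \<open>Joining with an atom not below \<open>P\<close> is a covering step, so the number of
  blocks serves as a corank.\<close>

lemma card_merge:
  assumes "finite X" "\<not> together i j P"
  shows "card P = Suc (card (merge i j P))"
proof -
  note b = block[OF P i] block[OF P j]
  have finP: "finite P" using finite_elements[OF assms(1) P] .
  have ne: "block P i \<noteq> block P j" using assms(2) b by (auto simp: together_def)
  have "block P i \<union> block P j \<notin> P - {block P i, block P j}"
    using partition_on_block_unique[OF P b(1) _ b(2), of "block P i \<union> block P j"] b by blast
  then have "card (merge i j P) = Suc (card P - 2)"
    using finP b ne by (simp add: merge_def card_Diff_subset card_insert_if)
  moreover have "card P \<ge> 2"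
    using card_mono[OF finP, of "{block P i, block P j}"] b ne by simp
  ultimately show ?thesis by simp
qed

end

lemma card_refines:
  assumes "finite X" "refines X P Q"
  shows "card Q \<le> card P"
proof -
  have "\<exists>S\<in>P. S \<subseteq> T" if "T \<in> Q" for T
  proof -
    have "T \<noteq> {}" "T \<subseteq> X" using that refinesD(2)[OF assms(2)] by (auto simp: partition_on_def)
    then obtain x where x: "x \<in> T" "x \<in> X" by blast
    obtain S where "S \<in> P" "x \<in> S" using partition_on_block[OF refinesD(1)[OF assms(2)] x(2)] .
    then show ?thesis using refines_block_subset[OF assms(2) _ that _ x(1)] by blast
  qed
  then obtain f where f: "\<And>T. T \<in> Q \<Longrightarrow> f T \<in> P \<and> f T \<subseteq> T" by metis
  have "inj_on f Q"
  proof (rule inj_onI)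
    fix S T assume ST: "S \<in> Q" "T \<in> Q" "f S = f T"
    have "f S \<noteq> {}" using f ST refinesD(1)[OF assms(2)] by (metis partition_onD3)
    then obtain x where "x \<in> f S" by blast
    then show "S = T" using partition_on_block_unique[OF refinesD(2)[OF assms(2)] ST(1,2), of x] f ST by blast
  qed
  then show ?thesis
    using f by (intro card_inj_on_le[of f]) (auto intro: finite_elements[OF assms(1) refinesD(1)[OF assms(2)]])
qed

text \<open>If \<open>Q\<close> were strictly coarser, a pair joined in \<open>Q\<close> but not in
  \<open>P\<close> could be merged in \<open>P\<close>; the result has one block fewer and still
  refines \<open>Q\<close>.\<close>

lemma refines_card_eq:
  assumes "finite X" "refines X P Q" "card P \<le> card Q"
  shows "P = Q"
proof (rule ccontr)
  assume "P \<noteq> Q"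
  have "\<exists>S\<in>Q. \<exists>i\<in>S. \<exists>j\<in>S. \<not> together i j P"
  proof (rule ccontr)
    assume no: "\<not> ?thesis"
    have "refines X Q P"
      unfolding refines_def
    proof (intro conjI ballI)
      fix S assume S: "S \<in> Q"
      then obtain x where x: "x \<in> S" "x \<in> X"
        using refinesD(2)[OF assms(2)] by (metis partition_onD1 partition_onD3 UnionI equals0I)
      obtain T where T: "T \<in> P" "x \<in> T" using partition_on_block[OF refinesD(1)[OF assms(2)] x(2)] .
      have "S \<subseteq> T"
      proof
        fix y assume "y \<in> S"
        then obtain T' where "T' \<in> P" "x \<in> T'" "y \<in> T'" using no S x(1) unfolding together_def by blast
        then show "y \<in> T" using partition_on_block_unique[OF refinesD(1)[OF assms(2)], of T T' x] T by blast
      qed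
      then show "\<exists>T\<in>P. S \<subseteq> T" using T by blast
    qed (use refinesD[OF assms(2)] in auto)
    then show False using refines_asym[OF assms(2)] \<open>P \<noteq> Q\<close> by blast
  qed
  then obtain S i j where S: "S \<in> Q" "i \<in> S" "j \<in> S" "\<not> together i j P" by blast
  have ij: "i \<in> X" "j \<in> X" using S partition_onD1[OF refinesD(2)[OF assms(2)]] by auto
  note P = refinesD(1)[OF assms(2)]
  have "refines X (merge i j P) Q"
    using S by (intro merge_refines[OF P ij assms(2)]) (auto simp: together_def)
  then have "card Q \<le> card (merge i j P)" by (rule card_refines[OF assms(1)])
  then show False using card_merge[OF P ij assms(1) S(4)] assms(3) by simp
qed

abbreviation partition_chains :: "'a set \<Rightarrow> 'a set set \<Rightarrow> 'a set set set set" where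
  "partition_chains X \<pi> \<equiv> chains_through {P. refines X P \<pi>} (refines X) {singletons X, \<pi>}"

text \<open>Let \<open>a\<close> be an atom below \<open>\<pi>\<close>. A chain contains at most one \<open>P\<close> not above \<open>a\<close> with
  \<open>P \<squnion> a = \<pi>\<close>; it is covered by \<open>\<pi>\<close>, so the rest of the chain lies below it. If there is none, then
  \<open>P \<squnion> a\<close> can be inserted and removed, where \<open>P\<close> is the largest member not above \<open>a\<close>.\<close>

lemma dismantles_partition_chains:
  assumes "finite X" "partition_on X \<pi>"
  shows "dismantles (\<lambda>C. card C = card X - card \<pi> + 1) (partition_chains X \<pi>)"
  using assms(2)
proof (induction "card X - card \<pi>" arbitrary: \<pi> rule: less_induct)
  case less
  let ?P = "{P. refines X P \<pi>}"
  let ?crit = "\<lambda>C :: 'a set set set. card C = card X - card \<pi> + 1"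
  note \<pi> = less.prems
  have finP: "finite ?P"
    by (rule finite_subset[OF _ finitely_many_partition_on[OF assms(1)]]) (auto simp: refines_def)
  have finC: "finite (partition_chains X \<pi>)" by (rule finite_chains_through[OF finP])
  have card_le: "card P \<le> card X" if "partition_on X P" for P
    using card_refines[OF assms(1) singletons_refines[OF that]]
    by (simp add: singletons_def card_image)
  show ?case
  proof (cases "\<pi> = singletons X")
    case True
    \<comment> \<open>The interval is a point, and its only chain is critical of size 1.\<close>
    have "C = {singletons X}" if "C \<in> partition_chains X \<pi>" for C
      using chains_throughD(1,3)[OF that] True by (auto dest: refines_singletons)
    moreover have "{singletons X} \<in> partition_chains X \<pi>"
      using True \<pi> by (intro chains_throughI) (auto intro: refines_refl)
    ultimately have "partition_chains X \<pi> = {{singletons X}}" by blast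
    moreover have "card X = card \<pi>" by (simp add: True singletons_def card_image)
    ultimately show ?thesis
      by (simp add: dismantles.critical[OF dismantles.empty])
  next
    case False
    have "\<exists>S\<in>\<pi>. \<exists>i\<in>S. \<exists>j\<in>S. i \<noteq> j"
    proof (rule ccontr)
      assume no: "\<not> ?thesis"
      have "refines X \<pi> (singletons X)"
        unfolding refines_def
      proof (intro conjI ballI \<pi>)
        fix S assume S: "S \<in> \<pi>"
        then obtain x where "x \<in> S" "x \<in> X" using \<pi> by (metis partition_onD1 partition_onD3 UnionI equals0I)
        then show "\<exists>T\<in>singletons X. S \<subseteq> T" using no S by (auto simp: singletons_def)
      qed (auto simp: singletons_def partition_on_singletons)
      then show False using refines_singletons False by blast
    qed
    then obtain S i j where S: "S \<in> \<pi>" "i \<in> S" "j \<in> S" "i \<noteq> j" by blast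
    then have ij: "i \<in> X" "j \<in> X" using partition_onD1[OF \<pi>] by auto
    have \<pi>ij: "together i j \<pi>" using S by (auto simp: together_def)
    have sij: "\<not> together i j (singletons X)" using S by (auto simp: together_def singletons_def)
    have mono: "together i j Q" if PQ: "refines X P Q" "together i j P" for P Q
    proof -
      obtain S where "S \<in> P" "i \<in> S" "j \<in> S" using PQ(2) by (auto simp: together_def)
      then show ?thesis using refinesD(3)[OF PQ(1), of S] by (auto simp: together_def)
    qed
    let ?N = "{P. \<not> together i j P}"
    let ?M = "{P. refines X P \<pi> \<and> \<not> together i j P \<and> merge i j P = \<pi>}"
    show ?thesis
    proof (rule dismantles_fibres[OF finC, where N = ?M])
      fix E
      let ?F = "{C \<in> partition_chains X \<pi>. C \<inter> ?M = E}"
      consider "?F = {}" | P where "P \<in> E" "?F \<noteq> {}" | "E = {}" by blast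
      then show "dismantles ?crit ?F"
      proof cases
        case 1
        show ?thesis unfolding 1 by (rule dismantles.empty)
      next
        case (2 P)
        then obtain C0 where C0: "C0 \<in> partition_chains X \<pi>" "C0 \<inter> ?M = E" by blast
        then have P: "refines X P \<pi>" "\<not> together i j P" "merge i j P = \<pi>" using 2(1) by blast+
        have Pp: "partition_on X P" using refinesD(1)[OF P(1)] .
        have cP: "card P = Suc (card \<pi>)" using card_merge[OF Pp ij assms(1) P(2)] P(3) by simp
        \<comment> \<open>A \<open>Q\<close> above the atom lies above the join, which is \<pi>. A
          \<open>Q\<close> not above it loses a block by the join and still refines \<pi>, so it has
          at least \<open>card P\<close> blocks.\<close>
        have above: "Q = P \<or> Q = \<pi>" if PQ: "refines X P Q" and Q: "refines X Q \<pi>" for Q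
        proof (cases "together i j Q")
          case True
          then have "refines X \<pi> Q" using merge_refines[OF Pp ij PQ] P(3) by simp
          then show ?thesis using Q refines_asym by blast
        next
          case False
          have Qp: "partition_on X Q" using refinesD(1)[OF Q] .
          have "refines X (merge i j Q) \<pi>" by (rule merge_refines[OF Qp ij Q \<pi>ij])
          then have "card \<pi> \<le> card (merge i j Q)" by (rule card_refines[OF assms(1)])
          then have "card P \<le> card Q" using card_merge[OF Qp ij assms(1) False] cP by simp
          then show ?thesis using refines_card_eq[OF assms(1) PQ] by simp
        qed
        have E: "E = {P}"
        proof -
          have "Q = P" if Q: "Q \<in> E" for Q
          proof -
            have Q': "refines X Q \<pi>" "\<not> together i j Q" "merge i j Q = \<pi>" using Q C0 by blast+
            have "card Q = card P"
              using card_merge[OF refinesD(1)[OF Q'(1)] ij assms(1) Q'(2)] Q'(3) cP by simp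
            moreover have "refines X P Q \<or> refines X Q P"
              using chains_throughD(4)[OF C0(1)] Q 2(1) C0(2) by blast
            ultimately show ?thesis using refines_card_eq[OF assms(1)] by force
          qed
          then show ?thesis using 2(1) by blast
        qed
        have \<pi>P: "\<pi> \<notin> C" if "C \<in> partition_chains X P" for C
          using chains_throughD(1)[OF that] card_refines[OF assms(1), of \<pi> P] cP by auto
        have \<pi>M: "\<pi> \<notin> ?M" using \<pi>ij by blast
        \<comment> \<open>These are the chains up to \<open>P\<close> with \<pi> added, and
          induction applies; the added member makes up for
          \<open>card P = card \<pi> + 1\<close>.\<close>
        have "?F = (\<lambda>C. C \<union> {\<pi>}) ` partition_chains X P"
        proof (intro equalityI subsetI)
          fix C assume "C \<in> ?F"
          then have C: "C \<in> partition_chains X \<pi>" "P \<in> C" using E by blast+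
          note c = chains_throughD[OF C(1)]
          have CP: "refines X Q P" if Q: "Q \<in> C - {\<pi>}" for Q
            using c(1) c(4)[of P Q] above[of Q] Q C(2) refines_refl[OF Pp] by blast
          have "C - {\<pi>} \<in> partition_chains X P"
          proof (rule chains_throughI)
            show "{singletons X, P} \<subseteq> C - {\<pi>}" using c(3) C(2) P(2) \<pi>ij False by auto
            show "refines X x y \<or> refines X y x" if "x \<in> C - {\<pi>}" "y \<in> C - {\<pi>}" for x y
              using c(4) that by blast
          qed (use c(2) CP in auto)
          moreover have "C = (C - {\<pi>}) \<union> {\<pi>}" using c(3) by auto
          ultimately show "C \<in> (\<lambda>C. C \<union> {\<pi>}) ` partition_chains X P" by blast
        next
          fix C assume "C \<in> (\<lambda>C. C \<union> {\<pi>}) ` partition_chains X P"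
          then obtain C' where C': "C' \<in> partition_chains X P" "C = insert \<pi> C'" by auto
          note c = chains_throughD[OF C'(1)]
          have le: "refines X Q \<pi>" if "Q \<in> C'" for Q using c(1) that P(1) refines_trans by blast
          have "insert \<pi> C' \<in> partition_chains X \<pi>"
          proof (rule chains_throughI)
            show "refines X x y \<or> refines X y x" if "x \<in> insert \<pi> C'" "y \<in> insert \<pi> C'" for x y
              using that le c(4) refines_refl[OF \<pi>] by blast
          qed (use c le refines_refl[OF \<pi>] in auto)
          moreover have "insert \<pi> C' \<inter> ?M = {P}"
          proof -
            have "Q = P" if Q: "Q \<in> C'" "Q \<in> ?M" for Q
            proof -
              have "refines X Q P" using c(1) Q(1) by blast
              moreover have "card Q = card P"
                using card_merge[OF refinesD(1)[OF \<open>refines X Q P\<close>] ij assms(1)] Q(2) cP by simp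
              ultimately show ?thesis using refines_card_eq[OF assms(1)] by force
            qed
            then show ?thesis using \<pi>M c(3) P by blast
          qed
          ultimately show "C \<in> ?F" using C'(2) E by blast
        qed
        moreover have "dismantles ?crit ((\<lambda>C. C \<union> {\<pi>}) ` partition_chains X P)"
        proof (rule dismantles_Un_fixed)
          have cX: "card P \<le> card X" by (rule card_le[OF Pp])
          show "dismantles (\<lambda>C. card C = card X - card P + 1) (partition_chains X P)"
            using less.hyps[OF _ Pp] cP cX by simp
          show "card (C \<union> {\<pi>}) = card X - card \<pi> + 1"
            if C: "C \<in> partition_chains X P" "card C = card X - card P + 1" for C
            using C(2) \<pi>P[OF C(1)] chains_throughD(2)[OF C(1)] cP cX by simp
        qed (use \<pi>P in auto)
        ultimately show ?thesis by simp
      next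
        case 3
        have finF: "finite ?F" using finC by simp
        show ?thesis
        \<comment> \<open>The members not above the atom are fixed within a family, hence so is the
          largest of them, \<open>P\<close>. The partition toggled is above the atom and does not
          change this trace.\<close>
        proof (rule dismantles_fibres[OF finF, where N = ?N])
          fix D
          let ?G = "{C \<in> ?F. C \<inter> ?N = D}"
          show "dismantles ?crit ?G"
          proof (cases "?G = {}")
            case True
            show ?thesis unfolding True by (rule dismantles.empty)
          next
            case ne: False
            then obtain C0 where C0: "C0 \<in> partition_chains X \<pi>" "C0 \<inter> ?M = {}" "C0 \<inter> ?N = D"
              using 3 by blast
            note c0 = chains_throughD[OF C0(1)]
            have sD: "singletons X \<in> D" using c0(3) C0(3) sij by auto
            have finD: "finite D" using c0(2) C0(3) by auto
            have neD: "D \<noteq> {}" using sD by auto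
            have linD: "\<forall>P\<in>D. \<forall>Q\<in>D. refines X P Q \<or> refines X Q P"
              using c0(4) C0(3) by blast
            obtain P where P: "P \<in> D" "\<And>Q. Q \<in> D \<Longrightarrow> refines X Q P"
              using chain_has_max[OF finD neD linD refines_transp] by blast
            have P\<pi>: "refines X P \<pi>" and Pn: "\<not> together i j P" using P(1) C0 c0(1) by auto
            have Pp: "partition_on X P" using refinesD(1)[OF P\<pi>] .
            let ?v = "merge i j P"
            have v\<pi>: "refines X ?v \<pi>" by (rule merge_refines[OF Pp ij P\<pi> \<pi>ij])
            \<comment> \<open>This is the use of the empty trace on \<open>?M\<close>: the top of
              the interval must not be toggled.\<close>
            have vne: "?v \<noteq> \<pi>" using P(1) C0(2,3) P\<pi> Pn by blast
            have vij: "together i j ?v" by (rule together_merge[OF Pp ij])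
            have Pv: "refines X P ?v" by (rule refines_merge[OF Pp ij])
            have cmp: "refines X Q ?v \<or> refines X ?v Q" if C: "C \<in> ?G" "Q \<in> C" for C Q
            proof (cases "together i j Q")
              case True
              have "refines X P Q \<or> refines X Q P" using chains_throughD(4)[of C] C P(1) by blast
              then have "refines X P Q" using mono[of Q P] True Pn by blast
              then show ?thesis using merge_refines[OF Pp ij _ True] by blast
            next
              case False
              then show ?thesis using C P(2) Pv refines_trans by blast
            qed
            show ?thesis
            proof (rule dismantles_cone[where v = ?v])
              fix C assume C: "C \<in> ?G"
              then have C': "C \<in> partition_chains X \<pi>" "C \<inter> ?M = E" "C \<inter> ?N = D" by auto
              have "insert ?v C \<in> partition_chains X \<pi>"
                by (rule chains_through_insert[OF C'(1)])
                  (use v\<pi> cmp[OF C] refines_refl[OF refinesD(1)[OF v\<pi>]] in auto)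
              then show "insert ?v C \<in> ?G" using C'(2,3) vij by auto
              have "?v \<noteq> singletons X" using vij sij by auto
              then show "C - {?v} \<in> ?G"
                using chains_through_remove[OF C'(1), of ?v] vne C'(2,3) vij by auto
            qed (use finC chains_throughD(2) in auto)
          qed
        qed
      qed
    qed
  qed
qed

text \<open>Needed for two copies of partition intervals: the systems without hybrids, and those
  between a labelled system with singleton blocks and a coatom triple with the same hybrid.\<close>

lemma dismantles_partition_chains_image:
  assumes "finite X" and \<pi>: "partition_on X \<pi>" and bij: "bij_betw g {P. refines X P \<pi>} Z"
    and le: "\<And>P Q. partition_on X P \<Longrightarrow> partition_on X Q \<Longrightarrow> le (g P) (g Q) \<longleftrightarrow> refines X P Q"
  shows "dismantles (\<lambda>C. card C = card X - card \<pi> + 1) (chains_through Z le {g (singletons X), g \<pi>})"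
proof -
  have inj: "inj_on g {P. refines X P \<pi>}" using bij by (rule bij_betw_imp_inj_on)
  have "chains_through Z le (g ` {singletons X, \<pi>}) = (`) g ` partition_chains X \<pi>"
  proof (rule chains_through_image[OF bij])
    show "le (g P) (g Q) \<longleftrightarrow> refines X P Q"
      if "P \<in> {P. refines X P \<pi>}" "Q \<in> {P. refines X P \<pi>}" for P Q
      using that by (intro le) (auto dest: refinesD(1))
  qed (use singletons_refines[OF \<pi>] refines_refl[OF \<pi>] in simp)
  moreover have "dismantles (\<lambda>C. card C = card X - card \<pi> + 1) ((`) g ` partition_chains X \<pi>)"
  proof (rule dismantles_image[OF dismantles_partition_chains[OF assms(1) \<pi>]])
    show "inj_on g (\<Union>(partition_chains X \<pi>))"
      by (rule inj_on_subset[OF inj]) (use chains_throughD(1) in blast)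
    show "card (g ` C) = card X - card \<pi> + 1"
      if C: "C \<in> partition_chains X \<pi>" "card C = card X - card \<pi> + 1" for C
      using card_image[OF inj_on_subset[OF inj chains_throughD(1)[OF C(1)]]] C(2) by simp
  qed
  ultimately show ?thesis by simp
qed

section \<open>The order on ranked cactuses\<close>

definition hybrids :: "'a set_pair set \<Rightarrow> 'a set set" where
  "hybrids s = {H. H \<noteq> {} \<and> (\<exists>S. (S, H) \<in> s)}"

lemma ranked_cactusI:
  assumes "\<And>S H. (S, H) \<in> s \<Longrightarrow> S \<subseteq> X \<and> S \<noteq> {} \<and> S \<inter> H = {}"
    and unique: "\<And>p q x. p \<in> s \<Longrightarrow> q \<in> s \<Longrightarrow> x \<in> fst p \<Longrightarrow> x \<in> fst q \<Longrightarrow> p = q"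
    and cover: "\<And>x. x \<in> X \<Longrightarrow> \<exists>p\<in>s. x \<in> fst p"
    and hybrid: "\<And>S H. (S, H) \<in> s \<Longrightarrow> H \<noteq> {} \<Longrightarrow> (H, {}) \<in> s"
    and partner: "\<And>S H. (S, H) \<in> s \<Longrightarrow> H \<noteq> {} \<Longrightarrow>
      \<exists>B. B \<noteq> S \<and> (B, H) \<in> s \<and> (\<forall>C. (C, H) \<in> s \<longrightarrow> C = S \<or> C = B)"
  shows "s \<in> ranked_cactuses X"
  unfolding ranked_cactuses_def mem_Collect_eq partition_like_def
proof (intro conjI)
  have HX: "H \<subseteq> X" if SH: "(S, H) \<in> s" for S H
    using hybrid[OF SH] assms(1)[of H "{}"] by (cases "H = {}") auto
  show "set_pair_system X s"
    unfolding set_pair_system_def case_prod_beta using assms(1) HX by (metis prod.collapse)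
  show "partition_on X (fst ` s)"
  proof (rule partition_onI)
    show "\<Union>(fst ` s) = X" using assms(1) cover by fastforce
    show "disjnt p q" if pq: "p \<in> fst ` s" "q \<in> fst ` s" "p \<noteq> q" for p q
      using pq unique unfolding disjnt_def by blast
    show "{} \<notin> fst ` s" using assms(1) by force
  qed
  show "\<forall>(S, H)\<in>s. \<forall>(S', H')\<in>s. (S, H) \<noteq> (S', H') \<longrightarrow> S \<noteq> S'"
  proof -
    have "H = H'" if a: "(S, H) \<in> s" "(S, H') \<in> s" for S H H'
    proof -
      obtain x where "x \<in> S" using assms(1)[OF a(1)] by blast
      then show ?thesis using unique[OF a, of x] by simp
    qed
    then show ?thesis by clarsimp
  qed
  show "\<forall>(S, H)\<in>s. H \<noteq> {} \<longrightarrow> (H, {}) \<in> s \<and> (\<exists>!p. p \<in> s \<and> p \<noteq> (S, H) \<and> snd p = H)"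
  proof (clarify, intro conjI)
    fix S H assume a: "(S, H) \<in> s" "H \<noteq> {}"
    show "(H, {}) \<in> s" by (rule hybrid[OF a])
    obtain B where B: "B \<noteq> S" "(B, H) \<in> s" "\<forall>C. (C, H) \<in> s \<longrightarrow> C = S \<or> C = B"
      using partner[OF a] by blast
    show "\<exists>!p. p \<in> s \<and> p \<noteq> (S, H) \<and> snd p = H"
    proof (rule ex1I[of _ "(B, H)"])
      show "p = (B, H)" if p: "p \<in> s \<and> p \<noteq> (S, H) \<and> snd p = H" for p
        using p B(3) by (cases p) auto
    qed (use B in auto)
  qed
qed

lemma cactus_block_unique:
  assumes "s \<in> ranked_cactuses X" "p \<in> s" "q \<in> s" "x \<in> fst p" "x \<in> fst q"
  shows "p = q"
proof -
  have "fst p = fst q"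
    using ranked_cactuses_partition(2)[OF assms(1)] assms(2-) unfolding disjoint_def by blast
  then show ?thesis using inj_onD[OF ranked_cactuses_fst_inj[OF assms(1)]] assms(2,3) by blast
qed

lemma ranked_cactus_label_unique:
  assumes "s \<in> ranked_cactuses X" "(S, H) \<in> s" "(S, H') \<in> s"
  shows "H = H'"
  using inj_onD[OF ranked_cactuses_fst_inj[OF assms(1)], of "(S, H)" "(S, H')"] assms by simp

lemma ranked_cactus_block:
  assumes "s \<in> ranked_cactuses X" "x \<in> X"
  obtains p where "p \<in> s" "x \<in> fst p"
  using ranked_cactuses_partition(1)[OF assms(1)] assms(2) by blast

lemma ranked_cactus_partition_on:
  assumes "s \<in> ranked_cactuses X"
  shows "partition_on X (fst ` s)"
  using assms unfolding ranked_cactuses_def partition_like_def by blast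

lemma ranked_cactus_finite:
  assumes "s \<in> ranked_cactuses X" "finite X"
  shows "finite s"
  using finite_elements[OF assms(2) ranked_cactus_partition_on[OF assms(1)]]
    ranked_cactuses_fst_inj[OF assms(1)] finite_imageD by blast

lemma ranked_cactus_hybrid:
  assumes "s \<in> ranked_cactuses X" "(S, H) \<in> s" "H \<noteq> {}"
  shows "(H, {}) \<in> s" "\<exists>B. B \<noteq> S \<and> (B, H) \<in> s \<and> (\<forall>C. (C, H) \<in> s \<longrightarrow> C = S \<or> C = B)"
proof -
  have "\<forall>(S, H)\<in>s. H \<noteq> {} \<longrightarrow> (H, {}) \<in> s \<and> (\<exists>!p. p \<in> s \<and> p \<noteq> (S, H) \<and> snd p = H)"
    using assms(1) unfolding ranked_cactuses_def partition_like_def mem_Collect_eq by (elim conjE)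
  from bspec[OF this assms(2)] assms(3)
  have *: "(H, {}) \<in> s \<and> (\<exists>!p. p \<in> s \<and> p \<noteq> (S, H) \<and> snd p = H)" by simp
  then show "(H, {}) \<in> s" by blast
  obtain p where p: "p \<in> s" "p \<noteq> (S, H)" "snd p = H"
    and u: "\<And>q. q \<in> s \<and> q \<noteq> (S, H) \<and> snd q = H \<Longrightarrow> q = p"
    using * by (elim conjE ex1E) blast
  have "C = S \<or> C = fst p" if "(C, H) \<in> s" for C
    using u[of "(C, H)"] that by (cases "C = S") (simp_all add: prod_eq_iff)
  then show "\<exists>B. B \<noteq> S \<and> (B, H) \<in> s \<and> (\<forall>C. (C, H) \<in> s \<longrightarrow> C = S \<or> C = B)"
    using p by (intro exI[of _ "fst p"]) (cases p; auto)
qed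

lemma hybrids_triple:
  assumes "s \<in> ranked_cactuses X" "H \<in> hybrids s"
  obtains A B where "A \<noteq> B" "(A, H) \<in> s" "(B, H) \<in> s" "(H, {}) \<in> s"
    "\<forall>C. (C, H) \<in> s \<longrightarrow> C = A \<or> C = B" "H \<noteq> {}"
proof -
  obtain A where A: "(A, H) \<in> s" "H \<noteq> {}" using assms(2) by (auto simp: hybrids_def)
  show ?thesis using that[of A] ranked_cactus_hybrid[OF assms(1) A] A by metis
qed

text \<open>The triple of \<open>H\<close> contains \<open>(H, {})\<close>, and the label of a block
  is unique. Consequently a labelled block is never itself a hybrid.\<close>

lemma hybrids_block:
  assumes "s \<in> ranked_cactuses X" "H \<in> hybrids s" "(H, K) \<in> s"
  shows "K = {}"
  using hybrids_triple[OF assms(1,2)] ranked_cactus_label_unique[OF assms(1,3)] by metis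

text \<open>For nested blocks an empty label falls under the first alternative, and equal nonempty
  labels on equal blocks mean equality, so the strictness conditions disappear.\<close>

lemma set_pair_le_iff:
  "set_pair_le p q \<longleftrightarrow> fst p \<subseteq> fst q \<and> (snd p \<subseteq> fst q \<or> snd p = snd q)"
  by (cases p; cases q) (auto simp: set_pair_le_def)

lemma cactus_leD:
  assumes "cactus_le s t"
  shows "p \<in> s \<Longrightarrow> \<exists>q\<in>t. fst p \<subseteq> fst q \<and> (snd p \<subseteq> fst q \<or> snd p = snd q)"
    and "q \<in> t \<Longrightarrow> snd q \<in> hybrids s \<Longrightarrow> \<exists>p\<in>s. snd p = snd q \<and> fst p \<subseteq> fst q"
proof -
  show "\<exists>q\<in>t. fst p \<subseteq> fst q \<and> (snd p \<subseteq> fst q \<or> snd p = snd q)" if "p \<in> s"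
    using assms that unfolding cactus_le_def set_pair_le_iff by (elim conjE bspec)
  assume q: "q \<in> t" "snd q \<in> hybrids s"
  then obtain S where "(S, snd q) \<in> s" "snd q \<noteq> {}" by (auto simp: hybrids_def)
  then have "\<exists>p\<in>s. snd p = snd q \<and> set_pair_le p q"
    using assms q(1) unfolding cactus_le_def by (metis snd_conv)
  then show "\<exists>p\<in>s. snd p = snd q \<and> fst p \<subseteq> fst q" by (auto simp: set_pair_le_iff)
qed

lemma cactus_leI:
  assumes "\<And>p. p \<in> s \<Longrightarrow> \<exists>q\<in>t. fst p \<subseteq> fst q \<and> (snd p \<subseteq> fst q \<or> snd p = snd q)"
    and "\<And>q. q \<in> t \<Longrightarrow> snd q \<in> hybrids s \<Longrightarrow> \<exists>p\<in>s. snd p = snd q \<and> fst p \<subseteq> fst q"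
  shows "cactus_le s t"
  unfolding cactus_le_def set_pair_le_iff
proof (intro conjI ballI impI)
  fix q assume q: "q \<in> t" "snd q \<noteq> {}" "\<exists>p\<in>s. snd p = snd q"
  then have "snd q \<in> hybrids s" by (auto simp: hybrids_def)
  then obtain p where "p \<in> s" "snd p = snd q" "fst p \<subseteq> fst q" using assms(2)[OF q(1)] by blast
  then show "\<exists>p\<in>s. snd p = snd q \<and> fst p \<subseteq> fst q \<and> (snd p \<subseteq> fst q \<or> snd p = snd q)" by blast
qed (rule assms(1))

lemma cactus_le_refl: "cactus_le s s"
  by (rule cactus_leI) auto

lemma cactus_le_block:
  assumes "t \<in> ranked_cactuses X" "cactus_le s t" "p \<in> s" "q \<in> t" "x \<in> fst p" "x \<in> fst q"
  shows "fst p \<subseteq> fst q" "snd p \<subseteq> fst q \<or> snd p = snd q"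
proof -
  obtain q' where q': "q' \<in> t" "fst p \<subseteq> fst q'" "snd p \<subseteq> fst q' \<or> snd p = snd q'"
    using cactus_leD(1)[OF assms(2,3)] by blast
  then have "q' = q"
    using cactus_block_unique[OF assms(1) q'(1) assms(4) _ assms(6)] assms(5) by blast
  then show "fst p \<subseteq> fst q" "snd p \<subseteq> fst q \<or> snd p = snd q" using q' by simp_all
qed

lemma cactus_le_refines:
  assumes "s \<in> ranked_cactuses X" "t \<in> ranked_cactuses X" "cactus_le s t"
  shows "refines X (fst ` s) (fst ` t)"
  unfolding refines_def
  using ranked_cactus_partition_on[OF assms(1)] ranked_cactus_partition_on[OF assms(2)]
    cactus_leD(1)[OF assms(3)] by (simp add: ball_simps) blast

text \<open>The delicate condition is the one on hybrids: it passes through \<open>t\<close> only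
  because a common hybrid of \<open>s\<close> and \<open>u\<close> is also a hybrid of
  \<open>t\<close>.\<close>

lemma cactus_le_trans:
  assumes s: "s \<in> ranked_cactuses X" and t: "t \<in> ranked_cactuses X" and u: "u \<in> ranked_cactuses X"
    and st: "cactus_le s t" and tu: "cactus_le t u"
  shows "cactus_le s u"
proof (rule cactus_leI)
  fix p assume "p \<in> s"
  then obtain q where q: "q \<in> t" "fst p \<subseteq> fst q" "snd p \<subseteq> fst q \<or> snd p = snd q"
    using cactus_leD(1)[OF st, unfolded fst_conv snd_conv] by blast
  then obtain r where "r \<in> u" "fst q \<subseteq> fst r" "snd q \<subseteq> fst r \<or> snd q = snd r"
    using cactus_leD(1)[OF tu, unfolded fst_conv snd_conv] by blast
  then show "\<exists>q\<in>u. fst p \<subseteq> fst q \<and> (snd p \<subseteq> fst q \<or> snd p = snd q)"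
    using q by (intro bexI[of _ r]) auto
next
  fix r assume r: "r \<in> u" "snd r \<in> hybrids s"
  then obtain S H where p: "(S, H) \<in> s" "H = snd r" "H \<noteq> {}" by (auto simp: hybrids_def)
  \<comment> \<open>Otherwise a block of \<open>t\<close> contains both \<open>S\<close> and
    \<open>H\<close>, and the block of \<open>u\<close> around it can only be
    \<open>(H, {})\<close>, which leaves no room for \<open>S\<close>.\<close>
  have "H \<in> hybrids t"
  proof (rule ccontr)
    assume nH: "H \<notin> hybrids t"
    obtain q where q: "q \<in> t" "S \<subseteq> fst q" "H \<subseteq> fst q \<or> H = snd q"
      using cactus_leD(1)[OF st p(1), unfolded fst_conv snd_conv] by blast
    then have "H \<subseteq> fst q" using nH p(3) by (cases q) (auto simp: hybrids_def)
    moreover obtain r' where r': "r' \<in> u" "fst q \<subseteq> fst r'"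
      using cactus_leD(1)[OF tu q(1), unfolded fst_conv snd_conv] by blast
    moreover have "(H, {}) \<in> u"
      using ranked_cactus_hybrid(1)[OF u, of "fst r" "snd r"] r(1) p by simp
    moreover obtain x where "x \<in> H" using p(3) by blast
    ultimately have "r' = (H, {})" using cactus_block_unique[OF u r'(1), of "(H, {})" x] by auto
    then have "S \<subseteq> H" using q(2) r'(2) by auto
    then show False using ranked_cactuses_memberD(3,4)[OF s p(1)] by auto
  qed
  then obtain q where q: "q \<in> t" "snd q = snd r" "fst q \<subseteq> fst r"
    using cactus_leD(2)[OF tu r(1)] p(2) by auto
  moreover obtain p' where "p' \<in> s" "snd p' = snd q" "fst p' \<subseteq> fst q"
    using cactus_leD(2)[OF st q(1)] q(2) r(2) by auto
  ultimately show "\<exists>p\<in>s. snd p = snd r \<and> fst p \<subseteq> fst r" by (intro bexI[of _ p']) auto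
qed

section \<open>A corank for systems\<close>

text \<open>It is \<open>card X\<close> at the minimum, 1 at the maximum, and drops strictly along
  the order. Hybrid blocks are left out so that it also drops when a triple is formed without
  merging any blocks.\<close>

definition crank :: "'a set_pair set \<Rightarrow> nat" where
  "crank s = card {p \<in> s. fst p \<notin> hybrids s}"

text \<open>Each non-hybrid block of the larger system contains a non-hybrid block of the smaller one.\<close>

lemma crank_less:
  assumes X: "finite X" and s: "s \<in> ranked_cactuses X" and t: "t \<in> ranked_cactuses X"
    and le: "cactus_le s t" and ne: "s \<noteq> t"
  shows "crank t < crank s"
proof (rule ccontr)
  let ?n = "\<lambda>s. {p \<in> s. fst p \<notin> hybrids s}"
  \<comment> \<open>If the count does not drop, choosing a smaller non-hybrid block for each one is
    a bijection \<open>f\<close>, and this rigidity will force \<open>s = t\<close>.\<close>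
  assume no: "\<not> ?thesis"
  note us = cactus_block_unique[OF s] and ut = cactus_block_unique[OF t]
  have nes: "\<exists>x\<in>X. x \<in> fst p" if "p \<in> s" for p using ranked_cactuses_memberD[OF s that] by blast
  have net: "\<exists>x\<in>X. x \<in> fst p" if "p \<in> t" for p using ranked_cactuses_memberD[OF t that] by blast
  have labelled: "(A, H) \<in> ?n s" if "(A, H) \<in> s" "H \<noteq> {}" for A H
    using that hybrids_block[OF s] by auto
  have hyb_block: "(H, {}) \<in> t" if "H \<in> hybrids t" for H using hybrids_triple[OF t that] by metis
  have "\<exists>p\<in>?n s. fst p \<subseteq> fst q" if q: "q \<in> ?n t" for q
  proof -
    obtain x where x: "x \<in> X" "x \<in> fst q" using net q by blast
    obtain p where p: "p \<in> s" "x \<in> fst p" using ranked_cactus_block[OF s x(1)] .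
    have pq: "fst p \<subseteq> fst q" using cactus_le_block(1)[OF t le p(1) _ p(2) x(2)] q by blast
    show ?thesis
    proof (cases "fst p \<in> hybrids s")
      case False
      then show ?thesis using p pq by blast
    next
      \<comment> \<open>The point lies in a hybrid block of \<open>s\<close>. A block labelled by
        this hybrid then lies in \<open>q\<close>, for otherwise \<open>q\<close> would be a hybrid
        block of \<open>t\<close>.\<close>
      case True
      then obtain A where A: "(A, fst p) \<in> s" "fst p \<noteq> {}" by (auto simp: hybrids_def)
      obtain q' where q': "q' \<in> t" "A \<subseteq> fst q'" "fst p \<subseteq> fst q' \<or> fst p = snd q'"
        using cactus_leD(1)[OF le A(1), unfolded fst_conv snd_conv] by blast
      have "fst p \<noteq> snd q'"
      proof
        assume eq: "fst p = snd q'"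
        then have h: "fst p \<in> hybrids t" using q'(1) A(2) by (cases q') (auto simp: hybrids_def)
        have "q = (fst p, {})" using ut[OF _ hyb_block[OF h], of q x] q x p by auto
        then show False using q h by auto
      qed
      then have "q' = q" using ut[OF q'(1), of q x] q' q x p by auto
      then show ?thesis using labelled[OF A] q'(2) by force
    qed
  qed
  then have "\<forall>q\<in>?n t. \<exists>p. p \<in> ?n s \<and> fst p \<subseteq> fst q" by blast
  from bchoice[OF this] obtain f where f': "\<forall>q\<in>?n t. f q \<in> ?n s \<and> fst (f q) \<subseteq> fst q" ..
  have f: "f q \<in> ?n s \<and> fst (f q) \<subseteq> fst q" if "q \<in> ?n t" for q using bspec[OF f' that] .
  have inj: "inj_on f (?n t)"
  proof (rule inj_onI)
    fix q q' assume q: "q \<in> ?n t" "q' \<in> ?n t" "f q = f q'"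
    obtain x where "x \<in> fst (f q)" using nes f[OF q(1)] by blast
    then show "q = q'" using ut[of q q' x] f[OF q(1)] f[OF q(2)] q by auto
  qed
  have fins: "finite (?n s)" using ranked_cactus_finite[OF s X] by simp
  have fim: "f ` ?n t = ?n s"
    using f no card_image[OF inj] by (intro card_subset_eq[OF fins] antisym card_mono[OF fins])
      (auto simp: crank_def image_subset_iff)
  have up: "\<exists>q\<in>?n t. p = f q" if "p \<in> ?n s" for p using that fim by blast
  \<comment> \<open>As \<open>f\<close> is onto and the blocks of \<open>t\<close> are disjoint, a
    non-hybrid block of \<open>s\<close> meets only the block of \<open>t\<close> for which it was
    chosen.\<close>
  have nblock: "q \<in> ?n t \<and> p = f q" if p: "p \<in> ?n s" and q: "q \<in> t" "x \<in> fst q" "x \<in> fst p" for p q x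
  proof -
    obtain q' where q': "q' \<in> ?n t" "p = f q'" using up[OF p] by blast
    then have "q' = q" using ut[of q' q x] f[OF q'(1)] q by auto
    then show ?thesis using q' by simp
  qed
  \<comment> \<open>A triple that disappears would put both of its labelled blocks into one block of
    \<open>t\<close>, for which \<open>f\<close> chooses only one.\<close>
  have stays: "\<exists>A'. (A', H) \<in> t \<and> A \<subseteq> A'" if AH: "(A, H) \<in> s" "H \<noteq> {}" for A H
  proof (rule ccontr)
    assume no: "\<not> ?thesis"
    have collapsed: "\<exists>q\<in>t. A \<subseteq> fst q \<and> H \<subseteq> fst q"
    proof -
      obtain q where q: "q \<in> t" "A \<subseteq> fst q" "H \<subseteq> fst q \<or> H = snd q"
        using cactus_leD(1)[OF le AH(1), unfolded fst_conv snd_conv] by blast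
      moreover have "H \<noteq> snd q" using no q(1,2) by (metis prod.collapse)
      ultimately show ?thesis by blast
    qed
    then obtain q where q: "q \<in> t" "A \<subseteq> fst q" "H \<subseteq> fst q" by blast
    obtain B where B: "B \<noteq> A" "(B, H) \<in> s" using ranked_cactus_hybrid(2)[OF s AH] by blast
    obtain q' where q': "q' \<in> t" "B \<subseteq> fst q'" "H \<subseteq> fst q' \<or> H = snd q'"
      using cactus_leD(1)[OF le B(2), unfolded fst_conv snd_conv] by blast
    obtain h where h: "h \<in> H" using AH(2) by blast
    obtain a b where a: "a \<in> A" and b: "b \<in> B" using nes[OF AH(1)] nes[OF B(2)] by auto
    have "H \<noteq> snd q'"
    proof
      assume eq: "H = snd q'"
      then have "(H, {}) \<in> t" using q'(1) AH(2) by (intro hyb_block) (cases q', auto simp: hybrids_def)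
      then have "q = (H, {})" using ut[OF q(1), of "(H, {})" h] q h by auto
      then show False using q(2) a ranked_cactuses_memberD(4)[OF s AH(1)] by auto
    qed
    then have "q' = q" using ut[OF q'(1) q(1), of h] q q' h by auto
    then have "(A, H) = f q" "(B, H) = f q"
      using nblock[OF labelled[OF AH] q(1), of a] nblock[OF labelled[OF B(2) AH(2)] q(1), of b] a b q q' by auto
    then have "(A, H) = (B, H)" by simp
    then show False using B(1) by simp
  qed
  have hst: "hybrids s \<subseteq> hybrids t" using stays by (fastforce simp: hybrids_def)
  \<comment> \<open>By \<open>nblock\<close> a hybrid block of \<open>t\<close> meets only hybrid
    blocks of \<open>s\<close>, and these are hybrid blocks of \<open>t\<close> as well.\<close>
  have hts: "hybrids t \<subseteq> hybrids s"
  proof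
    fix K assume K: "K \<in> hybrids t"
    obtain x where x: "x \<in> X" "x \<in> K" using net[OF hyb_block[OF K]] by auto
    obtain p where p: "p \<in> s" "x \<in> fst p" using ranked_cactus_block[OF s x(1)] .
    show "K \<in> hybrids s"
    proof (cases "fst p \<in> hybrids s")
      case True
      then have "(fst p, {}) = (K, {})" using ut[OF hyb_block hyb_block[OF K], of "fst p" x] hst p x by auto
      then show ?thesis using True by simp
    next
      case False
      then have "(K, {}) \<in> ?n t" using nblock[of p "(K, {})" x] p x hyb_block[OF K] by auto
      then show ?thesis using K by auto
    qed
  qed
  have sub: "s \<subseteq> t"
  proof
    fix p assume p: "p \<in> s"
    show "p \<in> t"
    proof (cases "fst p \<in> hybrids s")
      case True
      then show ?thesis
        using hyb_block[of "fst p"] hst hybrids_block[OF s True, of "snd p"] p by (cases p) auto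
    next
      case False
      then obtain q where q: "q \<in> ?n t" "p = f q" using up[of p] p by blast
      have pq: "fst p \<subseteq> fst q" using f[OF q(1)] q(2) by simp
      have "fst q \<subseteq> fst p"
      proof
        fix y assume y: "y \<in> fst q"
        then have "y \<in> X" using ranked_cactuses_memberD(1)[OF t, of q] q(1) by blast
        then obtain p' where p': "p' \<in> s" "y \<in> fst p'" using ranked_cactus_block[OF s] by blast
        have "fst p' \<notin> hybrids s"
        proof
          assume "fst p' \<in> hybrids s"
          then have h: "fst p' \<in> hybrids t" using hst by blast
          then have "q = (fst p', {})" using ut[OF _ hyb_block[OF h], of q y] q(1) y p' by auto
          then show False using q(1) h by auto
        qed
        then have "p' = p" using nblock[of p' q y] p' q y by auto
        then show "y \<in> fst p" using p' by simp
      qed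
      with pq have fpq: "fst p = fst q" by blast
      obtain x where x: "x \<in> fst p" using nes[OF p] by blast
      have "snd p = snd q"
      proof (cases "snd q = {}")
        case True
        have "snd p \<subseteq> fst p \<or> snd p = snd q"
          using cactus_le_block(2)[OF t le p _ x, of q] q(1) x fpq by auto
        then show ?thesis using True ranked_cactuses_memberD(4)[OF s p] by auto
      next
        case False
        have "snd q \<in> hybrids s"
        proof -
          have "snd q \<in> hybrids t" using q(1) False by (cases q) (auto simp: hybrids_def)
          then show ?thesis using hts by blast
        qed
        then obtain p' where p': "p' \<in> s" "snd p' = snd q" "fst p' \<subseteq> fst q"
          using cactus_leD(2)[OF le, of q] q(1) by auto
        obtain y where "y \<in> fst p'" using nes[OF p'(1)] by blast
        then have "p' = p" using us[OF p'(1) p, of y] p' fpq by auto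
        then show ?thesis using p' by simp
      qed
      then have "p = q" using fpq by (simp add: prod_eq_iff)
      then show ?thesis using q by simp
    qed
  qed
  have "t \<subseteq> s"
  proof
    fix q assume q: "q \<in> t"
    obtain x where x: "x \<in> X" "x \<in> fst q" using net[OF q] by blast
    obtain p where p: "p \<in> s" "x \<in> fst p" using ranked_cactus_block[OF s x(1)] .
    then have "p = q" using ut[of p q x] sub q x by auto
    then show "q \<in> s" using p by simp
  qed
  then show False using sub ne by blast
qed

lemma crank_bounds:
  assumes "finite X" "X \<noteq> {}" "s \<in> ranked_cactuses X"
  shows "1 \<le> crank s" "crank s \<le> card X"
proof -
  have "{p \<in> s. fst p \<notin> hybrids s} \<noteq> {}"
  proof -
    obtain x where "x \<in> X" using assms(2) by blast
    then obtain p where p: "p \<in> s" using ranked_cactus_block[OF assms(3)] by blast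
    show ?thesis
    proof (cases "fst p \<in> hybrids s")
      case True
      then obtain A where "(A, fst p) \<in> s" "fst p \<noteq> {}" by (auto simp: hybrids_def)
      then show ?thesis using hybrids_block[OF assms(3)] by fastforce
    qed (use p in blast)
  qed
  moreover have fin: "finite s" by (rule ranked_cactus_finite[OF assms(3,1)])
  ultimately show "1 \<le> crank s" by (simp add: crank_def card_gt_0_iff Suc_le_eq)
  have "crank s \<le> card s" unfolding crank_def by (rule card_mono[OF fin]) auto
  also have "\<dots> = card (fst ` s)" using ranked_cactuses_fst_inj[OF assms(3)] by (simp add: card_image)
  also have "\<dots> \<le> card (singletons X)"
    by (rule card_refines[OF assms(1) singletons_refines[OF ranked_cactus_partition_on[OF assms(3)]]])
  also have "\<dots> = card X" by (simp add: singletons_def card_image)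
  finally show "crank s \<le> card X" .
qed

lemma card_chain_ranked_cactuses:
  assumes "finite X" "X \<noteq> {}" "C \<in> order_complex (ranked_cactuses X) cactus_le"
  shows "card C \<le> card X"
proof -
  have C: "C \<subseteq> ranked_cactuses X" "\<And>x y. x \<in> C \<Longrightarrow> y \<in> C \<Longrightarrow> cactus_le x y \<or> cactus_le y x"
    using assms(3) by (auto simp: order_complex_def chain_def)
  have "inj_on crank C"
  proof (rule inj_onI)
    fix s t assume st: "s \<in> C" "t \<in> C" "crank s = crank t"
    show "s = t"
      using C(2)[OF st(1,2)] crank_less[OF assms(1), of s t] crank_less[OF assms(1), of t s] st C(1)
      by fastforce
  qed
  moreover have "crank ` C \<subseteq> {1..card X}" using crank_bounds[OF assms(1,2)] C(1) by fastforce
  ultimately have "card C \<le> card {1..card X}" by (intro card_inj_on_le) auto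
  then show ?thesis by simp
qed

section \<open>Collapsing and forgetting triples\<close>

definition cluster :: "'a set_pair set \<Rightarrow> 'a set \<Rightarrow> 'a set" where
  "cluster s H = H \<union> \<Union>{S. (S, H) \<in> s}"

text \<open>All triples with hybrid in \<open>R\<close> are contracted at once. This makes sense
  because hybrid blocks carry no label, so that the clusters of different hybrids are
  disjoint.\<close>

definition collapse :: "'a set set \<Rightarrow> 'a set_pair set \<Rightarrow> 'a set_pair set" where
  "collapse R s = {p \<in> s. fst p \<notin> R \<and> snd p \<notin> R} \<union> (\<lambda>H. (cluster s H, {})) ` R"

lemma cluster_block:
  assumes "s \<in> ranked_cactuses X" "H \<in> hybrids s" "x \<in> cluster s H"
  obtains r where "r \<in> s" "x \<in> fst r" "fst r = H \<or> snd r = H"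
proof -
  have H: "(H, {}) \<in> s" using hybrids_triple[OF assms(1,2)] by metis
  from assms(3) consider "x \<in> H" | S where "(S, H) \<in> s" "x \<in> S" by (auto simp: cluster_def)
  then show ?thesis
  proof cases
    case 1
    then show ?thesis using that[OF H] by simp
  next
    case (2 S)
    then show ?thesis using that[OF 2(1)] by simp
  qed
qed

lemma hybrids_nonempty: "H \<in> hybrids s \<Longrightarrow> H \<noteq> {}"
  by (auto simp: hybrids_def)

context
  fixes X :: "'a set" and s :: "'a set_pair set" and R :: "'a set set"
  assumes s: "s \<in> ranked_cactuses X" and R: "R \<subseteq> hybrids s"
begin

lemma collapse_cases:
  assumes "p \<in> collapse R s"
  obtains "p \<in> s" "fst p \<notin> R" "snd p \<notin> R" | H where "H \<in> R" "p = (cluster s H, {})"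
  using assms by (auto simp: collapse_def)

lemma hybrid_not_collapsed:
  assumes "(S, H) \<in> s" "H \<noteq> {}"
  shows "S \<notin> R"
  using hybrids_block[OF s _ assms(1)] assms(2) R by blast

lemma collapse_in_ranked_cactuses: "collapse R s \<in> ranked_cactuses X"
proof (rule ranked_cactusI)
  have empty: "{} \<notin> R" using R hybrids_nonempty by blast
  fix S H assume SH: "(S, H) \<in> collapse R s"
  show "S \<subseteq> X \<and> S \<noteq> {} \<and> S \<inter> H = {}"
    using SH
  proof (cases rule: collapse_cases)
    case 1
    then show ?thesis using ranked_cactuses_memberD[OF s 1(1)] by simp
  next
    case (2 K)
    have "cluster s K \<subseteq> X"
    proof
      fix x assume "x \<in> cluster s K"
      then obtain r where "r \<in> s" "x \<in> fst r" using cluster_block[OF s _ \<open>x \<in> cluster s K\<close>] 2 R by blast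
      then show "x \<in> X" using ranked_cactuses_memberD(1)[OF s] by blast
    qed
    moreover have "cluster s K \<noteq> {}" using 2(1) R hybrids_nonempty by (auto simp: cluster_def)
    ultimately show ?thesis using 2 by simp
  qed
  assume H: "H \<noteq> {}"
  then have SH': "(S, H) \<in> s" "S \<notin> R" "H \<notin> R" using SH by (auto simp: collapse_def)
  show "(H, {}) \<in> collapse R s"
    using ranked_cactus_hybrid(1)[OF s SH'(1) H] SH'(3) empty by (auto simp: collapse_def)
  obtain B where B: "B \<noteq> S" "(B, H) \<in> s" "\<forall>C. (C, H) \<in> s \<longrightarrow> C = S \<or> C = B"
    using ranked_cactus_hybrid(2)[OF s SH'(1) H] by blast
  have "(B, H) \<in> collapse R s"
    using B(2) SH'(3) hybrid_not_collapsed[OF B(2) H] by (auto simp: collapse_def)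
  moreover have "(C, H) \<in> s" if "(C, H) \<in> collapse R s" for C
    using that H by (auto simp: collapse_def)
  ultimately show "\<exists>B. B \<noteq> S \<and> (B, H) \<in> collapse R s \<and> (\<forall>C. (C, H) \<in> collapse R s \<longrightarrow> C = S \<or> C = B)"
    using B(1,3) by blast
next
  fix x assume "x \<in> X"
  then obtain p where p: "p \<in> s" "x \<in> fst p" using ranked_cactus_block[OF s] by blast
  show "\<exists>p\<in>collapse R s. x \<in> fst p"
  proof (cases "fst p \<in> R \<or> snd p \<in> R")
    case True
    then obtain H where "H \<in> R" "x \<in> cluster s H"
    proof
      assume "fst p \<in> R"
      then show ?thesis using that[of "fst p"] p(2) by (auto simp: cluster_def)
    next
      assume "snd p \<in> R"
      then show ?thesis using that[of "snd p"] p by (cases p) (auto simp: cluster_def)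
    qed
    then show ?thesis by (intro bexI[of _ "(cluster s H, {})"]) (auto simp: collapse_def)
  next
    case False
    then show ?thesis using p by (intro bexI[of _ p]) (auto simp: collapse_def)
  qed
next
  have mixed: False if p: "p \<in> s" "fst p \<notin> R" "snd p \<notin> R" "x \<in> fst p" and H: "H \<in> R" "x \<in> cluster s H" for p H x
  proof -
    obtain r where r: "r \<in> s" "x \<in> fst r" "fst r = H \<or> snd r = H" using cluster_block[OF s _ H(2)] H(1) R by blast
    have "r = p" by (rule cactus_block_unique[OF s r(1) p(1) r(2) p(4)])
    then show False using r(3) p(2,3) H(1) by blast
  qed
  have both: "H = K" if H: "H \<in> R" "x \<in> cluster s H" and K: "K \<in> R" "x \<in> cluster s K" for H K x
  proof -
    have hH: "H \<in> hybrids s" and hK: "K \<in> hybrids s" using H(1) K(1) R by blast+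
    obtain r where r: "r \<in> s" "x \<in> fst r" "fst r = H \<or> snd r = H" using cluster_block[OF s hH H(2)] .
    obtain q where q: "q \<in> s" "x \<in> fst q" "fst q = K \<or> snd q = K" using cluster_block[OF s hK K(2)] .
    have rq: "r = q" by (rule cactus_block_unique[OF s r(1) q(1) r(2) q(2)])
    have "snd r = {}" if "fst r = H" using hybrids_block[OF s hH, of "snd r"] r(1) that by (metis prod.collapse)
    moreover have "snd r = {}" if "fst r = K" using hybrids_block[OF s hK, of "snd r"] r(1) that by (metis prod.collapse)
    ultimately show ?thesis using r(3) q(3) rq hybrids_nonempty[OF hH] hybrids_nonempty[OF hK] by blast
  qed
  fix p q x assume p: "p \<in> collapse R s" and q: "q \<in> collapse R s" and x: "x \<in> fst p" "x \<in> fst q"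
  show "p = q"
    using p
  proof (cases rule: collapse_cases)
    case p1: 1
    show ?thesis using q
    proof (cases rule: collapse_cases)
      case 1
      then show ?thesis using cactus_block_unique[OF s p1(1)] x by blast
    next
      case (2 H)
      then show ?thesis using mixed[OF p1 x(1), of H] x(2) by simp
    qed
  next
    case p2: (2 H)
    show ?thesis using q
    proof (cases rule: collapse_cases)
      case 1
      then show ?thesis using mixed[OF 1 x(2) p2(1)] x(1) p2(2) by simp
    next
      case (2 K)
      then show ?thesis using both[OF p2(1) _ 2(1), of x] x p2(2) by simp
    qed
  qed
qed

lemma hybrids_collapse: "hybrids (collapse R s) = hybrids s - R"
proof (intro equalityI subsetI)
  fix H assume "H \<in> hybrids s - R"
  then obtain S where "(S, H) \<in> s" "H \<noteq> {}" "H \<notin> R" by (auto simp: hybrids_def)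
  then show "H \<in> hybrids (collapse R s)"
    using hybrid_not_collapsed[of S H] by (auto simp: hybrids_def collapse_def)
qed (auto simp: hybrids_def collapse_def)

lemma le_collapse: "cactus_le s (collapse R s)"
proof (rule cactus_leI)
  fix p assume p: "p \<in> s"
  show "\<exists>q\<in>collapse R s. fst p \<subseteq> fst q \<and> (snd p \<subseteq> fst q \<or> snd p = snd q)"
  proof (cases "fst p \<in> R \<or> snd p \<in> R")
    case False
    then show ?thesis using p by (intro bexI[of _ p]) (auto simp: collapse_def)
  next
    case True
    then show ?thesis
    proof
      assume f: "fst p \<in> R"
      then have "snd p = {}" using hybrids_block[OF s, of "fst p" "snd p"] p R by auto
      then show ?thesis using f
        by (intro bexI[of _ "(cluster s (fst p), {})"]) (auto simp: collapse_def cluster_def)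
    next
      assume f: "snd p \<in> R"
      then show ?thesis using p
        by (intro bexI[of _ "(cluster s (snd p), {})"]) (cases p, auto simp: collapse_def cluster_def)+
    qed
  qed
next
  fix q assume "q \<in> collapse R s" "snd q \<in> hybrids s"
  then have "q \<in> s" using hybrids_nonempty[of "snd q" s] by (auto simp: collapse_def)
  then show "\<exists>p\<in>s. snd p = snd q \<and> fst p \<subseteq> fst q" by blast
qed

text \<open>With \<open>le_collapse\<close> and \<open>hybrids_collapse\<close> this makes the
  collapse the least system above \<open>s\<close> without a hybrid in \<open>R\<close>.\<close>

lemma collapse_le:
  assumes t: "t \<in> ranked_cactuses X" and le: "cactus_le s t" and dis: "hybrids t \<inter> R = {}"
  shows "cactus_le (collapse R s) t"
proof (rule cactus_leI)
  fix p assume "p \<in> collapse R s"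
  then show "\<exists>q\<in>t. fst p \<subseteq> fst q \<and> (snd p \<subseteq> fst q \<or> snd p = snd q)"
  proof (cases rule: collapse_cases)
    case 1
    then show ?thesis using cactus_leD(1)[OF le] by blast
  next
    case (2 H)
    then have H: "H \<in> hybrids s" using R by blast
    \<comment> \<open>As \<open>H\<close> is no hybrid of \<open>t\<close>, each block labelled
      \<open>H\<close> shares a block of \<open>t\<close> with \<open>H\<close>; all these blocks of
      \<open>t\<close> contain \<open>H\<close> and so agree.\<close>
    have big: "\<exists>q\<in>t. S \<subseteq> fst q \<and> H \<subseteq> fst q" if S: "(S, H) \<in> s" for S
    proof -
      obtain q where q: "q \<in> t" "S \<subseteq> fst q" "H \<subseteq> fst q \<or> H = snd q"
        using cactus_leD(1)[OF le S, unfolded fst_conv snd_conv] by blast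
      have "H \<noteq> snd q"
      proof
        assume "H = snd q"
        then have "H \<in> hybrids t" using q(1) hybrids_nonempty[OF H] by (cases q) (auto simp: hybrids_def)
        then show False using dis 2(1) by blast
      qed
      then show ?thesis using q by blast
    qed
    obtain h where h: "h \<in> H" using hybrids_nonempty[OF H] by blast
    obtain A where "(A, H) \<in> s" using hybrids_triple[OF s H] by metis
    then obtain q where q: "q \<in> t" "H \<subseteq> fst q" using big by blast
    have "S \<subseteq> fst q" if S: "(S, H) \<in> s" for S
    proof -
      obtain q' where q': "q' \<in> t" "S \<subseteq> fst q'" "H \<subseteq> fst q'" using big[OF S] by blast
      then have "q' = q" using cactus_block_unique[OF t q'(1) q(1), of h] h q(2) by blast
      then show ?thesis using q' by simp
    qed
    then have "cluster s H \<subseteq> fst q" using q(2) by (auto simp: cluster_def)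
    then show ?thesis using q(1) 2(2) by auto
  qed
next
  fix q assume q: "q \<in> t" "snd q \<in> hybrids (collapse R s)"
  then have "snd q \<in> hybrids s" "snd q \<notin> R" by (auto simp: hybrids_collapse)
  then obtain p where p: "p \<in> s" "snd p = snd q" "fst p \<subseteq> fst q" using cactus_leD(2)[OF le q(1)] by blast
  have "fst p \<notin> R"
    using hybrid_not_collapsed[of "fst p" "snd p"] p hybrids_nonempty[OF q(2)] by (cases p) auto
  then show "\<exists>p\<in>collapse R s. snd p = snd q \<and> fst p \<subseteq> fst q"
    using p \<open>snd q \<notin> R\<close> by (intro bexI[of _ p]) (auto simp: collapse_def)
qed

end

definition coatom_triples :: "'a set \<Rightarrow> 'a set_pair set set" where
  "coatom_triples X = {t \<in> ranked_cactuses X. \<exists>A B H. A \<noteq> B \<and> H \<noteq> {} \<and> t = {(A, H), (B, H), (H, {})}}"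

lemma hybrids_min: "hybrids (cactus_min X) = {}"
  by (auto simp: hybrids_def cactus_min_def)

lemma hybrids_max: "hybrids (cactus_max X) = {}"
  by (auto simp: hybrids_def cactus_max_def)

text \<open>The cluster of a single hybrid is already all of \<open>X\<close>, so no block lies
  outside its triple. This is the one case in which collapsing all triples yields nothing that can
  be toggled.\<close>

lemma collapse_top:
  assumes s: "s \<in> ranked_cactuses X" and H: "H \<in> hybrids s" and eq: "collapse (hybrids s) s = cactus_max X"
  shows "s \<in> coatom_triples X"
proof -
  obtain A B where AB: "A \<noteq> B" "(A, H) \<in> s" "(B, H) \<in> s" "(H, {}) \<in> s"
    and u: "\<forall>C. (C, H) \<in> s \<longrightarrow> C = A \<or> C = B" and "H \<noteq> {}"
    by (rule hybrids_triple[OF s H])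
  have "(cluster s H, {}) \<in> collapse (hybrids s) s" using H by (auto simp: collapse_def)
  then have cX: "cluster s H = X" by (simp add: eq cactus_max_def)
  have "p \<in> {(A, H), (B, H), (H, {})}" if p: "p \<in> s" for p
  proof -
    obtain x where x: "x \<in> fst p" "x \<in> X" using ranked_cactuses_memberD[OF s p] by blast
    obtain r where r: "r \<in> s" "x \<in> fst r" "fst r = H \<or> snd r = H"
      using cluster_block[OF s H, of x] x(2) cX by blast
    have "p = r" by (rule cactus_block_unique[OF s p r(1) x(1) r(2)])
    moreover have "r \<in> {(A, H), (B, H), (H, {})}"
    proof (cases "snd r = H")
      case True
      then show ?thesis using spec[OF u, of "fst r"] r(1) by (cases r) auto
    next
      case False
      then have "fst r = H" using r(3) by blast
      then show ?thesis using hybrids_block[OF s H, of "snd r"] r(1) by (cases r) auto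
    qed
    ultimately show ?thesis by simp
  qed
  then have "s = {(A, H), (B, H), (H, {})}" using AB by blast
  then show ?thesis using s AB(1) \<open>H \<noteq> {}\<close> unfolding coatom_triples_def by blast
qed

text \<open>A collapsed cluster is unlabelled, so in \<open>t\<close> it could only be the hybrid
  block \<open>K\<close>. But \<open>K\<close> is also a block of \<open>s\<close> and contains the
  collapsed hybrid, so it would equal it, whereas \<open>K\<close> is not in
  \<open>R\<close>.\<close>

lemma collapse_not_coatom_triple:
  assumes s: "s \<in> ranked_cactuses X" and t: "t \<in> coatom_triples X" and R: "R \<subseteq> hybrids s" "R \<noteq> {}"
    and dis: "hybrids t \<inter> R = {}" "hybrids t \<subseteq> hybrids s"
  shows "collapse R s \<noteq> t"
proof
  assume eq: "collapse R s = t"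
  obtain A B K where T: "A \<noteq> B" "K \<noteq> {}" "t = {(A, K), (B, K), (K, {})}"
    using t by (auto simp: coatom_triples_def)
  have K: "K \<in> hybrids t" using T by (auto simp: hybrids_def)
  obtain H where H: "H \<in> R" using R(2) by blast
  have "(cluster s H, {}) \<in> t" using H eq by (auto simp: collapse_def)
  then have cK: "cluster s H = K" using T by auto
  have Ks: "(K, {}) \<in> s" using hybrids_triple[OF s, of K] K dis(2) by blast
  have hH: "H \<in> hybrids s" using H R by blast
  obtain h where h: "h \<in> H" using hybrids_nonempty[OF hH] by blast
  have "(H, {}) \<in> s" using hybrids_triple[OF s hH] by metis
  moreover have "h \<in> K" using h cK by (auto simp: cluster_def)
  ultimately have "(H, {}) = (K, {})" using cactus_block_unique[OF s _ Ks, of "(H, {})" h] h by simp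
  then show False using K dis(1) H by blast
qed

section \<open>Partitions as systems with at most one hybrid\<close>

text \<open>The labels are prescribed by representatives that do not depend on the partition.
  \<open>L = {}\<close> embeds partitions as systems without hybrids; \<open>L = {a, b}\<close> puts
  \<open>H\<close> on the blocks of \<open>a\<close> and \<open>b\<close>.\<close>

definition mark :: "'a set \<Rightarrow> 'a set \<Rightarrow> 'a set set \<Rightarrow> 'a set_pair set" where
  "mark H L P = (\<lambda>S. (S, if S \<inter> L = {} then {} else H)) ` P"

lemma fst_mark [simp]: "fst ` mark H L P = P"
  by (force simp: mark_def)

lemma mark_in_ranked_cactuses:
  assumes P: "partition_on X P"
    and L: "L = {} \<or> H \<in> P \<and> H \<inter> L = {} \<and> L = {a, b} \<and> a \<in> X \<and> b \<in> X \<and> \<not> together a b P"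
  shows "mark H L P \<in> ranked_cactuses X"
proof (rule ranked_cactusI)
  have disj: "S = T" if "S \<in> P" "T \<in> P" "x \<in> S" "x \<in> T" for S T x
    using partition_on_block_unique[OF P] that by blast
  fix S K assume SK: "(S, K) \<in> mark H L P"
  then have S: "S \<in> P" and K: "K = (if S \<inter> L = {} then {} else H)"
    unfolding mark_def by (elim imageE, simp)+
  have "S \<inter> K = {}"
  proof (rule ccontr)
    assume ne: "S \<inter> K \<noteq> {}"
    then obtain x where x: "x \<in> S" "x \<in> K" by blast
    then have SL: "S \<inter> L \<noteq> {}" using K by (cases "S \<inter> L = {}") simp_all
    then have KH: "K = H" "S \<inter> L \<noteq> {}" using K by simp_all
    then have "S = H" using disj[OF S, of H x] x L by auto
    then show False using KH L by auto
  qed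
  then show "S \<subseteq> X \<and> S \<noteq> {} \<and> S \<inter> K = {}" using S P by (auto simp: partition_on_def)
  assume "K \<noteq> {}"
  then have SL: "S \<inter> L \<noteq> {}" using K by (cases "S \<inter> L = {}") simp_all
  then have KH: "K = H" "S \<inter> L \<noteq> {}" using K by simp_all
  then have L': "H \<in> P" "H \<inter> L = {}" "L = {a, b}" "a \<in> X" "b \<in> X" "\<not> together a b P" using L by auto
  show "(K, {}) \<in> mark H L P" using L' KH by (auto simp: mark_def)
  obtain Sa where Sa: "Sa \<in> P" "a \<in> Sa" using partition_on_block[OF P L'(4)] .
  obtain Sb where Sb: "Sb \<in> P" "b \<in> Sb" using partition_on_block[OF P L'(5)] .
  have ne: "Sa \<noteq> Sb" using L'(6) Sa Sb by (auto simp: together_def)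
  have lab: "(Sa, H) \<in> mark H L P" "(Sb, H) \<in> mark H L P"
    using Sa Sb L'(3) by (auto simp: mark_def image_iff)
  have which: "T = Sa \<or> T = Sb" if T: "T \<in> P" "T \<inter> L \<noteq> {}" for T
    using T disj[OF T(1) Sa(1) _ Sa(2)] disj[OF T(1) Sb(1) _ Sb(2)] L'(3) by auto
  have which': "T = Sa \<or> T = Sb" if T: "(T, H) \<in> mark H L P" for T
  proof (rule which)
    show "T \<in> P" using T by (auto simp: mark_def)
    have "H \<noteq> {}" using KH \<open>K \<noteq> {}\<close> by simp
    then show "T \<inter> L \<noteq> {}" using T by (auto simp: mark_def split: if_splits)
  qed
  show "\<exists>B. B \<noteq> S \<and> (B, K) \<in> mark H L P \<and> (\<forall>C. (C, K) \<in> mark H L P \<longrightarrow> C = S \<or> C = B)"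
    using which[OF S KH(2)]
  proof
    assume "S = Sa"
    then show ?thesis using ne lab which' KH by (intro exI[of _ Sb]) auto
  next
    assume "S = Sb"
    then show ?thesis using ne lab which' KH by (intro exI[of _ Sa]) auto
  qed
next
  fix x assume "x \<in> X"
  then obtain S where "S \<in> P" "x \<in> S" using partition_on_block[OF P] by blast
  then show "\<exists>p\<in>mark H L P. x \<in> fst p" by (auto simp: mark_def)
next
  fix p q x assume p: "p \<in> mark H L P" and q: "q \<in> mark H L P" and x: "x \<in> fst p" "x \<in> fst q"
  have "fst p = fst q"
    using partition_on_block_unique[OF P, of "fst p" "fst q" x] p q x by (auto simp: mark_def)
  then show "p = q" using p q by (auto simp: mark_def)
qed

text \<open>With a fixed \<open>L\<close>, a block above one that meets \<open>L\<close> also meets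
  it, and a representative in a labelled block of \<open>Q\<close> selects a labelled block of
  \<open>P\<close> below.\<close>

lemma mark_le_iff:
  assumes P: "partition_on X P" and Q: "partition_on X Q" and L: "L \<subseteq> X"
  shows "cactus_le (mark H L P) (mark H L Q) \<longleftrightarrow> refines X P Q"
proof
  assume le: "cactus_le (mark H L P) (mark H L Q)"
  show "refines X P Q"
    unfolding refines_def
  proof (intro conjI ballI P Q)
    fix S assume "S \<in> P"
    then have "(S, if S \<inter> L = {} then {} else H) \<in> mark H L P" by (auto simp: mark_def)
    from cactus_leD(1)[OF le this] show "\<exists>T\<in>Q. S \<subseteq> T" by (auto simp: mark_def)
  qed
next
  assume r: "refines X P Q"
  show "cactus_le (mark H L P) (mark H L Q)"
  proof (rule cactus_leI)
    fix p assume "p \<in> mark H L P"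
    then obtain S where S: "S \<in> P" "p = (S, if S \<inter> L = {} then {} else H)" by (auto simp: mark_def)
    obtain T where T: "T \<in> Q" "S \<subseteq> T" using refinesD(3)[OF r S(1)] by blast
    then have "(T, if T \<inter> L = {} then {} else H) \<in> mark H L Q" by (auto simp: mark_def)
    moreover have "S \<inter> L \<noteq> {} \<Longrightarrow> T \<inter> L \<noteq> {}" using T by blast
    ultimately show "\<exists>q\<in>mark H L Q. fst p \<subseteq> fst q \<and> (snd p \<subseteq> fst q \<or> snd p = snd q)"
      using S T by (intro bexI[of _ "(T, if T \<inter> L = {} then {} else H)"]) auto
  next
    fix q assume q: "q \<in> mark H L Q" "snd q \<in> hybrids (mark H L P)"
    then have ne: "snd q \<noteq> {}" using hybrids_nonempty by blast
    then obtain T where T: "T \<in> Q" "q = (T, H)" "T \<inter> L \<noteq> {}" using q(1) by (auto simp: mark_def split: if_splits)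
    then obtain x where x: "x \<in> T" "x \<in> L" by blast
    obtain S where S: "S \<in> P" "x \<in> S" using partition_on_block[OF P] x(2) L by blast
    have "S \<subseteq> T" by (rule refines_block_subset[OF r S(1) T(1) S(2) x(1)])
    moreover have "(S, H) \<in> mark H L P" using S x by (auto simp: mark_def image_iff)
    ultimately show "\<exists>p\<in>mark H L P. snd p = snd q \<and> fst p \<subseteq> fst q"
      using T by (intro bexI[of _ "(S, H)"]) auto
  qed
qed

lemma hybrids_mark: "hybrids (mark H L P) \<subseteq> {H}"
  by (auto simp: hybrids_def mark_def split: if_splits)

lemma hybrids_mark_empty: "hybrids (mark {} L P) = {}"
  by (auto simp: hybrids_def mark_def split: if_splits)

lemma mark_fst_eqI:
  assumes "\<And>p. p \<in> s \<Longrightarrow> snd p = (if fst p \<inter> L = {} then {} else H)"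
  shows "mark H L (fst ` s) = s"
proof -
  have "mark H L (fst ` s) = (\<lambda>p. (fst p, if fst p \<inter> L = {} then {} else H)) ` s"
    by (auto simp: mark_def image_iff)
  also have "\<dots> = (\<lambda>p. p) ` s" using assms by (intro image_cong refl) (auto simp: prod_eq_iff)
  finally show ?thesis by simp
qed

lemma mark_fst:
  assumes "hybrids s = {}"
  shows "mark {} {} (fst ` s) = s"
  using assms by (intro mark_fst_eqI) (auto simp: hybrids_def)

lemma mark_fst_pair:
  assumes s: "s \<in> ranked_cactuses X" "hybrids s \<subseteq> {H}"
    and SS: "(S, H) \<in> s" "(S', H) \<in> s" "S \<noteq> S'" and ab: "a \<in> S" "b \<in> S'"
  shows "mark H {a, b} (fst ` s) = s"
proof (rule mark_fst_eqI)
  fix p assume p: "p \<in> s"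
  show "snd p = (if fst p \<inter> {a, b} = {} then {} else H)"
  proof (cases "fst p \<inter> {a, b} = {}")
    case False
    then have "p = (S, H) \<or> p = (S', H)"
      using cactus_block_unique[OF s(1) p SS(1), of a]
        cactus_block_unique[OF s(1) p SS(2), of b] ab by auto
    then show ?thesis using False by auto
  next
    case True
    have "snd p = {}"
    proof (rule ccontr)
      assume "snd p \<noteq> {}"
      then have "snd p \<in> hybrids s" using p by (cases p) (auto simp: hybrids_def)
      then have pH: "snd p = H" and H: "H \<in> hybrids s" using s(2) by auto
      have pH': "(fst p, H) \<in> s" using p by (simp add: pH[symmetric])
      obtain A B where "\<forall>C. (C, H) \<in> s \<longrightarrow> C = A \<or> C = B" by (rule hybrids_triple[OF s(1) H])
      then have "fst p = S \<or> fst p = S'" using pH' SS by metis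
      then show False using True ab by auto
    qed
    then show ?thesis using True by simp
  qed
qed

lemma mark_singletons: "mark {} {} (singletons X) = cactus_min X"
  by (auto simp: mark_def singletons_def cactus_min_def)

lemma mark_top: "mark {} {} {X} = cactus_max X"
  by (auto simp: mark_def cactus_max_def)

context
  fixes X :: "'a set" and s :: "'a set_pair set"
  assumes s: "s \<in> ranked_cactuses X"
begin

abbreviation (input) "forget \<equiv> mark {} {} (fst ` s)"

lemma forget_in_ranked_cactuses: "forget \<in> ranked_cactuses X"
  by (rule mark_in_ranked_cactuses[OF ranked_cactus_partition_on[OF s]]) simp

lemma forget_le: "cactus_le forget s"
proof (rule cactus_leI)
  fix p assume "p \<in> forget"
  then obtain q where "q \<in> s" "p = (fst q, {})" by (auto simp: mark_def)
  then show "\<exists>q\<in>s. fst p \<subseteq> fst q \<and> (snd p \<subseteq> fst q \<or> snd p = snd q)" by (intro bexI[of _ q]) auto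
qed (simp add: hybrids_mark_empty)

text \<open>With \<open>forget_le\<close>, the underlying partition is the largest system without
  hybrids below \<open>s\<close>, dual to the collapse of all triples.\<close>

lemma le_forget:
  assumes r: "r \<in> ranked_cactuses X" "cactus_le r s" "hybrids r = {}"
  shows "cactus_le r forget"
  using mark_le_iff[OF ranked_cactus_partition_on[OF r(1)] ranked_cactus_partition_on[OF s], of "{}" "{}"]
    cactus_le_refines[OF r(1) s r(2)] mark_fst[OF r(3)] by simp

end

section \<open>Chains of ranked cactuses\<close>

lemma crank_alt:
  assumes "s \<in> ranked_cactuses X"
  shows "crank s = card (fst ` s - hybrids s)"
proof -
  have "fst ` {p \<in> s. fst p \<notin> hybrids s} = fst ` s - hybrids s" by auto
  moreover have "inj_on fst {p \<in> s. fst p \<notin> hybrids s}"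
    by (rule inj_on_subset[OF ranked_cactuses_fst_inj[OF assms]]) auto
  ultimately show ?thesis using card_image[of fst "{p \<in> s. fst p \<notin> hybrids s}"] by (simp add: crank_def)
qed

text \<open>Equal blocks and hybrids give equal \<open>crank\<close>, which comparable distinct
  systems cannot have.\<close>

lemma cactus_le_eqI:
  assumes "finite X" "s \<in> ranked_cactuses X" "t \<in> ranked_cactuses X" "cactus_le s t"
    and "fst ` s = fst ` t" "hybrids s = hybrids t"
  shows "s = t"
  using crank_less[OF assms(1-4)] crank_alt[OF assms(2)] crank_alt[OF assms(3)] assms(5,6) by auto

lemma bij_betw_mark_empty:
  assumes "X \<noteq> {}"
  shows "bij_betw (mark {} {}) {P. refines X P {X}} {s \<in> ranked_cactuses X. hybrids s = {}}"
proof (rule bij_betw_byWitness[where f' = "(`) fst"])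
  show "mark {} {} ` {P. refines X P {X}} \<subseteq> {s \<in> ranked_cactuses X. hybrids s = {}}"
    using refinesD(1) by (auto intro!: mark_in_ranked_cactuses simp: hybrids_mark_empty)
  show "(`) fst ` {s \<in> ranked_cactuses X. hybrids s = {}} \<subseteq> {P. refines X P {X}}"
  proof clarify
    fix s assume s: "s \<in> ranked_cactuses X"
    note P = ranked_cactus_partition_on[OF s]
    then show "refines X (fst ` s) {X}"
      using partition_on_space[OF assms] partition_onD1[OF P] unfolding refines_def by blast
  qed
qed (auto simp: mark_fst)

text \<open>Between the marked singletons and \<open>t\<close> the label \<open>H\<close> has to sit
  on the blocks of \<open>a\<close> and \<open>b\<close>, so only the partition varies. As
  \<open>H\<close> is a single point, it stays a block of every refinement of
  \<open>{A, B, H}\<close>.\<close>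

lemma bij_betw_mark:
  assumes t: "t \<in> ranked_cactuses X" "t = {(A, H), (B, H), (H, {})}" "A \<noteq> B" "H = {h}"
    and ab: "a \<in> A" "b \<in> B"
  shows "bij_betw (mark H {a, b}) {P. refines X P {A, B, H}}
    {z \<in> ranked_cactuses X. cactus_le (mark H {a, b} (singletons X)) z \<and> cactus_le z t \<and> hybrids z \<subseteq> {H}}"
    (is "bij_betw _ _ ?Z")
proof -
  let ?L = "{a, b}"
  have mem: "(A, H) \<in> t" "(B, H) \<in> t" "(H, {}) \<in> t" using t(2) by auto
  have ft: "fst ` t = {A, B, H}" by (simp add: t(2))
  have \<pi>: "partition_on X {A, B, H}" using ranked_cactus_partition_on[OF t(1)] by (simp only: ft)
  have X: "a \<in> X" "b \<in> X" using partition_onD1[OF \<pi>] ab by auto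
  have AH: "A \<inter> H = {}" "B \<inter> H = {}"
    using ranked_cactuses_memberD(4)[OF t(1) mem(1)] ranked_cactuses_memberD(4)[OF t(1) mem(2)] by simp_all
  have AB: "A \<inter> B = {}"
    using cactus_block_unique[OF t(1) mem(1,2)] t(3) by fastforce
  have "hybrids t \<subseteq> {H}" using t(2) by (auto simp: hybrids_def)
  then have t_mark: "t = mark H ?L {A, B, H}"
    using mark_fst_pair[OF t(1) _ mem(1,2) t(3) ab] by (simp add: ft)
  have LX: "?L \<subseteq> X" using X by simp
  have into: "mark H ?L P \<in> ranked_cactuses X" if P: "refines X P {A, B, H}" for P
  proof (rule mark_in_ranked_cactuses[OF refinesD(1)[OF P]])
    have hX: "h \<in> X" using partition_onD1[OF \<pi>] t(4) by auto
    obtain S where S: "S \<in> P" "h \<in> S" using partition_on_block[OF refinesD(1)[OF P] hX] .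
    have "S \<subseteq> H" using refines_block_subset[OF P S(1) _ S(2), of H] t(4) by simp
    then have "S = H" using S(2) t(4) by auto
    then have "H \<in> P" using S by simp
    moreover have "\<not> together a b P"
    proof
      assume "together a b P"
      then obtain S where S: "S \<in> P" "a \<in> S" "b \<in> S" by (auto simp: together_def)
      have "S \<subseteq> A" using refines_block_subset[OF P S(1) _ S(2) ab(1)] by simp
      then show False using S(3) ab(2) AB by blast
    qed
    ultimately show "?L = {} \<or> H \<in> P \<and> H \<inter> ?L = {} \<and> ?L = {a, b} \<and> a \<in> X \<and> b \<in> X \<and> \<not> together a b P"
      using X ab AH by auto
  qed
  have inverse: "mark H ?L (fst ` z) = z" if z: "z \<in> ?Z" for z
  proof -
    have zr: "z \<in> ranked_cactuses X" and zu: "cactus_le (mark H ?L (singletons X)) z"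
      and zle: "cactus_le z t" and zH: "hybrids z \<subseteq> {H}" using z by auto
    \<comment> \<open>This block lies above a singleton labelled \<open>H\<close>, so it contains
      \<open>H\<close> or carries it as label; lying inside \<open>A\<close> or \<open>B\<close>, it
      cannot contain \<open>H\<close>.\<close>
    have lab: "snd p = H" if p: "p \<in> z" "x \<in> fst p" and x: "x \<in> ?L" for p x
    proof -
      have "({x}, H) \<in> mark H ?L (singletons X)" using x X by (auto simp: mark_def singletons_def)
      then have "H \<subseteq> fst p \<or> H = snd p"
        using cactus_le_block(2)[OF zr zu _ p(1), of "({x}, H)" x] p(2) by simp
      moreover have "\<not> H \<subseteq> fst p"
      proof -
        from x consider "x \<in> A" | "x \<in> B" using ab by auto
        then show ?thesis
        proof cases
          case 1
          then have "fst p \<subseteq> A" using cactus_le_block(1)[OF t(1) zle p(1) mem(1) p(2)] by simp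
          then show ?thesis using AH t(4) by auto
        next
          case 2
          then have "fst p \<subseteq> B" using cactus_le_block(1)[OF t(1) zle p(1) mem(2) p(2)] by simp
          then show ?thesis using AH t(4) by auto
        qed
      qed
      ultimately show ?thesis by simp
    qed
    obtain pa where pa: "pa \<in> z" "a \<in> fst pa" using ranked_cactus_block[OF zr X(1)] .
    obtain pb where pb: "pb \<in> z" "b \<in> fst pb" using ranked_cactus_block[OF zr X(2)] .
    have "fst pa \<subseteq> A" using cactus_le_block(1)[OF t(1) zle pa(1) mem(1) pa(2)] ab by simp
    then have ne: "fst pa \<noteq> fst pb" using pb(2) ab(2) AB by blast
    have "(fst pa, H) \<in> z" "(fst pb, H) \<in> z"
      using lab[OF pa] lab[OF pb] pa(1) pb(1) by (metis insertCI prod.collapse)+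
    then show ?thesis by (rule mark_fst_pair[OF zr zH _ _ ne pa(2) pb(2)])
  qed
  show ?thesis
  proof (rule bij_betw_byWitness[where f' = "(`) fst"])
    show "mark H ?L ` {P. refines X P {A, B, H}} \<subseteq> ?Z"
    proof clarify
      fix P assume P: "refines X P {A, B, H}"
      have "cactus_le (mark H ?L (singletons X)) (mark H ?L P)"
        using mark_le_iff[OF _ refinesD(1)[OF P] LX, of "singletons X"] singletons_refines[OF refinesD(1)[OF P]]
        by (simp add: singletons_def partition_on_singletons)
      moreover have "cactus_le (mark H ?L P) t"
        unfolding t_mark using mark_le_iff[OF refinesD(1)[OF P] \<pi> LX] P by simp
      ultimately show "mark H ?L P \<in> ranked_cactuses X \<and> cactus_le (mark H ?L (singletons X)) (mark H ?L P) \<and>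
          cactus_le (mark H ?L P) t \<and> hybrids (mark H ?L P) \<subseteq> {H}"
        using into[OF P] hybrids_mark by blast
    qed
    show "(`) fst ` ?Z \<subseteq> {P. refines X P {A, B, H}}"
      using cactus_le_refines[OF _ t(1)] ft by auto
  qed (use inverse in auto)
qed

section \<open>The matching on chains from minimum to maximum\<close>

context
  fixes X :: "'a set"
  assumes fin: "finite X" and two: "2 \<le> card X"
begin

abbreviation (input) "\<PP> \<equiv> ranked_cactuses X"
abbreviation (input) "cmin \<equiv> cactus_min X"
abbreviation (input) "cmax \<equiv> cactus_max X"
abbreviation (input) "T \<equiv> coatom_triples X"
abbreviation (input) "cchains \<equiv> chains_through \<PP> cactus_le {cmin, cmax}"

lemma X_nonempty: "X \<noteq> {}" using two by auto

lemma min_neq_max: "cmin \<noteq> cmax"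
proof
  assume eq: "cmin = cmax"
  have "(X, {}) \<in> cmax" by (simp add: cactus_max_def)
  then have "(X, {}) \<in> cmin" by (simp only: eq)
  then obtain x where "X = {x}" unfolding cactus_min_def by blast
  then show False using two by simp
qed

lemma finite_cchains: "finite cchains"
  by (rule finite_chains_through[OF finite_ranked_cactuses[OF fin]])

lemma cchainsD:
  assumes "C \<in> cchains"
  shows "z \<in> C \<Longrightarrow> z \<in> \<PP>" "finite C" "cmin \<in> C" "cmax \<in> C"
    "y \<in> C \<Longrightarrow> z \<in> C \<Longrightarrow> cactus_le y z \<or> cactus_le z y"
  using chains_throughD[OF assms] by auto

lemma transp_cactus_le: "D \<subseteq> \<PP> \<Longrightarrow> transp_on D cactus_le"
  by (intro transp_onI) (blast intro: cactus_le_trans)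

lemma max_le: "s \<in> \<PP> \<Longrightarrow> cactus_le cmax s \<Longrightarrow> s = cmax"
  by (rule cactus_max_le_iff[OF X_nonempty])

lemma coatom_tripleD:
  assumes "t \<in> T"
  shows "t \<in> \<PP>" "t \<noteq> cmax" "hybrids t \<noteq> {}"
    "z \<in> \<PP> \<Longrightarrow> cactus_le t z \<Longrightarrow> z = t \<or> z = cmax"
proof -
  show t: "t \<in> \<PP>" using assms by (simp add: coatom_triples_def)
  obtain A B H where T: "A \<noteq> B" "H \<noteq> {}" "t = {(A, H), (B, H), (H, {})}"
    using assms by (auto simp: coatom_triples_def)
  then have H: "H \<in> hybrids t" by (auto simp: hybrids_def)
  then show "hybrids t \<noteq> {}" by blast
  then show "t \<noteq> cmax" using hybrids_max by metis
  assume z: "z \<in> \<PP>" "cactus_le t z"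
  \<comment> \<open>At most \<open>A\<close> and \<open>B\<close> are counted, so no value of
    \<open>crank\<close> fits strictly between \<open>t\<close> and the maximum.\<close>
  have "fst ` t - hybrids t \<subseteq> {A, B}" using T H by auto
  then have "card (fst ` t - hybrids t) \<le> card {A, B}" by (rule card_mono[rotated]) simp
  then have "crank t \<le> 2" using T(1) by (simp add: crank_alt[OF t])
  show "z = t \<or> z = cmax"
  proof (rule ccontr)
    assume no: "\<not> ?thesis"
    then have "crank z < crank t" using crank_less[OF fin t z(1,2)] by blast
    moreover have "crank cmax < crank z"
      using crank_less[OF fin z(1) cactus_max_in[OF X_nonempty] cactus_le_max[OF z(1)]] no by blast
    moreover have "1 \<le> crank cmax"
      by (rule crank_bounds[OF fin X_nonempty cactus_max_in[OF X_nonempty]])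
    ultimately show False using \<open>crank t \<le> 2\<close> by linarith
  qed
qed

lemma dismantles_toggle:
  assumes F: "F \<subseteq> cchains" and v: "v \<in> \<PP>" "v \<noteq> cmin" "v \<noteq> cmax"
    and cmp: "\<And>C z. C \<in> F \<Longrightarrow> z \<in> C \<Longrightarrow> cactus_le z v \<or> cactus_le v z"
    and closed: "\<And>C. C \<in> F \<Longrightarrow> insert v C \<in> cchains \<Longrightarrow> insert v C \<in> F"
      "\<And>C. C \<in> F \<Longrightarrow> C - {v} \<in> cchains \<Longrightarrow> C - {v} \<in> F"
  shows "dismantles crit F"
proof (rule dismantles_cone[where v = v])
  show "finite F" using finite_subset[OF F finite_cchains] .
  fix C assume C: "C \<in> F"
  then have C': "C \<in> cchains" using F by blast
  show "finite C" by (rule cchainsD(2)[OF C'])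
  show "insert v C \<in> F"
    by (rule closed(1)[OF C chains_through_insert[OF C' v(1) cactus_le_refl cmp[OF C]]])
  show "C - {v} \<in> F"
    by (rule closed(2)[OF C chains_through_remove[OF C']]) (use v in auto)
qed

text \<open>\<open>C \<inter> T = {t} \<inter> T\<close> covers both kinds of \<open>t\<close>: it
  makes \<open>t\<close> the only coatom triple of \<open>C\<close>, or says that there is none if
  \<open>t\<close> is the maximum. Fixing \<open>D\<close> fixes its largest member
  \<open>x\<close>; members above \<open>x\<close> outside \<open>D\<close> have only hybrids of
  \<open>t\<close> and therefore lie above the collapse.\<close>

lemma dismantles_uncollapsed_fibre:
  assumes t: "t \<in> \<PP>" "t = cmax \<or> t \<in> T"
    and N: "N = {x. \<not> hybrids x \<subseteq> hybrids t}" and D: "D \<noteq> {}"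
  shows "dismantles crit {C \<in> {C \<in> cchains. t \<in> C \<and> C \<inter> T = {t} \<inter> T}. C \<inter> N = D}"
    (is "dismantles crit ?F")
proof (cases "?F = {}")
  case True
  show ?thesis unfolding True by (rule dismantles.empty)
next
  case False
  then obtain C0 where C0: "C0 \<in> cchains" "t \<in> C0" "C0 \<inter> T = {t} \<inter> T" "C0 \<inter> N = D" by blast
  have DP: "D \<subseteq> \<PP>" using C0 cchainsD(1)[OF C0(1)] by blast
  have "finite D" using cchainsD(2)[OF C0(1)] C0(4) by blast
  moreover have "\<forall>x\<in>D. \<forall>y\<in>D. cactus_le x y \<or> cactus_le y x" using cchainsD(5)[OF C0(1)] C0(4) by blast
  ultimately obtain x where x: "x \<in> D" "\<forall>z\<in>D. cactus_le z x"
    using chain_has_max[OF _ D, of cactus_le] transp_cactus_le[OF DP] by blast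
  have xP: "x \<in> \<PP>" and xC: "x \<in> C0" and xN: "\<not> hybrids x \<subseteq> hybrids t" using x(1) DP C0 N by auto
  have xmax: "x \<noteq> cmax" using xN hybrids_max by blast
  have xt: "cactus_le x t"
  proof (cases "t = cmax")
    case True
    then show ?thesis using cactus_le_max[OF xP] by simp
  next
    case False
    then have "t \<in> T" using t(2) by blast
    moreover have "x \<noteq> t" using xN by blast
    ultimately show ?thesis using cchainsD(5)[OF C0(1) xC C0(2)] coatom_tripleD(4)[of t x] xP xmax by blast
  qed
  let ?R = "hybrids x - hybrids t"
  let ?v = "collapse ?R x"
  have R: "?R \<subseteq> hybrids x" "?R \<noteq> {}" using xN by auto
  have hv: "hybrids ?v \<subseteq> hybrids t" using hybrids_collapse[OF xP R(1)] by auto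
  have vP: "?v \<in> \<PP>" by (rule collapse_in_ranked_cactuses[OF xP R(1)])
  have xv: "cactus_le x ?v" by (rule le_collapse[OF xP R(1)])
  have vle: "cactus_le ?v z" if "z \<in> \<PP>" "cactus_le x z" "hybrids z \<subseteq> hybrids t" for z
    by (rule collapse_le[OF xP R(1) that(1,2)]) (use that(3) in auto)
  have vt: "cactus_le ?v t" using vle[OF t(1) xt] by simp
  \<comment> \<open>If \<open>t\<close> is the maximum, reaching it would make \<open>x\<close> a
    coatom triple, which the chain does not contain. If \<open>t\<close> is a coatom triple,
    collapsing foreign hybrids cannot produce it.\<close>
  have v_neq_t: "?v \<noteq> t"
  proof
    assume eq: "?v = t"
    then have ht: "hybrids t \<subseteq> hybrids x" using hybrids_collapse[OF xP R(1)] by auto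
    show False
    proof (cases "t = cmax")
      case True
      then have "?R = hybrids x" using hybrids_max by auto
      then have "x \<in> T" using collapse_top[OF xP] R eq True by auto
      then have "x \<in> {t} \<inter> T" using C0(3) xC by (metis IntI)
      then show False using xN by simp
    next
      case False
      then have "t \<in> T" using t(2) by blast
      then show False using collapse_not_coatom_triple[OF xP _ R _ ht] eq by blast
    qed
  qed
  have v_max: "?v \<noteq> cmax" using vt v_neq_t max_le[OF t(1)] by metis
  \<comment> \<open>If \<open>t\<close> is the maximum, the collapse has no hybrid at all; strictly
    below a coatom triple there is no other one.\<close>
  have v_T: "?v \<notin> T"
  proof
    assume "?v \<in> T"
    then have "t = cmax" using coatom_tripleD(4)[of ?v t] vt v_neq_t t(1) by blast
    then show False using coatom_tripleD(3)[OF \<open>?v \<in> T\<close>] hv hybrids_max by blast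
  qed
  have v_min: "?v \<noteq> cmin"
    using xv cactus_le_min_iff[OF xP] xN hybrids_min by (metis empty_subsetI)
  have v_N: "?v \<notin> N" using hv N by blast
  show ?thesis
  proof (rule dismantles_toggle[where v = ?v, OF _ vP v_min v_max])
    fix C z assume C: "C \<in> ?F" and z: "z \<in> C"
    then have C': "C \<in> cchains" "C \<inter> N = D" by auto
    have zP: "z \<in> \<PP>" by (rule cchainsD(1)[OF C'(1) z])
    have le: "cactus_le z ?v" if "cactus_le z x" by (rule cactus_le_trans[OF zP xP vP that xv])
    show "cactus_le z ?v \<or> cactus_le ?v z"
    proof (cases "z \<in> N")
      case True
      then show ?thesis using le x(2) z C'(2) by blast
    next
      case False
      moreover have "cactus_le z x \<or> cactus_le x z" using cchainsD(5)[OF C'(1) z, of x] x(1) C'(2) by blast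
      ultimately show ?thesis using le vle[OF zP] N by blast
    qed
  next
    fix C assume C: "C \<in> ?F"
    show "insert ?v C \<in> ?F" if "insert ?v C \<in> cchains" using that C v_T v_N by auto
    show "C - {?v} \<in> ?F" if "C - {?v} \<in> cchains" using that C v_T v_N v_neq_t by auto
  qed auto
qed

text \<open>The maximum has no hybrid, so the empty trace leaves just the chains of partitions, with
  critical size \<open>card X - 1 + 1\<close>.\<close>

lemma dismantles_unlabelled_chains:
  "dismantles (\<lambda>C. card C = card X) {C \<in> {C \<in> cchains. cmax \<in> C \<and> C \<inter> T = {cmax} \<inter> T}.
     C \<inter> {x. \<not> hybrids x \<subseteq> hybrids cmax} = {}}" (is "dismantles _ ?F")
proof -
  let ?Z = "{s \<in> \<PP>. hybrids s = {}}"
  have X: "partition_on X {X}" by (rule partition_on_space[OF X_nonempty])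
  have maxT: "cmax \<notin> T" using coatom_tripleD(2) by blast
  have "?F = chains_through ?Z cactus_le {cmin, cmax}"
    using coatom_tripleD(3) maxT unfolding hybrids_max
    by (auto simp: chains_through_def order_complex_def)
  moreover have "cactus_le (mark {} {} P) (mark {} {} Q) \<longleftrightarrow> refines X P Q"
    if "partition_on X P" "partition_on X Q" for P Q
    by (rule mark_le_iff[OF that]) simp
  ultimately show ?thesis
    using dismantles_partition_chains_image[OF fin X bij_betw_mark_empty[OF X_nonempty]] two
    by (simp add: mark_singletons mark_top)
qed

text \<open>\<open>M\<close> collects the systems with a hybrid whose underlying partition is the
  minimum. Without them the partition below the smallest member with a hybrid can be toggled; this
  member exists because \<open>t\<close> has a hybrid.\<close>

lemma dismantles_forget_fibre:
  assumes t: "t \<in> T" and N: "N = {x. \<not> hybrids x \<subseteq> hybrids t}"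
    and M: "M = {u \<in> \<PP>. hybrids u \<noteq> {} \<and> fst ` u = singletons X}"
  shows "dismantles crit {C \<in> {C \<in> {C \<in> cchains. t \<in> C \<and> C \<inter> T = {t} \<inter> T}. C \<inter> N = {}}. C \<inter> M = {}}"
    (is "dismantles crit ?F")
\<comment> \<open>All members with a hybrid are fixed, so the smallest of them is the same
  throughout a family.\<close>
proof (rule dismantles_fibres[where N = "{z. hybrids z \<noteq> {}}"])
  show "finite ?F" using finite_cchains by simp
  fix D
  let ?N = "{z :: 'a set_pair set. hybrids z \<noteq> {}}"
  let ?G = "{C \<in> ?F. C \<inter> ?N = D}"
  show "dismantles crit ?G"
  proof (cases "?G = {}")
    case True
    show ?thesis unfolding True by (rule dismantles.empty)
  next
    case False
    then obtain C0 where C0: "C0 \<in> cchains" "t \<in> C0" "C0 \<inter> M = {}" "C0 \<inter> ?N = D" by blast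
    have DP: "D \<subseteq> \<PP>" using C0 cchainsD(1)[OF C0(1)] by blast
    have "finite D" using cchainsD(2)[OF C0(1)] C0(4) by blast
    moreover have "D \<noteq> {}" using C0(2,4) coatom_tripleD(3)[OF t] by blast
    moreover have "\<forall>x\<in>D. \<forall>y\<in>D. cactus_le y x \<or> cactus_le x y" using cchainsD(5)[OF C0(1)] C0(4) by blast
    moreover have "transp_on D (\<lambda>x y. cactus_le y x)"
      using transp_cactus_le[OF DP] unfolding transp_on_def by blast
    ultimately obtain y where y: "y \<in> D" "\<forall>z\<in>D. cactus_le y z"
      using chain_has_max[of D "\<lambda>x y. cactus_le y x"] by blast
    have yP: "y \<in> \<PP>" and yC: "y \<in> C0" and yh: "hybrids y \<noteq> {}" using y(1) DP C0 by auto
    let ?v = "mark {} {} (fst ` y)"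
    have vP: "?v \<in> \<PP>" by (rule forget_in_ranked_cactuses[OF yP])
    have vy: "cactus_le ?v y" by (rule forget_le[OF yP])
    have hv: "hybrids ?v = {}" by (rule hybrids_mark_empty)
    have v_min: "?v \<noteq> cmin"
    proof
      assume "?v = cmin"
      then have "fst ` ?v = fst ` mark {} {} (singletons X)" by (simp only: mark_singletons)
      then have "fst ` y = singletons X" by simp
      then show False using yC C0(3) yP yh M by blast
    qed
    have v_max: "?v \<noteq> cmax"
      using max_le[OF yP] vy yh hybrids_max by metis
    have v_T: "?v \<notin> T" using coatom_tripleD(3) hv by blast
    show ?thesis
    proof (rule dismantles_toggle[where v = ?v, OF _ vP v_min v_max])
      fix C z assume C: "C \<in> ?G" and z: "z \<in> C"
      then have C': "C \<in> cchains" "C \<inter> ?N = D" by auto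
      have zP: "z \<in> \<PP>" by (rule cchainsD(1)[OF C'(1) z])
      have le: "cactus_le ?v z" if "cactus_le y z" by (rule cactus_le_trans[OF vP yP zP vy that])
      show "cactus_le z ?v \<or> cactus_le ?v z"
      proof (cases "hybrids z = {}")
        case False
        then show ?thesis using le y(2) z C'(2) by blast
      next
        case True
        moreover have "cactus_le z y \<or> cactus_le y z" using cchainsD(5)[OF C'(1) z, of y] y(1) C'(2) by blast
        ultimately show ?thesis using le le_forget[OF yP zP] by blast
      qed
    next
      fix C assume C: "C \<in> ?G"
      have "?v \<notin> N" "?v \<notin> M" "?v \<notin> ?N" "?v \<noteq> t" using hv N M t v_T by auto
      show "insert ?v C \<in> ?G" if "insert ?v C \<in> cchains"
        using that C v_T \<open>?v \<notin> N\<close> \<open>?v \<notin> M\<close> \<open>?v \<notin> ?N\<close> by auto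
      show "C - {?v} \<in> ?G" if "C - {?v} \<in> cchains"
        using that C v_T \<open>?v \<notin> N\<close> \<open>?v \<notin> M\<close> \<open>?v \<notin> ?N\<close> \<open>?v \<noteq> t\<close> by auto
    qed auto
  qed
qed

lemma cchains_Un_bounds:
  assumes C: "C \<subseteq> \<PP>" "finite C" and lin: "\<And>x y. x \<in> C \<Longrightarrow> y \<in> C \<Longrightarrow> cactus_le x y \<or> cactus_le y x"
  shows "C \<union> {cmin, cmax} \<in> cchains"
proof (rule chains_throughI)
  show P: "C \<union> {cmin, cmax} \<subseteq> \<PP>" using C(1) cactus_min_in cactus_max_in[OF X_nonempty] by auto
  fix x y assume xy: "x \<in> C \<union> {cmin, cmax}" "y \<in> C \<union> {cmin, cmax}"
  then have P': "x \<in> \<PP>" "y \<in> \<PP>" using P by blast+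
  show "cactus_le x y \<or> cactus_le y x"
  proof (cases "x \<in> C \<and> y \<in> C")
    case True
    then show ?thesis using lin by blast
  next
    case False
    then have "x = cmin \<or> x = cmax \<or> y = cmin \<or> y = cmax" using xy by blast
    then show ?thesis
      using cactus_min_le[OF P'(1)] cactus_min_le[OF P'(2)] cactus_le_max[OF P'(1)] cactus_le_max[OF P'(2)]
      by blast
  qed
qed (use C in auto)

text \<open>Every member except the minimum lies above \<open>u\<close>, and every member except the
  maximum lies below \<open>t\<close>. Apart from these two, the chain lives in the interval from
  \<open>u\<close> to \<open>t\<close>, which is a copy of a partition interval.\<close>

lemma dismantles_atom_fibre:
  assumes t: "t \<in> T" and N: "N = {x. \<not> hybrids x \<subseteq> hybrids t}"
    and M: "M = {u \<in> \<PP>. hybrids u \<noteq> {} \<and> fst ` u = singletons X}" and E: "u \<in> E"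
  shows "dismantles (\<lambda>C. card C = card X)
    {C \<in> {C \<in> {C \<in> cchains. t \<in> C \<and> C \<inter> T = {t} \<inter> T}. C \<inter> N = {}}. C \<inter> M = E}"
    (is "dismantles ?crit ?F")
proof (cases "?F = {}")
  case True
  show ?thesis unfolding True by (rule dismantles.empty)
next
  case False
  then obtain C0 where C0: "C0 \<in> cchains" "t \<in> C0" "C0 \<inter> N = {}" "C0 \<inter> M = E" by blast
  have tP: "t \<in> \<PP>" and tmax: "t \<noteq> cmax" using coatom_tripleD(1,2)[OF t] by auto
  obtain A B H where T: "A \<noteq> B" "H \<noteq> {}" "t = {(A, H), (B, H), (H, {})}"
    using t by (auto simp: coatom_triples_def)
  have ht: "hybrids t = {H}" using T by (auto simp: hybrids_def)
  have uM: "u \<in> M" and uC: "u \<in> C0" and uN: "u \<notin> N" using E C0 by auto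
  have uP: "u \<in> \<PP>" and fu: "fst ` u = singletons X" using uM M by auto
  have hu: "hybrids u = {H}" using uM uN M N ht by auto
  have below_t: "cactus_le z t" if z: "z \<in> \<PP>" "z \<noteq> cmax" "cactus_le z t \<or> cactus_le t z" for z
    using z coatom_tripleD(4)[OF t z(1)] cactus_le_refl by blast
  have "u \<noteq> cmax" using hu hybrids_max by auto
  then have ut: "cactus_le u t" using below_t[OF uP] cchainsD(5)[OF C0(1) uC C0(2)] by blast
  have Hu: "H \<in> hybrids u" by (simp add: hu)
  have not_min: "u \<noteq> cmin" "t \<noteq> cmin" using hu ht hybrids_min by (metis insert_not_empty)+
  obtain S1 where S1: "(S1, H) \<in> u" using Hu by (auto simp: hybrids_def)
  have sing: "\<exists>x\<in>X. S = {x}" if "(S, K) \<in> u" for S K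
  proof -
    have "S \<in> fst ` u" using that by force
    then show ?thesis unfolding fu by (auto simp: singletons_def)
  qed
  \<comment> \<open>The hybrid is itself a block of \<open>u\<close>, and all blocks of
    \<open>u\<close> are singletons.\<close>
  obtain h where h: "H = {h}" using sing[OF ranked_cactus_hybrid(1)[OF uP S1 T(2)]] by blast
  have one: "\<exists>p\<in>u. snd p = H \<and> fst p \<subseteq> A" "\<exists>p\<in>u. snd p = H \<and> fst p \<subseteq> B"
    using cactus_leD(2)[OF ut, of "(A, H)"] cactus_leD(2)[OF ut, of "(B, H)"] T(3) Hu by auto
  obtain pa where pa: "pa \<in> u" "snd pa = H" "fst pa \<subseteq> A" using one(1) by blast
  obtain pb where pb: "pb \<in> u" "snd pb = H" "fst pb \<subseteq> B" using one(2) by blast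
  obtain a where a: "fst pa = {a}" "a \<in> X" using sing[of "fst pa" "snd pa"] pa(1) by auto
  obtain b where b: "fst pb = {b}" "b \<in> X" using sing[of "fst pb" "snd pb"] pb(1) by auto
  have ab: "a \<in> A" "b \<in> B" using pa(3) pb(3) a b by auto
  have AB: "A \<inter> B = {}"
    using cactus_block_unique[OF tP, of "(A, H)" "(B, H)"] T by auto
  have ab_lab: "({a}, H) \<in> u" "({b}, H) \<in> u" using pa pb a b by (metis prod.collapse)+
  have "{a} \<noteq> {b}" using ab AB by auto
  then have "mark H {a, b} (fst ` u) = u"
    by (intro mark_fst_pair[OF uP _ ab_lab]) (simp_all add: hu)
  then have u_mark: "u = mark H {a, b} (singletons X)" by (simp only: fu)
  let ?g = "mark H {a, b}" and ?\<pi> = "{A, B, H}"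
  let ?Z = "{z \<in> \<PP>. cactus_le u z \<and> cactus_le z t \<and> hybrids z \<subseteq> {H}}"
  have bij: "bij_betw ?g {P. refines X P ?\<pi>} ?Z"
    unfolding u_mark by (rule bij_betw_mark[OF tP T(3,1) h ab])
  have \<pi>: "partition_on X ?\<pi>" using ranked_cactus_partition_on[OF tP] T(3) by simp
  have LX: "{a, b} \<subseteq> X" using a b by simp
  have AH: "A \<inter> H = {}" "B \<inter> H = {}" and neA: "A \<noteq> {}" "B \<noteq> {}"
    using ranked_cactuses_memberD(3,4)[OF tP, of "(A, H)"] ranked_cactuses_memberD(3,4)[OF tP, of "(B, H)"] T(3) by auto
  have t_mark: "t = ?g ?\<pi>"
    using mark_fst_pair[OF tP _ _ _ T(1) ab, of H] T(3) ht by simp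
  have card\<pi>: "card ?\<pi> = 3" using neA AH T(1,2) by (auto simp: card_insert_if)
  have three: "3 \<le> card X"
    using card_refines[OF fin singletons_refines[OF \<pi>]] card\<pi> by (simp add: singletons_def card_image)
  have u_unique: "z = u" if z: "z \<in> \<PP>" "fst ` z = singletons X" "hybrids z = {H}" "cactus_le u z \<or> cactus_le z u" for z
    using z(4) cactus_le_eqI[OF fin uP z(1)] cactus_le_eqI[OF fin z(1) uP] z(2,3) hu fu by auto
  have special: "cmin \<notin> ?Z" "cmax \<notin> ?Z"
    using cactus_le_min_iff[OF uP] max_le[OF tP] tmax hu hybrids_min by auto
  have F: "?F = (\<lambda>C. C \<union> {cmin, cmax}) ` chains_through ?Z cactus_le {u, t}"
  proof (intro equalityI subsetI)
    fix C assume C: "C \<in> ?F"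
    then have C': "C \<in> cchains" "t \<in> C" "C \<inter> N = {}" "C \<inter> M = E" by auto
    have uC': "u \<in> C" using E C'(4) by blast
    note c = cchainsD[OF C'(1)]
    have "C - {cmin, cmax} \<in> chains_through ?Z cactus_le {u, t}"
    proof (rule chains_throughI)
      show "C - {cmin, cmax} \<subseteq> ?Z"
      proof
        fix z assume z: "z \<in> C - {cmin, cmax}"
        have zP: "z \<in> \<PP>" using c(1) z by blast
        have hz: "hybrids z \<subseteq> {H}" using z C'(3) N ht by auto
        have zt: "cactus_le z t" using below_t[OF zP] c(5)[OF _ C'(2), of z] z by blast
        have "cactus_le u z"
        proof (rule ccontr)
          assume no: "\<not> cactus_le u z"
          then have zu: "cactus_le z u" using c(5)[OF _ uC', of z] z by blast
          \<comment> \<open>A member below \<open>u\<close> has singleton blocks too: without a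
            hybrid it is the minimum, with the hybrid \<open>H\<close> it is
            \<open>u\<close>.\<close>
          have fz: "fst ` z = singletons X"
            using cactus_le_refines[OF zP uP zu] fu refines_singletons by simp
          show False
          proof (cases "hybrids z = {}")
            case True
            then show False using mark_fst[OF True] fz mark_singletons[of X] z by auto
          next
            case False
            then have "hybrids z = {H}" using hz by auto
            then show False using u_unique[OF zP fz _ ] zu no cactus_le_refl by blast
          qed
        qed
        then show "z \<in> ?Z" using zP zt hz by blast
      qed
      show "{u, t} \<subseteq> C - {cmin, cmax}"
        using uC' C'(2) tmax \<open>u \<noteq> cmax\<close> not_min by simp
    qed (use c in auto)
    moreover have "C = (C - {cmin, cmax}) \<union> {cmin, cmax}" using c(3,4) by blast
    ultimately show "C \<in> (\<lambda>C. C \<union> {cmin, cmax}) ` chains_through ?Z cactus_le {u, t}" by blast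
  next
    fix C assume "C \<in> (\<lambda>C. C \<union> {cmin, cmax}) ` chains_through ?Z cactus_le {u, t}"
    then obtain D where D: "D \<in> chains_through ?Z cactus_le {u, t}" "C = D \<union> {cmin, cmax}" by blast
    note d = chains_throughD[OF D(1)]
    have dP: "z \<in> \<PP>" and dZ: "cactus_le u z" "cactus_le z t" "hybrids z \<subseteq> {H}" if "z \<in> D" for z
      using d(1) that by auto
    have "C \<in> cchains"
      unfolding D(2) by (rule cchains_Un_bounds[OF _ d(2,4)]) (use dP in blast)
    moreover have "t \<in> C" "u \<in> C" using d(3) D(2) by auto
    moreover have "C \<inter> T = {t} \<inter> T"
    proof -
      have "z = t" if z: "z \<in> C" "z \<in> T" for z
      proof -
        have "z \<noteq> cmax" "z \<noteq> cmin" using coatom_tripleD(2,3)[OF z(2)] hybrids_min by metis+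
        then have "cactus_le z t" using z(1) D(2) dZ by blast
        then show ?thesis using coatom_tripleD(4)[OF z(2) tP] tmax by blast
      qed
      then show ?thesis using \<open>t \<in> C\<close> by blast
    qed
    moreover have "C \<inter> N = {}" using dZ(3) by (auto simp: D(2) N ht hybrids_min hybrids_max)
    moreover have "C \<inter> M = E"
    proof -
      have only_u: "z = u" if z: "z \<in> C" "z \<in> M" for z
      proof -
        have "z \<noteq> cmin" "z \<noteq> cmax" using z(2) M hybrids_min hybrids_max by auto
        then have zD: "z \<in> D" using z(1) D(2) by blast
        then have "hybrids z = {H}" using dZ(3)[OF zD] z(2) M by blast
        then show ?thesis using u_unique[of z] dP[OF zD] dZ(1)[OF zD] z(2) M by blast
      qed
      moreover have "E \<subseteq> {u}"
      proof
        fix z assume z: "z \<in> E"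
        then have z': "z \<in> C0" "z \<in> M" "z \<notin> N" using C0 by auto
        then have "hybrids z = {H}" using M N ht by auto
        then show "z \<in> {u}" using u_unique[of z] z' M cchainsD(5)[OF C0(1) uC z'(1)] by auto
      qed
      ultimately show ?thesis using \<open>u \<in> C\<close> uM E by blast
    qed
    ultimately show "C \<in> ?F" by blast
  qed
  have "dismantles (\<lambda>C. card C = card X - card ?\<pi> + 1) (chains_through ?Z cactus_le {?g (singletons X), ?g ?\<pi>})"
    by (rule dismantles_partition_chains_image[OF fin \<pi> bij mark_le_iff[OF _ _ LX]])
  \<comment> \<open>\<open>3 \<le> card X\<close> keeps the truncated subtraction exact; adding
    minimum and maximum then brings the size back to \<open>card X\<close>.\<close>
  moreover have "card X - card ?\<pi> + 1 = card X - 2" using three card\<pi> by simp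
  ultimately have "dismantles (\<lambda>C. card C = card X - 2) (chains_through ?Z cactus_le {u, t})"
    by (simp only: u_mark[symmetric] t_mark[symmetric])
  then show ?thesis
    unfolding F
  proof (rule dismantles_Un_fixed)
    show dis: "C \<inter> {cmin, cmax} = {}" if "C \<in> chains_through ?Z cactus_le {u, t}" for C
      using chains_throughD(1)[OF that] special by blast
    show "card (C \<union> {cmin, cmax}) = card X"
      if C: "C \<in> chains_through ?Z cactus_le {u, t}" "card C = card X - 2" for C
      using card_Un_disjoint[OF chains_throughD(2)[OF C(1)] _ dis[OF C(1)]] C(2) three min_neq_max by simp
  qed simp
qed

text \<open>Different coatom triples are incomparable, so the trace on \<open>T\<close> has at most
  one element and determines \<open>t\<close>.\<close>

lemma dismantles_cactus_chains: "dismantles (\<lambda>C. card C = card X) cchains"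
proof (rule dismantles_fibres[OF finite_cchains, where N = T])
  fix D
  let ?F = "{C \<in> cchains. C \<inter> T = D}"
  let ?G = "\<lambda>t. {C \<in> cchains. t \<in> C \<and> C \<inter> T = {t} \<inter> T}"
  consider "?F = {}" | "?F = ?G cmax" | t where "t \<in> T" "?F = ?G t"
  proof (cases "?F = {}")
    case False
    then obtain C0 where C0: "C0 \<in> cchains" "C0 \<inter> T = D" by blast
    show ?thesis
    proof (cases "D = {}")
      case True
      have "?F = ?G cmax" using True cchainsD(4) coatom_tripleD(2) by blast
      then show ?thesis using that by blast
    next
      case False
      then obtain t where t: "t \<in> D" by blast
      have tT: "t \<in> T" using t C0(2) by blast
      have "z = t" if z: "z \<in> D" for z
      proof -
        have zT: "z \<in> T" using z C0(2) by blast
        have "cactus_le t z \<or> cactus_le z t" using cchainsD(5)[OF C0(1)] z t C0(2) by blast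
        then show ?thesis
          using coatom_tripleD(4)[OF tT coatom_tripleD(1)[OF zT]] coatom_tripleD(4)[OF zT coatom_tripleD(1)[OF tT]]
            coatom_tripleD(2)[OF tT] coatom_tripleD(2)[OF zT] by blast
      qed
      then have "D = {t}" using t by blast
      then have "?F = ?G t" using tT by blast
      then show ?thesis using that tT by blast
    qed
  qed
  then show "dismantles (\<lambda>C. card C = card X) ?F"
  proof cases
    case 1
    show ?thesis unfolding 1 by (rule dismantles.empty)
  next
    case 2
    show ?thesis
      unfolding 2
    proof (rule dismantles_fibres[where N = "{x. \<not> hybrids x \<subseteq> hybrids cmax}"])
      fix E
      show "dismantles (\<lambda>C. card C = card X) {C \<in> ?G cmax. C \<inter> {x. \<not> hybrids x \<subseteq> hybrids cmax} = E}"
      proof (cases "E = {}")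
        case True
        then show ?thesis using dismantles_unlabelled_chains by simp
      next
        case False
        then show ?thesis
          by (intro dismantles_uncollapsed_fibre[OF cactus_max_in[OF X_nonempty] _ refl]) simp_all
      qed
    qed (use finite_cchains in simp)
  next
    case (3 t)
    let ?N = "{x. \<not> hybrids x \<subseteq> hybrids t}"
    let ?M = "{u \<in> \<PP>. hybrids u \<noteq> {} \<and> fst ` u = singletons X}"
    show ?thesis
      unfolding 3(2)
    proof (rule dismantles_fibres[where N = ?N])
      fix E
      show "dismantles (\<lambda>C. card C = card X) {C \<in> ?G t. C \<inter> ?N = E}"
      proof (cases "E = {}")
        case True
        show ?thesis
          unfolding True
        proof (rule dismantles_fibres[where N = ?M])
          fix E'
          show "dismantles (\<lambda>C. card C = card X) {C \<in> {C \<in> ?G t. C \<inter> ?N = {}}. C \<inter> ?M = E'}"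
          proof (cases "E' = {}")
            case True
            show ?thesis unfolding True by (rule dismantles_forget_fibre[OF 3(1) refl refl])
          next
            case False
            then obtain u where "u \<in> E'" by blast
            then show ?thesis by (rule dismantles_atom_fibre[OF 3(1) refl refl])
          qed
        qed (use finite_cchains in simp)
      next
        case False
        show ?thesis
          by (rule dismantles_uncollapsed_fibre[OF coatom_tripleD(1)[OF 3(1)] _ refl False])
            (simp add: 3(1))
      qed
    qed (use finite_cchains in simp)
  qed
qed

lemma dismantles_proper_cactus_complex:
  "dismantles (\<lambda>C. card C = card X - 2) (order_complex (\<PP> - {cmin, cmax}) cactus_le)"
proof -
  have "(\<lambda>C. C - {cmin, cmax}) ` cchains = order_complex (\<PP> - {cmin, cmax}) cactus_le"
  proof (intro equalityI subsetI)
    fix C assume "C \<in> (\<lambda>C. C - {cmin, cmax}) ` cchains"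
    then obtain D where D: "D \<in> cchains" "C = D - {cmin, cmax}" by blast
    then show "C \<in> order_complex (\<PP> - {cmin, cmax}) cactus_le"
      using cchainsD[OF D(1)] by (auto simp: order_complex_def chain_def)
  next
    fix C assume C: "C \<in> order_complex (\<PP> - {cmin, cmax}) cactus_le"
    then have c: "C \<subseteq> \<PP> - {cmin, cmax}" "finite C"
      "\<And>x y. x \<in> C \<Longrightarrow> y \<in> C \<Longrightarrow> cactus_le x y \<or> cactus_le y x"
      by (auto simp: order_complex_def chain_def)
    have "C \<union> {cmin, cmax} \<in> cchains"
      by (rule cchains_Un_bounds[OF _ c(2,3)]) (use c(1) in blast)
    moreover have "C = C \<union> {cmin, cmax} - {cmin, cmax}" using c(1) by blast
    ultimately show "C \<in> (\<lambda>C. C - {cmin, cmax}) ` cchains" by blast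
  qed
  moreover have "dismantles (\<lambda>C. card C = card X - 2) ((\<lambda>C. C - {cmin, cmax}) ` cchains)"
  proof (rule dismantles_Diff_fixed[OF dismantles_cactus_chains])
    show sub: "{cmin, cmax} \<subseteq> C" if "C \<in> cchains" for C using chains_throughD(3)[OF that] .
    show "card (C - {cmin, cmax}) = card X - 2" if "C \<in> cchains" "card C = card X" for C
      using card_Diff_subset[OF _ sub[OF that(1)]] that(2) min_neq_max by simp
  qed
  ultimately show ?thesis by simp
qed

lemma card_proper_chain:
  assumes "C \<in> order_complex (\<PP> - {cmin, cmax}) cactus_le"
  shows "card C \<le> card X - 2"
proof -
  have c: "C \<subseteq> \<PP> - {cmin, cmax}" "finite C" "\<And>x y. x \<in> C \<Longrightarrow> y \<in> C \<Longrightarrow> cactus_le x y \<or> cactus_le y x"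
    using assms by (auto simp: order_complex_def chain_def)
  have "C \<union> {cmin, cmax} \<in> cchains"
    by (rule cchains_Un_bounds[OF _ c(2,3)]) (use c(1) in blast)
  then have "C \<union> {cmin, cmax} \<in> order_complex \<PP> cactus_le" by (simp add: chains_through_def)
  then have "card (C \<union> {cmin, cmax}) \<le> card X" by (rule card_chain_ranked_cactuses[OF fin X_nonempty])
  moreover have "card (C \<union> {cmin, cmax}) = card C + 2"
    using card_Un_disjoint[OF c(2), of "{cmin, cmax}"] c(1) min_neq_max by auto
  ultimately show ?thesis by simp
qed

end

theorem corollary5p1:
  fixes n :: nat
  assumes "n \<ge> 1"
  shows "homotopy_type_of_wedge_of_spheres (proper_cactus_link {1..n})"
proof -
  let ?X = "{1..n}"
  let ?P = "ranked_cactuses ?X - {cactus_min ?X, cactus_max ?X}"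
  let ?K = "order_complex ?P cactus_le"
  have ne: "?X \<noteq> {}" using assms by simp
  have K: "proper_cactus_complex ?X = ?K"
    unfolding proper_cactus_complex_def proper_part_ranked_cactuses[OF ne] by (rule refl)
  have link: "proper_cactus_link ?X = geometric_realization ?K"
    using proper_cactus_link_eq[OF _ ne] K by simp
  have sc: "simplicial_complex ?K"
    unfolding simplicial_complex_def
  proof (intro conjI ballI allI impI)
    show "finite ?K" by (rule finite_order_complex) (simp add: finite_ranked_cactuses)
    show "finite s" if "s \<in> ?K" for s using that by (simp add: order_complex_def)
    show "t \<in> ?K" if "s \<in> ?K" "t \<subseteq> s" for s t
      using that by (auto simp: order_complex_def chain_def intro: finite_subset)
  qed
  have ne': "{} \<in> ?K" by (simp add: order_complex_def chain_def)
  show ?thesis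
  proof (cases "n = 1")
    \<comment> \<open>Minimum and maximum coincide, so the count \<open>card X - 2\<close> does not
      apply; the proper part is empty and its realization is the sphere of dimension -1.\<close>
    case True
    have eq: "cactus_min ?X = cactus_max ?X" using True by (auto simp: cactus_min_def cactus_max_def)
    have "s = cactus_max ?X" if s: "s \<in> ranked_cactuses ?X" for s
      using cactus_max_le_iff[OF ne s] cactus_min_le[OF s] eq by simp
    then have "?P = {}" by blast
    then have "vertex_support x = {}" if "x \<in> topspace (geometric_realization ?K)" for x
      using that unfolding geometric_realization_iff[OF sc] by (auto simp: order_complex_def)
    then have "topspace (geometric_realization ?K) = {}"
      using geometric_realization_nonempty_support by blast
    then show ?thesis unfolding link homotopy_type_of_wedge_of_spheres_def by blast
  next
    case False
    then have two: "2 \<le> card ?X" using assms by simp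
    show ?thesis
      unfolding link
    proof (rule wedge_of_spheres_if_dismantles[OF sc])
      show "?K \<noteq> {}" using ne' by blast
      show "card \<tau> \<le> card ?X - 2" if "\<tau> \<in> ?K" for \<tau>
        using card_proper_chain[OF _ two that] by simp
      show "dismantles (\<lambda>\<tau>. card \<tau> = card ?X - 2) ?K"
        using dismantles_proper_cactus_complex[OF _ two] by simp
    qed
  qed
qed

end
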